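(* Let $(H,K)$ be a strong Shoda pair of a finite group $G$ such that $\tau(gH,g'H)=1$ for all $g,g'\in N_G(K)$, where $\tau$ is the twisting described in the context. Let $\varepsilon=\varepsilon(H,K)$ and $e=e(G,H,K)$. Let $F$ denote the fixed subfield of $\mathbb{Q}H\varepsilon$ under the natural action of $N_G(K)/H$, and let $n=[N_G(K):H]$. Let $w$ be a normal element of $\mathbb{Q}H\varepsilon/F$ and $B$ the normal basis determined by $w$. Let $\psi$ be the isomorphism between $\mathbb{Q}N_G(K)\varepsilon$ and the matrix algebra $M_n(F)$ with respect to the basis $B$ described in the context. Let $P,A\in M_n(F)$ be the matrices $$P= \begin{pmatrix} 1 & 1 & 1 & \cdots & 1 & 1\\ 1 & -1 & 0 & \cdots & 0 & 0\\ 1 & 0 & -1 & \cdots & 0 & 0\\ \vdots & \vdots & \vdots & \ddots & \vdots & \vdots\\ 1 & 0 & 0 & \cdots & -1 & 0\\ 1 & 0 & 0 & \cdots & 0 & -1 \end{pmatrix} \quad\text{and}\quad A= \begin{pmatrix} 0 & 0 & \cdots & 0 & 1\\ 1 & 0 & \cdots & 0 & 0\\ 0 & 1 & \cdots & 0 & 0\\ \vdots & \vdots & \ddots & \vdots & \vdots\\ 0 & 0 & \cdots & 0 & 0\\ 0 & 0 & \cdots & 1 & 0 \end{pmatrix}.$$ Then $$\{x\widehat{T_1}\varepsilon x^{-1} \mid x\in T_2\langle x_e\rangle\}$$ is a complete set of orthogonal primitive idempotents of $\mathbb{Q}Ge$, where $x_e=\psi^{-1}(PAP^{-1})$, $T_1$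 is a transversal of $H$ in $N_G(K)$, $T_2$ is a right transversal of $N_G(K)$ in $G$, and $\widehat{T_1}$ denotes the element $\frac{1}{|T_1|}\sum_{t\in T_1}t$ of $\mathbb{Q}G$.
   Context: For a subgroup $H$ of a finite group $G$, $\widehat{H}=\frac1{|H|}\sum_{h\in H}h\in\mathbb{Q}G$. For $K\lhd H\le G$ with $K\ne H$, put $\varepsilon(H,K)=\prod_M(\widehat{K}-\widehat{M})$, where $M$ runs over the minimal elements of the set of normal subgroups of $H$ properly containing $K$; put $\varepsilon(H,H)=\widehat{H}$. Let $e(G,H,K)$ be the sum of the distinct $G$-conjugates of $\varepsilon(H,K)$. A strong Shoda pair of $G$ is a pair $(H,K)$ of subgroups with $K\le H\unlhd N_G(K)$, $H/K$ cyclic and a maximal abelian subgroup of $N_G(K)/K$, and the distinct $G$-conjugates of $\varepsilon(H,K)$ pairwise orthogonal. In this case the centralizer of $\varepsilon(H,K)$ in $G$ is $N_G(K)$ and $e(G,H,K)$ is a primitive central idempotent of $\mathbb{Q}G$. Let $N=N_G(K)$, $k=[H:K]$, $H/K=\langle yK\rangle$, and let $\phi:N/H\to N/K$ be a section of the canonical projection $N/K\to N/H$. Then $\mathbb{Q}H\varepsilon\cong\mathbb{Q}(\zeta_k)$ is a field with identity $\varepsilon$ ($\zeta_k$ a complex primitive $k$-th root of unity), on which $N/H$ acts faithfully by conjugation, so $N/H$ is identified with $\mathrm{Gal}(\mathbb{Q}H\varepsilon/F)$, where $F$ is the fixed field. The twisting is $\tau(gH,g'H)=\zeta_k^j$ if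 $\phi(gg'H)^{-1}\phi(gH)\phi(g'H)=y^jK$. For a coset $tK\in N/K$ the element $t\varepsilon$ depends only on $tK$; write $\phi(gH)\varepsilon$ accordingly. The algebra $\mathbb{Q}N\varepsilon=\bigoplus_{gH\in N/H}\mathbb{Q}H\varepsilon\cdot\phi(gH)\varepsilon$ is a crossed product of $\mathbb{Q}H\varepsilon$ by $N/H$ with twisting $\tau$. A normal element of a finite Galois extension $E/F$ is $w\in E$ such that $\{\sigma(w):\sigma\in\mathrm{Gal}(E/F)\}$ is an $F$-basis of $E$ (the normal basis determined by $w$). The isomorphism $\psi$: when $\tau=1$, $\psi:\mathbb{Q}N\varepsilon\to\mathrm{End}_F(\mathbb{Q}H\varepsilon)\to M_n(F)$ is the $F$-algebra isomorphism sending $x\,\phi(gH)\varepsilon$ (with $x\in\mathbb{Q}H\varepsilon$) to the matrix in the basis $B$ of the $F$-linear map $v\mapsto x\cdot\sigma_g(v)$, where $\sigma_g\in\mathrm{Gal}(\mathbb{Q}H\varepsilon/F)$ is the automorphism $\sigma_g(v)=gvg^{-1}$. In $P$ the first row and first column consist of ones, $P_{ii}=-1$ for $i\ge2$, and all other entries are $0$; $A$ has $A_{i+1,i}=1$ for $1\le i<n$, $A_{1,n}=1$, and all other entries $0$. $\langle x_e\rangle$ is the cyclic group generated by $x_e$ in the unit group of $\mathbb{Q}N\varepsilon$ (identity $\varepsilon$); $T_2\langle x_e\rangle=\{t x_e^i : t\in T_2,\ i\in\mathbb{Z}\}$, and for $x=tx_e^i$ we write $x^{-1}=x_e^{-i}t^{-1}$.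 A complete set of orthogonal primitive idempotents of $\mathbb{Q}Ge$ is a set of pairwise orthogonal primitive idempotents with sum $e$.
   Formalization: T_1 is required to represent the section φ with trivial twisting (tK = φ(tH) for t in T_1), since the claim fails for arbitrary transversals (e.g. G = S_3, T_1 = {y, s}); the right transversal T_2 is read as representing the cosets tN, as conjugation x·x^{-1} requires. *)

theory Defs
  imports Complex_Main "HOL-Algebra.Group_Action" "HOL-Algebra.Elementary_Groups"
    "HOL-Algebra.QuotRing" "HOL-Algebra.Embedded_Algebras"
begin

section \<open>The rational group algebra of a finite group\<close>

text \<open>Elements are coefficient functions vanishing outside the group. Without a finite-support
  condition this is the group algebra only for a finite group, the only case used here.\<close>

definition group_algebra :: "('a, 'b) monoid_scheme \<Rightarrow> ('a \<Rightarrow> rat) ring" where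
  "group_algebra G = \<lparr>
     carrier = {a. \<forall>g. g \<notin> carrier G \<longrightarrow> a g = 0},
     monoid.mult = (\<lambda>a b g. if g \<in> carrier G
               then \<Sum>h\<in>carrier G. a h * b (inv\<^bsub>G\<^esub> h \<otimes>\<^bsub>G\<^esub> g) else 0),
     monoid.one = (\<lambda>g. if g = \<one>\<^bsub>G\<^esub> then 1 else 0),
     ring.zero = (\<lambda>g. 0),
     ring.add = (\<lambda>a b g. a g + b g) \<rparr>"

definition basis_elt :: "'a \<Rightarrow> 'a \<Rightarrow> rat" where
  "basis_elt g = (\<lambda>h. if h = g then 1 else 0)"

definition hat :: "'a set \<Rightarrow> 'a \<Rightarrow> rat" where
  "hat S = (\<lambda>g. if g \<in> S then 1 / of_nat (card S) else 0)"

definition conj_by :: "('a, 'b) monoid_scheme \<Rightarrow> 'a \<Rightarrow> ('a \<Rightarrow> rat) \<Rightarrow> 'a \<Rightarrow> rat" where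
  "conj_by G g a = basis_elt g \<otimes>\<^bsub>group_algebra G\<^esub> a
                     \<otimes>\<^bsub>group_algebra G\<^esub> basis_elt (inv\<^bsub>G\<^esub> g)"

definition conjugates :: "('a, 'b) monoid_scheme \<Rightarrow> ('a \<Rightarrow> rat) \<Rightarrow> ('a \<Rightarrow> rat) set" where
  "conjugates G a = (\<lambda>g. conj_by G g a) ` carrier G"

text \<open>The ring \<open>\<rat>S c\<close> with identity \<open>c\<close>, for a subgroup \<open>S\<close> and an idempotent \<open>c\<close> commuting
  with \<open>\<rat>S\<close>.\<close>

definition alg_component ::
    "('a, 'b) monoid_scheme \<Rightarrow> 'a set \<Rightarrow> ('a \<Rightarrow> rat) \<Rightarrow> ('a \<Rightarrow> rat) ring" where
  "alg_component G S c = (group_algebra G)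
     \<lparr> carrier := (\<lambda>a. a \<otimes>\<^bsub>group_algebra G\<^esub> c) `
                    {a \<in> carrier (group_algebra G). \<forall>g. g \<notin> S \<longrightarrow> a g = 0},
       monoid.one := c \<rparr>"


section \<open>Strong Shoda pairs\<close>

definition minimal_normals_above ::
    "('a, 'b) monoid_scheme \<Rightarrow> 'a set \<Rightarrow> 'a set \<Rightarrow> 'a set set" where
  "minimal_normals_above G H K =
     {M. M \<lhd> (G\<lparr>carrier := H\<rparr>) \<and> K \<subset> M \<and>
         (\<forall>L. L \<lhd> (G\<lparr>carrier := H\<rparr>) \<and> K \<subset> L \<and> L \<subseteq> M \<longrightarrow> L = M)}"

text \<open>The factors below are central in \<open>\<rat>H\<close>, hence commute, so the product does not
  depend on an order although the group algebra is not commutative.\<close>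

definition eps :: "('a, 'b) monoid_scheme \<Rightarrow> 'a set \<Rightarrow> 'a set \<Rightarrow> 'a \<Rightarrow> rat" where
  "eps G H K = (if H = K then hat H
     else \<Otimes>\<^bsub>group_algebra G\<^esub>M\<in>minimal_normals_above G H K. (hat K \<ominus>\<^bsub>group_algebra G\<^esub> hat M))"

definition pci :: "('a, 'b) monoid_scheme \<Rightarrow> 'a set \<Rightarrow> 'a set \<Rightarrow> 'a \<Rightarrow> rat" where
  "pci G H K = (\<Oplus>\<^bsub>group_algebra G\<^esub>a\<in>conjugates G (eps G H K). a)"

definition maximal_abelian_subgroup :: "'a set \<Rightarrow> ('a, 'b) monoid_scheme \<Rightarrow> bool" where
  "maximal_abelian_subgroup A Q \<longleftrightarrow>
     subgroup A Q \<and> comm_group (Q\<lparr>carrier := A\<rparr>) \<and>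
     (\<forall>B. subgroup B Q \<and> comm_group (Q\<lparr>carrier := B\<rparr>) \<and> A \<subseteq> B \<longrightarrow> B = A)"

abbreviation quot :: "('a, 'b) monoid_scheme \<Rightarrow> 'a set \<Rightarrow> 'a set \<Rightarrow> 'a set monoid" where
  "quot G S K \<equiv> (G\<lparr>carrier := S\<rparr>) Mod K"

definition strong_shoda_pair :: "('a, 'b) monoid_scheme \<Rightarrow> 'a set \<Rightarrow> 'a set \<Rightarrow> bool" where
  "strong_shoda_pair G H K \<longleftrightarrow>
     subgroup H G \<and> subgroup K G \<and> K \<subseteq> H \<and>
     H \<lhd> (G\<lparr>carrier := normalizer G K\<rparr>) \<and>
     cyclic_group (quot G H K) \<and>
     maximal_abelian_subgroup (carrier (quot G H K)) (quot G (normalizer G K) K) \<and>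
     (\<forall>a\<in>conjugates G (eps G H K). \<forall>b\<in>conjugates G (eps G H K).
        a \<noteq> b \<longrightarrow> a \<otimes>\<^bsub>group_algebra G\<^esub> b = \<zero>\<^bsub>group_algebra G\<^esub>)"


section \<open>Sections and the twisting\<close>

text \<open>The canonical projection \<open>N/K \<rightarrow> N/H\<close> sends a coset \<open>C\<close> of \<open>K\<close> to \<open>H <#> C\<close>.\<close>

definition is_section ::
    "('a, 'b) monoid_scheme \<Rightarrow> 'a set \<Rightarrow> 'a set \<Rightarrow> ('a set \<Rightarrow> 'a set) \<Rightarrow> bool" where
  "is_section G H K \<phi> \<longleftrightarrow>
     (\<forall>c\<in>carrier (quot G (normalizer G K) H).
        \<phi> c \<in> carrier (quot G (normalizer G K) K) \<and> H <#>\<^bsub>G\<^esub> \<phi> c = c)"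

definition primitive_root_of_unity :: "nat \<Rightarrow> complex \<Rightarrow> bool" where
  "primitive_root_of_unity k \<zeta> \<longleftrightarrow> \<zeta> ^ k = 1 \<and> (\<forall>j. 0 < j \<and> j < k \<longrightarrow> \<zeta> ^ j \<noteq> 1)"

text \<open>The exponent \<open>j\<close> is determined modulo \<open>[H : K]\<close>, so \<open>\<zeta> ^ j\<close> does not depend on the
  choice when \<open>\<zeta>\<close> is a root of unity of order \<open>[H : K]\<close>.\<close>

definition twisting ::
    "('a, 'b) monoid_scheme \<Rightarrow> 'a set \<Rightarrow> 'a set \<Rightarrow> ('a set \<Rightarrow> 'a set) \<Rightarrow> 'a \<Rightarrow> complex \<Rightarrow>
     'a set \<Rightarrow> 'a set \<Rightarrow> complex" where
  "twisting G H K \<phi> y \<zeta> c d =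
     (let NH = quot G (normalizer G K) H; NK = quot G (normalizer G K) K
      in \<zeta> ^ (SOME j::nat.
           inv\<^bsub>NK\<^esub> (\<phi> (c \<otimes>\<^bsub>NH\<^esub> d)) \<otimes>\<^bsub>NK\<^esub> \<phi> c \<otimes>\<^bsub>NK\<^esub> \<phi> d = (K #>\<^bsub>G\<^esub> y) [^]\<^bsub>NK\<^esub> j))"


section \<open>The field \<open>\<rat>H\<epsilon>\<close>, its fixed field and normal elements\<close>

abbreviation QHe :: "('a, 'b) monoid_scheme \<Rightarrow> 'a set \<Rightarrow> 'a set \<Rightarrow> ('a \<Rightarrow> rat) ring" where
  "QHe G H K \<equiv> alg_component G H (eps G H K)"

abbreviation QNe :: "('a, 'b) monoid_scheme \<Rightarrow> 'a set \<Rightarrow> 'a set \<Rightarrow> ('a \<Rightarrow> rat) ring" where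
  "QNe G H K \<equiv> alg_component G (normalizer G K) (eps G H K)"

definition fixed_field ::
    "('a, 'b) monoid_scheme \<Rightarrow> 'a set \<Rightarrow> 'a set \<Rightarrow> ('a \<Rightarrow> rat) set" where
  "fixed_field G H K = {v \<in> carrier (QHe G H K). \<forall>g\<in>normalizer G K. conj_by G g v = v}"

definition Gal :: "('r, 's) ring_scheme \<Rightarrow> 'r set \<Rightarrow> ('r \<Rightarrow> 'r) set" where
  "Gal E F = {\<sigma> \<in> ring_iso E E \<inter> extensional (carrier E). \<forall>x\<in>F. \<sigma> x = x}"

definition ordered_basis :: "('r, 's) ring_scheme \<Rightarrow> 'r set \<Rightarrow> 'r list \<Rightarrow> bool" where
  "ordered_basis E F bs \<longleftrightarrow> ring.independent E F bs \<and> ring.Span E F bs = carrier E"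

definition normal_element :: "('r, 's) ring_scheme \<Rightarrow> 'r set \<Rightarrow> 'r \<Rightarrow> bool" where
  "normal_element E F w \<longleftrightarrow>
     w \<in> carrier E \<and> (\<exists>bs. set bs = (\<lambda>\<sigma>. \<sigma> w) ` Gal E F \<and> ordered_basis E F bs)"


section \<open>Matrices\<close>

text \<open>Rows and columns are numbered from \<open>0\<close>.\<close>

definition mat_ring :: "nat \<Rightarrow> ('r, 's) ring_scheme \<Rightarrow> (nat \<times> nat \<Rightarrow> 'r) ring" where
  "mat_ring n R = (let I = {..<n} \<times> {..<n} in \<lparr>
     carrier = I \<rightarrow>\<^sub>E carrier R,
     monoid.mult = (\<lambda>M N. \<lambda>(i, j)\<in>I. \<Oplus>\<^bsub>R\<^esub>k\<in>{..<n}. M (i, k) \<otimes>\<^bsub>R\<^esub> N (k, j)),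
     monoid.one = (\<lambda>(i, j)\<in>I. if i = j then \<one>\<^bsub>R\<^esub> else \<zero>\<^bsub>R\<^esub>),
     ring.zero = (\<lambda>(i, j)\<in>I. \<zero>\<^bsub>R\<^esub>),
     ring.add = (\<lambda>M N. \<lambda>(i, j)\<in>I. M (i, j) \<oplus>\<^bsub>R\<^esub> N (i, j)) \<rparr>)"

definition P_mat :: "nat \<Rightarrow> ('r, 's) ring_scheme \<Rightarrow> nat \<times> nat \<Rightarrow> 'r" where
  "P_mat n R = (\<lambda>(i, j)\<in>{..<n} \<times> {..<n}.
     if i = 0 \<or> j = 0 then \<one>\<^bsub>R\<^esub> else if i = j then \<ominus>\<^bsub>R\<^esub> \<one>\<^bsub>R\<^esub> else \<zero>\<^bsub>R\<^esub>)"

definition A_mat :: "nat \<Rightarrow> ('r, 's) ring_scheme \<Rightarrow> nat \<times> nat \<Rightarrow> 'r" where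
  "A_mat n R = (\<lambda>(i, j)\<in>{..<n} \<times> {..<n}.
     if i = Suc j \<or> (i = 0 \<and> j = n - 1) then \<one>\<^bsub>R\<^esub> else \<zero>\<^bsub>R\<^esub>)"

text \<open>Column \<open>j\<close> consists of the coordinates of the image of the \<open>j\<close>-th basis vector.\<close>

definition matrix_of ::
    "('r, 's) ring_scheme \<Rightarrow> 'r set \<Rightarrow> 'r list \<Rightarrow> ('r \<Rightarrow> 'r) \<Rightarrow> nat \<times> nat \<Rightarrow> 'r" where
  "matrix_of E F bs f =
     (THE M. M \<in> carrier (mat_ring (length bs) (E\<lparr>carrier := F\<rparr>)) \<and>
        (\<forall>j<length bs. f (bs ! j) = (\<Oplus>\<^bsub>E\<^esub>i\<in>{..<length bs}. M (i, j) \<otimes>\<^bsub>E\<^esub> bs ! i)))"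


section \<open>The crossed product structure of \<open>\<rat>N\<epsilon>\<close> and the isomorphism \<open>\<psi>\<close>\<close>

text \<open>\<open>t\<epsilon>\<close> for any \<open>t\<close> in the coset \<open>C \<in> N/K\<close>, and \<open>v \<mapsto> g v g\<^sup>-\<^sup>1\<close> on \<open>\<rat>H\<epsilon>\<close> for any \<open>g\<close> in the
  coset \<open>c \<in> N/H\<close>; neither depends on the representative.\<close>

definition coset_eps ::
    "('a, 'b) monoid_scheme \<Rightarrow> 'a set \<Rightarrow> 'a set \<Rightarrow> 'a set \<Rightarrow> 'a \<Rightarrow> rat" where
  "coset_eps G H K C = basis_elt (SOME t. t \<in> C) \<otimes>\<^bsub>group_algebra G\<^esub> eps G H K"

definition coset_act :: "('a, 'b) monoid_scheme \<Rightarrow> 'a set \<Rightarrow> ('a \<Rightarrow> rat) \<Rightarrow> 'a \<Rightarrow> rat" where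
  "coset_act G c v = conj_by G (SOME g. g \<in> c) v"

text \<open>The coefficients \<open>x\<^sub>c \<in> \<rat>H\<epsilon>\<close> of \<open>a = \<Sum>\<^sub>c x\<^sub>c \<phi>(c)\<epsilon> \<in> \<rat>N\<epsilon>\<close>, where \<open>c\<close> runs over \<open>N/H\<close>.\<close>

definition crossed_coeffs ::
    "('a, 'b) monoid_scheme \<Rightarrow> 'a set \<Rightarrow> 'a set \<Rightarrow> ('a set \<Rightarrow> 'a set) \<Rightarrow>
     ('a \<Rightarrow> rat) \<Rightarrow> 'a set \<Rightarrow> 'a \<Rightarrow> rat" where
  "crossed_coeffs G H K \<phi> a =
     (THE x. x \<in> carrier (quot G (normalizer G K) H) \<rightarrow>\<^sub>E carrier (QHe G H K) \<and>
        a = (\<Oplus>\<^bsub>group_algebra G\<^esub>c\<in>carrier (quot G (normalizer G K) H).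
               x c \<otimes>\<^bsub>group_algebra G\<^esub> coset_eps G H K (\<phi> c)))"

definition crossed_endo ::
    "('a, 'b) monoid_scheme \<Rightarrow> 'a set \<Rightarrow> 'a set \<Rightarrow> ('a set \<Rightarrow> 'a set) \<Rightarrow>
     ('a \<Rightarrow> rat) \<Rightarrow> ('a \<Rightarrow> rat) \<Rightarrow> 'a \<Rightarrow> rat" where
  "crossed_endo G H K \<phi> a v =
     (\<Oplus>\<^bsub>group_algebra G\<^esub>c\<in>carrier (quot G (normalizer G K) H).
        crossed_coeffs G H K \<phi> a c \<otimes>\<^bsub>group_algebra G\<^esub> coset_act G c v)"

definition psi ::
    "('a, 'b) monoid_scheme \<Rightarrow> 'a set \<Rightarrow> 'a set \<Rightarrow> ('a set \<Rightarrow> 'a set) \<Rightarrow> ('a \<Rightarrow> rat) list \<Rightarrow>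
     ('a \<Rightarrow> rat) \<Rightarrow> nat \<times> nat \<Rightarrow> 'a \<Rightarrow> rat" where
  "psi G H K \<phi> bs a = matrix_of (QHe G H K) (fixed_field G H K) bs (crossed_endo G H K \<phi> a)"

definition x_e ::
    "('a, 'b) monoid_scheme \<Rightarrow> 'a set \<Rightarrow> 'a set \<Rightarrow> ('a set \<Rightarrow> 'a set) \<Rightarrow> ('a \<Rightarrow> rat) list \<Rightarrow>
     'a \<Rightarrow> rat" where
  "x_e G H K \<phi> bs =
     (let n = card (carrier (quot G (normalizer G K) H));
          F = (QHe G H K)\<lparr>carrier := fixed_field G H K\<rparr>;
          M = mat_ring n F
      in inv_into (carrier (QNe G H K)) (psi G H K \<phi> bs)
           (P_mat n F \<otimes>\<^bsub>M\<^esub> A_mat n F \<otimes>\<^bsub>M\<^esub> inv\<^bsub>M\<^esub> (P_mat n F)))"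


section \<open>Transversals and primitive idempotents\<close>

text \<open>A transversal \<open>T\<^sub>1\<close> of \<open>H\<close> in \<open>N\<close> (where \<open>H\<close> is normal, so left and right cosets agree)
  that represents the section: \<open>tK = \<phi>(tH)\<close> for \<open>t \<in> T\<^sub>1\<close>. If \<open>\<phi>\<close> is not tied to \<open>T\<^sub>1\<close>, the average
  of \<open>T\<^sub>1\<close> times \<open>\<epsilon>\<close> need not be idempotent: take \<open>G = S\<^sub>3\<close>, \<open>H = \<langle>(1 2 3)\<rangle>\<close>, \<open>K = 1\<close> and
  \<open>T\<^sub>1 = {(1 2 3), (1 2)}\<close>.\<close>

definition transversal_lifting ::
    "('a, 'b) monoid_scheme \<Rightarrow> 'a set \<Rightarrow> 'a set \<Rightarrow> ('a set \<Rightarrow> 'a set) \<Rightarrow> 'a set \<Rightarrow> bool" where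
  "transversal_lifting G H K \<phi> T \<longleftrightarrow>
     T \<subseteq> normalizer G K \<and> (\<forall>g\<in>normalizer G K. \<exists>!t. t \<in> T \<and> t \<in> H #>\<^bsub>G\<^esub> g) \<and>
     (\<forall>t\<in>T. K #>\<^bsub>G\<^esub> t = \<phi> (H #>\<^bsub>G\<^esub> t))"

text \<open>Right transversal in the sense that \<open>G\<close> is the disjoint union of the cosets \<open>tN\<close>: the
  conjugates \<open>t\<epsilon>t\<^sup>-\<^sup>1\<close> are parametrized by these cosets, the centralizer of \<open>\<epsilon>\<close> being \<open>N\<close>.\<close>

definition right_transversal :: "('a, 'b) monoid_scheme \<Rightarrow> 'a set \<Rightarrow> 'a set \<Rightarrow> bool" where
  "right_transversal G N T \<longleftrightarrow>
     T \<subseteq> carrier G \<and> (\<forall>g\<in>carrier G. \<exists>!t. t \<in> T \<and> t \<in> g <#\<^bsub>G\<^esub> N)"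

definition idempotents :: "('r, 's) ring_scheme \<Rightarrow> 'r set" where
  "idempotents R = {f \<in> carrier R. f \<otimes>\<^bsub>R\<^esub> f = f}"

definition orthogonal :: "('r, 's) ring_scheme \<Rightarrow> 'r \<Rightarrow> 'r \<Rightarrow> bool" where
  "orthogonal R a b \<longleftrightarrow> a \<otimes>\<^bsub>R\<^esub> b = \<zero>\<^bsub>R\<^esub> \<and> b \<otimes>\<^bsub>R\<^esub> a = \<zero>\<^bsub>R\<^esub>"

definition primitive_idempotent :: "('r, 's) ring_scheme \<Rightarrow> 'r \<Rightarrow> bool" where
  "primitive_idempotent R f \<longleftrightarrow>
     f \<in> idempotents R \<and> f \<noteq> \<zero>\<^bsub>R\<^esub> \<and>
     \<not> (\<exists>a\<in>idempotents R. \<exists>b\<in>idempotents R.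
          a \<noteq> \<zero>\<^bsub>R\<^esub> \<and> b \<noteq> \<zero>\<^bsub>R\<^esub> \<and> orthogonal R a b \<and> f = a \<oplus>\<^bsub>R\<^esub> b)"

definition complete_orthogonal_primitive :: "('r, 's) ring_scheme \<Rightarrow> 'r set \<Rightarrow> bool" where
  "complete_orthogonal_primitive R S \<longleftrightarrow>
     finite S \<and> (\<forall>f\<in>S. primitive_idempotent R f) \<and>
     (\<forall>f\<in>S. \<forall>f'\<in>S. f \<noteq> f' \<longrightarrow> orthogonal R f f') \<and>
     (\<Oplus>\<^bsub>R\<^esub>f\<in>S. f) = \<one>\<^bsub>R\<^esub>"

end

theory Submission
  imports Defs "HOL-Library.Function_Algebras" "HOL-Computational_Algebra.Polynomial"
    "HOL-Number_Theory.Residues"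
begin

text \<open>Let \<open>N = N\<^sub>G(K)\<close>, \<open>n = [N : H]\<close>, \<open>E = \<rat>H\<epsilon>\<close>, \<open>A = \<rat>N\<epsilon>\<close>, let \<open>F\<close> be the fixed field of \<open>N\<close> in \<open>E\<close>, and
let \<open>f\<close> be the average of \<open>T\<^sub>1\<close> times \<open>\<epsilon>\<close>.

Since the twisting is trivial, the section is a homomorphism, so \<open>T\<^sub>1\<close> is a group modulo \<open>K\<close> and
\<open>t f = f\<close> for all \<open>t \<in> T\<^sub>1\<close> (\<open>delta_T_f\<close>). Consequently \<open>A f = E f\<close>, this left ideal is a copy of \<open>E\<close>,
and on it \<open>x t\<epsilon>\<close> acts as \<open>v \<mapsto> x \<cdot> t v t\<^sup>-\<^sup>1\<close> (\<open>act_f\<close>). This is the representation behind \<open>\<psi>\<close>. It is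
multiplicative because \<open>\<rat>G\<close> is associative, and faithful by Dedekind's argument on the independence of
automorphisms (\<open>rho_injective\<close>), which rests on \<open>E\<close> being a domain and on \<open>N/H\<close> acting faithfully
on it (\<open>E_domain\<close>, \<open>N_faithful\<close>). A dimension count over \<open>\<rat>\<close> gives surjectivity.

In a normal basis, \<open>f\<close> acts as \<open>1/n\<close> times the trace. Let \<open>p\<^sub>0, \<dots>, p\<^sub>n\<^sub>-\<^sub>1 \<in> E\<close> have the columns of
\<open>P\<close> as coordinates. Then \<open>p\<^sub>0\<close> is the sum of the basis and the other \<open>p\<^sub>j\<close> are differences of basis
elements, so \<open>f\<close> is the projection onto the line \<open>F p\<^sub>0\<close> along the other \<open>p\<^sub>j\<close> (\<open>rho_f_p\<close>). The matrix
\<open>P A P\<^sup>-\<^sup>1\<close> of \<open>x\<^sub>e\<close> permutes the \<open>p\<^sub>j\<close> cyclically (\<open>x_shift\<close>). Therefore \<open>x\<^sub>e\<^sup>m f x\<^sub>e\<^sup>-\<^sup>m\<close> is the projection onto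
\<open>F p\<^sub>m\<close> along the others. These \<open>n\<close> projections are orthogonal with sum \<open>\<epsilon>\<close> (\<open>prim_mult\<close>, \<open>prim_sum\<close>), and
they are primitive because a line over the field \<open>F\<close> has no proper idempotent endomorphism
(\<open>prim_corner_idempotent\<close>).

The centralizer of \<open>\<epsilon>\<close> is \<open>N\<close> and distinct conjugates of \<open>\<epsilon>\<close> are orthogonal, so \<open>\<epsilon> (\<rat>G) \<epsilon> = A\<close>
(\<open>centralizer_eps\<close>, \<open>eps_corner\<close>). Hence idempotents that are primitive in \<open>A\<close> remain primitive in
\<open>\<rat>Ge\<close>, and conjugation by \<open>T\<^sub>2\<close> spreads them over the summands \<open>t \<epsilon> t\<^sup>-\<^sup>1\<close> of \<open>e\<close>.

The arithmetic input is that \<open>E\<close> is a domain. A faithful linear character of \<open>H/K\<close> maps \<open>E\<close> to \<open>\<complex>\<close>.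
If it vanishes on \<open>a \<in> E\<close>, then so do all its powers: those with exponent coprime to \<open>[H : K]\<close>
because primitive roots of unity are conjugate over \<open>\<rat>\<close> (\<open>rational_relation_conjugates\<close>), the others
because they kill \<open>\<epsilon>\<close> (\<open>chi_eps_noncoprime\<close>). By Fourier inversion \<open>a = 0\<close> (\<open>E_chi_injective\<close>).\<close>

section \<open>Conjugacy of the primitive roots of unity over the rationals\<close>

abbreviation ieval :: "int poly \<Rightarrow> complex \<Rightarrow> complex" where
  "ieval P \<equiv> poly (map_poly of_int P)"

abbreviation qeval :: "rat poly \<Rightarrow> complex \<Rightarrow> complex" where
  "qeval P \<equiv> poly (map_poly of_rat P)"

lemma map_poly_ring_hom:
  fixes h :: "'r::comm_ring_1 \<Rightarrow> 's::comm_ring_1"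
  assumes h0: "h 0 = 0" and add: "\<And>a b. h (a + b) = h a + h b" and mult: "\<And>a b. h (a * b) = h a * h b"
  shows map_poly_hom_add: "map_poly h (P + Q) = map_poly h P + map_poly h Q"
    and map_poly_hom_mult: "map_poly h (P * Q) = map_poly h P * map_poly h Q"
proof -
  show A: "map_poly h (P + Q) = map_poly h P + map_poly h Q" for P Q
    by (intro poly_eqI) (simp add: coeff_map_poly h0 add)
  have S: "map_poly h (Polynomial.smult c P) = Polynomial.smult (h c) (map_poly h P)" for c P
    by (intro poly_eqI) (simp add: coeff_map_poly h0 mult)
  show "map_poly h (P * Q) = map_poly h P * map_poly h Q"
    by (induction P) (simp_all add: h0 map_poly_pCons A S)
qed

lemma ieval_simps [simp]:
  "ieval (P + Q) z = ieval P z + ieval Q z" "ieval (P * Q) z = ieval P z * ieval Q z"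
  "ieval [:c:] z = of_int c" "ieval (P ^ m) z = ieval P z ^ m"
  "ieval (- P) z = - ieval P z" "ieval (P - Q) z = ieval P z - ieval Q z"
  "ieval (Polynomial.smult c P) z = of_int c * ieval P z"
  "ieval 0 z = 0" "ieval 1 z = 1"
proof -
  note hom = map_poly_ring_hom[where h = "of_int :: int \<Rightarrow> complex", simplified]
  show A: "ieval (P + Q) z = ieval P z + ieval Q z" for P Q by (simp add: hom)
  show M: "ieval (P * Q) z = ieval P z * ieval Q z" for P Q by (simp add: hom)
  show C: "ieval [:c:] z = of_int c" for c by (simp add: map_poly_pCons)
  show "ieval 0 z = 0" by simp
  show one: "ieval 1 z = 1" using C[of 1] by (simp add: one_pCons)
  show "ieval (P ^ m) z = ieval P z ^ m" by (induction m) (simp_all only: power_0 one power_Suc M)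
  show N: "ieval (- P) z = - ieval P z" for P
    using A[of P "- P"] by (simp add: add_eq_0_iff)
  show "ieval (P - Q) z = ieval P z - ieval Q z" using A[of P "- Q"] N[of Q] by simp
  show "ieval (Polynomial.smult c P) z = of_int c * ieval P z"
    using M[of "[:c:]" P] C[of c] by simp
qed

lemma qeval_simps [simp]:
  "qeval (P + Q) z = qeval P z + qeval Q z" "qeval (P * Q) z = qeval P z * qeval Q z"
  "qeval [:c:] z = of_rat c"
  "qeval (- P) z = - qeval P z" "qeval (P - Q) z = qeval P z - qeval Q z"
  "qeval (Polynomial.smult c P) z = of_rat c * qeval P z"
  "qeval 0 z = 0" "qeval 1 z = 1" 
proof -
  note hom = map_poly_ring_hom[where h = "of_rat :: rat \<Rightarrow> complex", simplified of_rat_add of_rat_mult of_rat_0, simplified]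
  show A: "qeval (P + Q) z = qeval P z + qeval Q z" for P Q by (simp add: hom)
  show M: "qeval (P * Q) z = qeval P z * qeval Q z" for P Q by (simp add: hom)
  show C: "qeval [:c:] z = of_rat c" for c by (simp add: map_poly_pCons)
  show "qeval 0 z = 0" by simp
  show one: "qeval 1 z = 1" using C[of 1] by (simp add: one_pCons)
  show N: "qeval (- P) z = - qeval P z" for P
    using A[of P "- P"] by (simp add: add_eq_0_iff)
  show "qeval (P - Q) z = qeval P z - qeval Q z" using A[of P "- Q"] N[of Q] by simp
  show "qeval (Polynomial.smult c P) z = of_rat c * qeval P z"
    using M[of "[:c:]" P] C[of c] by simp
qed

lemma qeval_monom [simp]: "qeval (Polynomial.monom c m) z = of_rat c * z ^ m"
  by (simp add: map_poly_monom poly_monom)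
lemma ieval_monom [simp]: "ieval (Polynomial.monom c m) z = of_int c * z ^ m"
  by (simp add: map_poly_monom poly_monom)

text \<open>The freshman's dream modulo \<open>p\<close>, together with Fermat's little theorem for the coefficients.\<close>

lemma frobenius_int_poly:
  assumes "prime (p::nat)"
  shows "\<exists>R :: int poly. P ^ p = pcompose P (Polynomial.monom 1 p) + of_nat p * R"
proof -
  have two: "\<exists>R. (A + B) ^ p = A ^ p + B ^ p + of_nat p * R" for A B :: "int poly"
  proof -
    have p0: "p > 0" using assms prime_gt_0_nat by blast
    have "(A + B) ^ p = (\<Sum>k\<le>p. of_nat (p choose k) * A ^ k * B ^ (p - k))" by (rule binomial_ring)
    also have "\<dots> = (\<Sum>k\<in>{0,p}. of_nat (p choose k) * A ^ k * B ^ (p - k)) +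
        (\<Sum>k\<in>{..p} - {0,p}. of_nat (p choose k) * A ^ k * B ^ (p - k))"
      by (subst sum.subset_diff[of "{0,p}" "{..p}"]) (auto simp: add_ac)
    also have "(\<Sum>k\<in>{0,p}. of_nat (p choose k) * A ^ k * B ^ (p - k)) = A ^ p + B ^ p"
      using p0 by (simp add: add_ac)
    also have "(\<Sum>k\<in>{..p} - {0,p}. of_nat (p choose k) * A ^ k * B ^ (p - k)) =
       of_nat p * (\<Sum>k\<in>{..p} - {0,p}. of_nat ((p choose k) div p) * A ^ k * B ^ (p - k))"
      unfolding sum_distrib_left
    proof (intro sum.cong refl)
      fix k assume "k \<in> {..p} - {0,p}"
      then have "p dvd (p choose k)" using assms by (intro dvd_choose_prime) auto
      then have "(of_nat (p choose k) :: int poly) = of_nat p * of_nat ((p choose k) div p)"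
        by (simp flip: of_nat_mult)
      then show "of_nat (p choose k) * A ^ k * B ^ (p - k) =
         of_nat p * (of_nat ((p choose k) div p) * A ^ k * B ^ (p - k))" by (simp add: mult.assoc)
    qed
    finally show ?thesis by blast
  qed
  show ?thesis
  proof (induction P)
    case 0
    show ?case using assms by (intro exI[of _ 0]) (simp add: prime_gt_0_nat)
  next
    case (pCons a P)
    then obtain R where R: "P ^ p = pcompose P (Polynomial.monom 1 p) + of_nat p * R" by blast
    obtain R1 where R1: "([:a:] + [:0,1:] * P) ^ p = [:a:] ^ p + ([:0,1:] * P) ^ p + of_nat p * R1"
      using two by blast
    have X: "[:0, 1::int:] ^ p = Polynomial.monom 1 p"
      by (metis monom_altdef smult_1_left)
    have "int p dvd a ^ p - a"
    proof -
      have "[a ^ p = a] (mod int p)"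
      proof (cases "int p dvd a")
        case True
        then show ?thesis using assms
          by (meson cong_0_iff cong_sym cong_trans dvd_power_same dvd_trans dvd_power prime_gt_0_nat)
      next
        case False
        then have "[a ^ (p - 1) = 1] (mod int p)"
          using fermat_theorem[of p "nat (a mod int p)"] assms
          by (smt (verit) Euclidean_Rings.pos_mod_sign cong_def cong_int_iff cong_pow dvd_eq_mod_eq_0 int_nat_eq mod_mod_trivial nat_int of_nat_1 of_nat_power prime_gt_0_nat of_nat_dvd_iff of_nat_0_less_iff)
        then have "[a ^ (p - 1) * a = 1 * a] (mod int p)" by (rule cong_scalar_right)
        then show ?thesis using assms prime_gt_0_nat
          by (metis mult_1 power_minus_mult)
      qed
      then show ?thesis by (simp add: cong_iff_dvd_diff)
    qed
    then obtain c where c: "a ^ p = a + int p * c" by (metis add_diff_cancel_left' diff_add_cancel dvd_def add.commute)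
    have "[:a:] ^ p = [:a:] + of_nat p * [:c:]"
      using c by (simp add: poly_const_pow of_nat_poly)
    moreover have "pCons a P = [:a:] + [:0,1:] * P" by simp
    ultimately have "pCons a P ^ p = [:a:] + of_nat p * [:c:] + Polynomial.monom 1 p * 
        (pcompose P (Polynomial.monom 1 p) + of_nat p * R) + of_nat p * R1"
      using R1 by (simp only: R X power_mult_distrib)
    also have "\<dots> = pcompose (pCons a P) (Polynomial.monom 1 p) + of_nat p * ([:c:] + Polynomial.monom 1 p * R + R1)"
      by (simp add: pcompose_pCons algebra_simps)
    finally show ?case by blast
  qed
qed

lemma ieval_pcompose_monom [simp]: "ieval (pcompose P (Polynomial.monom 1 m)) z = ieval P (z ^ m)"
  by (induction P) (simp_all add: pcompose_pCons map_poly_pCons)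


lemma poly_zero_on_roots_of_unity:
  fixes q :: "complex poly"
  assumes "degree q < k" and "\<And>\<omega>. \<omega> ^ k = 1 \<Longrightarrow> poly q \<omega> = 0"
  shows "q = 0"
proof (rule ccontr)
  assume "q \<noteq> 0"
  have "k = card {\<omega>::complex. \<omega> ^ k = 1}"
    using assms(1) by (simp add: card_roots_unity_eq)
  also have "\<dots> \<le> card {z. poly q z = 0}"
    using assms(2) poly_roots_finite[OF \<open>q \<noteq> 0\<close>] by (intro card_mono) auto
  also have "\<dots> \<le> degree q" using \<open>q \<noteq> 0\<close> by (rule card_poly_roots_bound)
  finally show False using assms(1) by simp
qed

text \<open>The values at the \<open>k\<close>-th roots of unity determine a polynomial modulo \<open>X\<^sup>k - 1\<close>. Exponents reduce
modulo \<open>k\<close> without leaving \<open>\<int>[X]\<close>, so divisibility of the values by \<open>p\<^sup>m\<close> is divisibility of integral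
coefficients, and no nonzero integer is divisible by all powers of \<open>p\<close>.\<close>

lemma infinitely_divisible_zero:
  fixes c :: "int poly"
  assumes k: "k > 0" and p: "p > (1::nat)"
    and div: "\<And>m::nat. \<exists>R::int poly. \<forall>\<omega>. \<omega> ^ k = 1 \<longrightarrow> ieval c \<omega> = of_nat (p ^ m) * ieval R \<omega>"
    and \<omega>: "\<omega> ^ k = 1"
  shows "ieval c \<omega> = 0"
proof -
  \<comment> \<open>Exponents reduced modulo \<open>k\<close>: the remainder modulo \<open>X\<^sup>k - 1\<close>.\<close>
  define red where "red P = (\<Sum>i\<le>degree P. Polynomial.monom (coeff P i) (i mod k))" for P :: "int poly"
  have red_eval: "ieval (red P) z = ieval P z" if "z ^ k = 1" for P z
  proof -
    have [simp]: "z ^ (i mod k) = z ^ i" for i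
    proof -
      have "z ^ i = z ^ (k * (i div k) + i mod k)" by simp
      also have "\<dots> = z ^ (i mod k)" by (simp only: power_add power_mult that power_one mult_1)
      finally show ?thesis by simp
    qed
    have "ieval (\<Sum>i\<in>I. Polynomial.monom (coeff P i) (i mod k)) z = (\<Sum>i\<in>I. of_int (coeff P i) * z ^ i)"
      if "finite I" for I using that by (induction I) simp_all
    then have "ieval (red P) z = (\<Sum>i\<le>degree P. of_int (coeff P i) * z ^ i)"
      by (simp add: red_def)
    also have "\<dots> = ieval P z"
      by (subst poly_altdef) (simp add: coeff_map_poly degree_map_poly)
    finally show ?thesis .
  qed
  have red_coeff: "coeff (red P) j = 0" if "j \<ge> k" for P j
  proof -
    have "i mod k \<noteq> j" for i using that mod_less_divisor[OF k, of i] by linarith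
    then show ?thesis by (simp add: red_def coeff_sum)
  qed
  have "coeff (red c) j = 0" for j
  proof -
    define m where "m = nat \<bar>coeff (red c) j\<bar>"
    obtain R where R: "\<And>\<omega>. \<omega> ^ k = 1 \<Longrightarrow> ieval c \<omega> = of_nat (p ^ m) * ieval R \<omega>"
      using div by blast
    define Q where "Q = red c - Polynomial.smult (int (p ^ m)) (red R)"
    have "coeff Q i = 0" if "i \<ge> k" for i using that by (simp add: Q_def red_coeff)
    then have "degree Q \<le> k - 1" by (intro degree_le) (use k in auto)
    then have "degree (map_poly of_int Q :: complex poly) < k" using k by (simp add: degree_map_poly)
    moreover have "ieval Q \<omega> = 0" if "\<omega> ^ k = 1" for \<omega>
      using that R[OF that] by (simp add: Q_def red_eval)
    ultimately have "(map_poly of_int Q :: complex poly) = 0"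
      by (intro poly_zero_on_roots_of_unity) auto
    then have "Q = 0" by (simp add: map_poly_eq_0_iff)
    then have "coeff (red c) j = int (p ^ m) * coeff (red R) j"
      by (metis Q_def coeff_smult eq_iff_diff_eq_0)
    moreover have "m < p ^ m" using p by (simp add: power_gt_expt)
    then have "\<bar>coeff (red c) j\<bar> < int (p ^ m)" unfolding m_def by linarith
    ultimately show ?thesis using dvd_imp_le_int[of "coeff (red c) j" "int (p ^ m)"] by fastforce
  qed
  then have "red c = 0" by (simp add: poly_eqI)
  then show ?thesis using red_eval[OF \<omega>, of c] by simp
qed

lemma clear_denominators:
  "\<exists>d>0. \<exists>P :: int poly. \<forall>z. ieval P z = of_nat d * qeval U z"
proof (induction U)
  case 0
  show ?case by (rule exI[of _ 1]) (auto intro!: exI[of _ 0])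
next
  case (pCons a U)
  then obtain d P where d: "d > (0::nat)" and P: "\<And>z. ieval P z = of_nat d * qeval U z" by blast
  obtain x y where q: "quotient_of a = (x, y)" by (cases "quotient_of a")
  have y: "y > 0" using quotient_of_denom_pos[OF q] .
  have a: "a = of_int x / of_int y" using quotient_of_div[OF q] .
  have "ieval (pCons (x * int d) (Polynomial.smult y P)) z = of_nat (d * nat y) * qeval (pCons a U) z" for z
    using y by (simp add: a map_poly_pCons P of_rat_divide field_simps)
  moreover have "d * nat y > 0" using d y by simp
  ultimately show ?case by blast
qed

text \<open>In terms of \<open>\<rat>[X]/(X\<^sup>k - 1)\<close>: idempotents are fixed by \<open>X \<mapsto> X\<^sup>p\<close>. With \<open>d\<close> the least denominator of
\<open>U\<close>, the integral polynomial \<open>P = d U\<close> satisfies \<open>P\<^sup>2 = d P\<close>, and \<open>P\<^sup>p \<equiv> P(X\<^sup>p)\<close> modulo \<open>p\<close>. If \<open>p\<close>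
divided \<open>d\<close>, an iterate of Frobenius that fixes the \<open>k\<close>-th roots of unity would make \<open>P\<close> divisible by \<open>p\<close>,
against the choice of \<open>d\<close>. Otherwise \<open>c = P - P(X\<^sup>p)\<close> is divisible by \<open>p\<close>, and \<open>c\<^sup>3 = d\<^sup>2 c\<close>, so \<open>c\<close> is
divisible by every power of \<open>p\<close>.\<close>

lemma idempotent_values_frobenius:
  fixes U :: "rat poly"
  assumes k: "k > 0" and p: "prime (p::nat)" and pk: "\<not> p dvd k"
    and U: "\<And>\<omega>. \<omega> ^ k = 1 \<Longrightarrow> qeval U \<omega> \<in> {0, 1}"
    and \<omega>: "\<omega> ^ k = 1"
  shows "qeval U (\<omega> ^ p) = qeval U \<omega>"
proof -
  define good where "good d \<longleftrightarrow> d > 0 \<and> (\<exists>P :: int poly. \<forall>\<omega>. \<omega> ^ k = 1 \<longrightarrow> ieval P \<omega> = of_nat d * qeval U \<omega>)"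
    for d :: nat
  define d where "d = (LEAST d. good d)"
  have "\<exists>d. good d" using clear_denominators[of U] unfolding good_def by blast
  then have "good d" unfolding d_def by (rule LeastI_ex)
  then obtain P where d0: "d > 0" and P: "\<And>\<omega>. \<omega> ^ k = 1 \<Longrightarrow> ieval P \<omega> = of_nat d * qeval U \<omega>"
    unfolding good_def by blast
  have pow_P: "ieval P \<omega> ^ Suc m = of_nat (d ^ m) * ieval P \<omega>" if "\<omega> ^ k = 1" for \<omega> m
    using U[OF that] P[OF that] by auto
  have p1: "p > 1" using p prime_gt_1_nat by blast
  have frob: "\<exists>R :: int poly. \<forall>z. ieval P z ^ (p ^ s) = ieval P (z ^ (p ^ s)) + of_nat p * ieval R z" for s
  proof (induction s)
    case 0
    show ?case by (intro exI[of _ 0]) simp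
  next
    case (Suc s)
    then obtain R where R: "\<And>z. ieval P z ^ (p ^ s) = ieval P (z ^ (p ^ s)) + of_nat p * ieval R z" by blast
    obtain R1 where R1: "(P ^ (p ^ s)) ^ p = pcompose (P ^ (p ^ s)) (Polynomial.monom 1 p) + of_nat p * R1"
      using frobenius_int_poly[OF p] by blast
    have of_nat_p: "ieval (of_nat p) z = of_nat p" for z
      using ieval_simps(3)[of "int p" z] by (simp add: of_nat_poly)
    have "ieval P z ^ (p ^ Suc s) = ieval P (z ^ (p ^ Suc s)) + of_nat p * ieval (pcompose R (Polynomial.monom 1 p) + R1) z" for z
    proof -
      have "ieval P z ^ (p ^ Suc s) = ieval ((P ^ (p ^ s)) ^ p) z"
        by (simp add: power_mult[symmetric] mult.commute)
      also have "\<dots> = ieval P (z ^ p) ^ (p ^ s) + of_nat p * ieval R1 z"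
        unfolding R1 by (simp add: of_nat_p)
      also have "ieval P (z ^ p) ^ (p ^ s) = ieval P ((z ^ p) ^ (p ^ s)) + of_nat p * ieval R (z ^ p)"
        by (rule R)
      finally show ?thesis by (simp add: power_mult[symmetric] algebra_simps)
    qed
    then show ?case by blast
  qed
  have "\<not> p dvd d"
  proof
    assume "p dvd d"
    then obtain d1 where d1: "d = p * d1" by blast
    \<comment> \<open>By Euler, raising to the power \<open>p\<^sup>s\<close> fixes all \<open>k\<close>-th roots of unity.\<close>
    define s where "s = totient k"
    have s: "s > 0" using k by (simp add: s_def)
    have "coprime p k" using p pk by (simp add: prime_imp_coprime)
    then have "[p ^ s = 1] (mod k)" unfolding s_def by (rule euler_theorem)
    then have ps: "\<omega> ^ (p ^ s) = \<omega>" if "\<omega> ^ k = 1" for \<omega> :: complex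
    proof -
      have "k dvd p ^ s - 1" using \<open>[p ^ s = 1] (mod k)\<close> p1
        by (metis cong_to_1_nat)
      then obtain l where "p ^ s - 1 = k * l" by blast
      then have "p ^ s = Suc (k * l)" using p1 by (metis Suc_diff_1 prime_gt_0_nat p zero_less_power)
      then have "\<omega> ^ (p ^ s) = \<omega> * (\<omega> ^ k) ^ l" by (simp add: power_mult)
      then show ?thesis using that by simp
    qed
    obtain R where R: "\<And>z. ieval P z ^ (p ^ s) = ieval P (z ^ (p ^ s)) + of_nat p * ieval R z"
      using frob by blast
    have "p ^ s \<ge> 2" using s p1 by (metis Suc_1 Suc_leI order.trans self_le_power less_or_eq_imp_le)
    then obtain m where m: "p ^ s = Suc (Suc m)" by (metis add_2_eq_Suc le_Suc_ex)
    define P1 where "P1 = Polynomial.smult (int (d1 * d ^ m)) P - R"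
    have "ieval P1 \<omega> = of_nat d1 * qeval U \<omega>" if "\<omega> ^ k = 1" for \<omega>
    proof -
      have "of_nat p * ieval P1 \<omega> = ieval P \<omega>"
      proof -
        have "of_nat (d ^ Suc m) * ieval P \<omega> = ieval P \<omega> + of_nat p * ieval R \<omega>"
          using R[of \<omega>] pow_P[OF that, of "Suc m"] unfolding ps[OF that] unfolding m by simp
        moreover have "(of_nat (d ^ Suc m) :: complex) = of_nat p * of_nat (d1 * d ^ m)" by (simp add: d1)
        moreover have "ieval P1 \<omega> = of_nat (d1 * d ^ m) * ieval P \<omega> - ieval R \<omega>" by (simp add: P1_def)
        ultimately show ?thesis by (simp only: right_diff_distrib mult.assoc[symmetric]) simp
      qed
      then show ?thesis using P[OF that] p1 by (simp add: d1)
    qed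
    moreover have "d1 > 0" "d1 < d" using d0 d1 p1 by auto
    ultimately have "good d1" unfolding good_def by blast
    then have "d \<le> d1" unfolding d_def by (rule Least_le)
    then show False using \<open>d1 < d\<close> by simp
  qed
  then have cop: "coprime p d" using p by (simp add: prime_imp_coprime)
  obtain R where R: "\<And>z. ieval P z ^ p = ieval P (z ^ p) + of_nat p * ieval R z"
    using frob[of 1] by auto
  have "p dvd d ^ (p - 1) - 1"
    using fermat_theorem[OF p \<open>\<not> p dvd d\<close>] by (rule cong_to_1_nat)
  then obtain l where "d ^ (p - 1) - 1 = p * l" by blast
  then have l: "d ^ (p - 1) = 1 + p * l" using d0
    by (metis Suc_diff_1 plus_1_eq_Suc zero_less_power)
  define c where "c = P - pcompose P (Polynomial.monom 1 p)"
  have Wp: "(\<omega> ^ p) ^ k = 1" if "\<omega> ^ k = 1" for \<omega> :: complex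
    using that by (metis power_commutes power_mult mult.commute power_one)
  have c_eval: "ieval c \<omega> = of_nat d * (qeval U \<omega> - qeval U (\<omega> ^ p))" if "\<omega> ^ k = 1" for \<omega>
    using P[OF that] P[OF Wp[OF that]] by (simp add: c_def algebra_simps)
  have c3: "ieval c \<omega> ^ 3 = of_nat (d\<^sup>2) * ieval c \<omega>" if "\<omega> ^ k = 1" for \<omega>
    using U[OF that] U[OF Wp[OF that]] by (auto simp: c_eval[OF that] power3_eq_cube power2_eq_square)
  have c1: "ieval c \<omega> = of_nat p * ieval (R - Polynomial.smult (int l) P) \<omega>" if "\<omega> ^ k = 1" for \<omega>
  proof -
    have "ieval P \<omega> ^ p = of_nat (1 + p * l) * ieval P \<omega>"
      using pow_P[OF that, of "p - 1"] p1 unfolding l by simp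
    then have "ieval P (\<omega> ^ p) + of_nat p * ieval R \<omega> = of_nat (1 + p * l) * ieval P \<omega>"
      unfolding R .
    moreover have "(of_nat (1 + p * l) :: complex) = 1 + of_nat p * of_nat l" by simp
    ultimately have "ieval P \<omega> - ieval P (\<omega> ^ p) = of_nat p * (ieval R \<omega> - of_nat l * ieval P \<omega>)"
      by (simp only:) (simp only: algebra_simps mult_1)
    then show ?thesis by (simp add: c_def)
  qed
  have div: "\<exists>R::int poly. \<forall>\<omega>. \<omega> ^ k = 1 \<longrightarrow> ieval c \<omega> = of_nat (p ^ m) * ieval R \<omega>" for m
  proof (induction m)
    case 0
    show ?case by auto
  next
    case (Suc m)
    show ?case
    proof (cases "m = 0")
      case True
      have "ieval c \<omega> = of_nat (p ^ Suc m) * ieval (R - Polynomial.smult (int l) P) \<omega>" if "\<omega> ^ k = 1" for \<omega>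
        using c1[OF that] True by (simp only: power_Suc power_0 mult_1_right)
      then show ?thesis by blast
    next
      case False
      from Suc obtain Rm where Rm: "\<And>\<omega>. \<omega> ^ k = 1 \<Longrightarrow> ieval c \<omega> = of_nat (p ^ m) * ieval Rm \<omega>" by blast
      have "coprime (int (d\<^sup>2)) (int (p ^ (3 * m)))"
        using cop by (simp add: coprime_commute coprime_int_iff)
      \<comment> \<open>From \<open>d\<^sup>2 c = c\<^sup>3\<close>, divisible by \<open>p\<^sup>3\<^sup>m\<close>, and \<open>d\<close> prime to \<open>p\<close>: the exponent triples.\<close>
      then obtain \<alpha> \<beta> where ab: "\<alpha> * int (d\<^sup>2) + \<beta> * int (p ^ (3 * m)) = 1"
        using bezout_int[of "int (d\<^sup>2)" "int (p ^ (3 * m))"] by (auto simp only: coprime_iff_gcd_eq_1)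
      define S where "S = Polynomial.smult \<alpha> (Rm ^ 3) + Polynomial.smult \<beta> c"
      have S: "ieval c \<omega> = of_nat (p ^ (3 * m)) * ieval S \<omega>" if "\<omega> ^ k = 1" for \<omega>
      proof -
        let ?q = "of_nat (p ^ (3 * m)) :: complex"
        have "of_nat (d\<^sup>2) * ieval c \<omega> = ieval c \<omega> ^ 3" using c3[OF that] by (rule sym)
        also have "\<dots> = ?q * ieval Rm \<omega> ^ 3"
          unfolding Rm[OF that] power_mult_distrib of_nat_power power_mult[symmetric] by (simp only: mult.commute[of m])
        finally have dq: "of_nat (d\<^sup>2) * ieval c \<omega> = ?q * ieval Rm \<omega> ^ 3" .
        have "of_int \<alpha> * of_nat (d\<^sup>2) + of_int \<beta> * ?q = 1"
          using arg_cong[OF ab, of "of_int :: int \<Rightarrow> complex"] unfolding of_int_add of_int_mult of_int_of_nat_eq of_int_1 .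
        then have "ieval c \<omega> = (of_int \<alpha> * of_nat (d\<^sup>2) + of_int \<beta> * ?q) * ieval c \<omega>" by simp
        also have "\<dots> = of_int \<alpha> * (of_nat (d\<^sup>2) * ieval c \<omega>) + of_int \<beta> * ?q * ieval c \<omega>"
          by (simp only: distrib_right mult.assoc)
        also have "\<dots> = ?q * (of_int \<alpha> * ieval Rm \<omega> ^ 3 + of_int \<beta> * ieval c \<omega>)"
          unfolding dq by (simp only: distrib_left mult.assoc mult.left_commute)
        finally show ?thesis by (simp only: S_def ieval_simps)
      qed
      have "3 * m = Suc m + (2 * m - 1)" using False by simp
      then have p3: "p ^ (3 * m) = p ^ Suc m * p ^ (2 * m - 1)" by (simp only: power_add)
      have "ieval c \<omega> = of_nat (p ^ Suc m) * ieval (Polynomial.smult (int (p ^ (2 * m - 1))) S) \<omega>"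
        if "\<omega> ^ k = 1" for \<omega>
        unfolding S[OF that] p3 of_nat_mult by (simp only: ieval_simps of_int_of_nat_eq mult.assoc)
      then show ?thesis by blast
    qed
  qed
  have "ieval c \<omega> = 0" using infinitely_divisible_zero[OF k p1 div \<omega>] .
  then have "of_nat d * (qeval U \<omega> - qeval U (\<omega> ^ p)) = 0" unfolding c_eval[OF \<omega>] .
  then show ?thesis using d0 by simp
qed

lemma idempotent_values_coprime_power:
  fixes U :: "rat poly"
  assumes k: "k > 0" and U: "\<And>\<omega>. \<omega> ^ k = 1 \<Longrightarrow> qeval U \<omega> \<in> {0, 1}"
    and j: "coprime j k" "j > 0" and \<omega>: "\<omega> ^ k = 1"
  shows "qeval U (\<omega> ^ j) = qeval U \<omega>"
  using j \<omega>
proof (induction j arbitrary: \<omega> rule: less_induct)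
  case (less j)
  show ?case
  proof (cases "j = 1")
    case False
    then obtain p where p: "prime p" "p dvd j" using prime_factor_nat by blast
    then obtain i where i: "j = p * i" by blast
    have "\<not> p dvd k" using less.prems(1) p by (metis coprime_common_divisor_nat not_prime_1)
    moreover have "i < j" "i > 0" using i less.prems(2) prime_gt_1_nat[OF p(1)] by auto
    moreover have "coprime i k" using less.prems(1) i by simp
    moreover have "(\<omega> ^ p) ^ k = 1" using less.prems(3) by (metis power_mult mult.commute power_one)
    ultimately have "qeval U ((\<omega> ^ p) ^ i) = qeval U (\<omega> ^ p)" "qeval U (\<omega> ^ p) = qeval U \<omega>"
      using less.IH[of i "\<omega> ^ p"] idempotent_values_frobenius[OF k p(1) _ U less.prems(3)] by auto
    then show ?thesis by (simp add: i power_mult)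
  qed simp
qed

text \<open>Irreducibility of the cyclotomic polynomial in the form in which it is used. Let \<open>f\<close> be a rational polynomial of
least degree vanishing at \<open>\<zeta>\<close> and \<open>X\<^sup>k - 1 = f g\<close>. As \<open>X\<^sup>k - 1\<close> is separable, its derivative gives an
explicit Bezout relation for \<open>f\<close> and \<open>g\<close>, hence a polynomial \<open>U\<close> with value \<open>0\<close> at the roots of \<open>f\<close> and
\<open>1\<close> at those of \<open>g\<close>. Invariance of its values under \<open>\<zeta> \<mapsto> \<zeta>\<^sup>j\<close> puts \<open>\<zeta>\<^sup>j\<close> among the roots of \<open>f\<close>.\<close>

lemma rational_relation_conjugates:
  fixes P :: "rat poly"
  assumes k: "k > 0" and \<zeta>: "\<zeta> ^ k = 1" and P: "qeval P \<zeta> = 0" and j: "coprime j k" "j > 0"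
  shows "qeval P (\<zeta> ^ j) = 0"
proof -
  define X where "X = Polynomial.monom 1 k - (1 :: rat poly)"
  have X: "qeval X z = z ^ k - 1" for z by (simp add: X_def)
  have "X \<noteq> 0"
    using X[of 0] k by (auto simp: zero_power)
  define vanish where "vanish m \<longleftrightarrow> (\<exists>f::rat poly. f \<noteq> 0 \<and> qeval f \<zeta> = 0 \<and> degree f = m)" for m
  have "\<exists>m. vanish m" unfolding vanish_def using \<open>X \<noteq> 0\<close> X[of \<zeta>] \<zeta> by auto
  then have "vanish (LEAST m. vanish m)" by (rule LeastI_ex)
  then obtain f where f: "f \<noteq> 0" "qeval f \<zeta> = 0" "degree f = (LEAST m. vanish m)"
    unfolding vanish_def by blast
  have dvd: "f dvd Q" if "qeval Q \<zeta> = 0" for Q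
  proof (rule ccontr)
    assume "\<not> f dvd Q"
    then have nz: "Q mod f \<noteq> 0" by (simp add: dvd_eq_mod_eq_0)
    have "qeval (Q div f * f + Q mod f) \<zeta> = 0" using that by simp
    then have "qeval (Q mod f) \<zeta> = 0" using f(2) unfolding qeval_simps by simp
    then have "vanish (degree (Q mod f))" using nz unfolding vanish_def by blast
    then have "degree f \<le> degree (Q mod f)" unfolding f(3) by (rule Least_le)
    moreover have "degree (Q mod f) < degree f" using nz f(1) by (metis degree_mod_less)
    ultimately show False by simp
  qed
  obtain g where g: "X = f * g" using dvd[of X] X[of \<zeta>] \<zeta> by (auto elim: dvdE)
  define V where "V = Polynomial.monom 1 1 * pderiv g - Polynomial.smult (of_nat k) g"
  define U where "U = Polynomial.smult (1 / of_nat k) (f * V)"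
  have "pderiv X = Polynomial.monom (of_nat k) (k - 1)"
    by (simp add: X_def pderiv_diff pderiv_monom)
  then have "Polynomial.monom 1 1 * pderiv X = Polynomial.monom (of_nat k) k"
    using k by (simp add: mult_monom)
  also have "\<dots> = Polynomial.smult (of_nat k) X + [:of_nat k:]"
    by (simp add: X_def smult_diff_right smult_monom one_pCons)
  \<comment> \<open>The relation \<open>X (X\<^sup>k - 1)' - k (X\<^sup>k - 1) = k\<close>, written in terms of \<open>f\<close> and \<open>g\<close>.\<close>
  finally have bez: "f * V + Polynomial.monom 1 1 * pderiv f * g = [:of_nat k:]"
    unfolding g pderiv_mult V_def by (simp add: algebra_simps)
  have U_f: "qeval U z = 0" if "qeval f z = 0" for z using that by (simp add: U_def)
  have U_g: "qeval U z = 1" if "qeval g z = 0" for z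
  proof -
    have "qeval (f * V) z = of_nat k"
      using arg_cong[OF bez, of "\<lambda>p. qeval p z"] that by simp
    then show ?thesis using k by (simp add: U_def of_rat_divide)
  qed
  have fg: "qeval f z = 0 \<or> qeval g z = 0" if "z ^ k = 1" for z
    using arg_cong[OF g, of "\<lambda>p. qeval p z"] X[of z] that by simp
  have "qeval U (\<zeta> ^ j) = qeval U \<zeta>"
    using fg U_f U_g by (intro idempotent_values_coprime_power[OF k _ j \<zeta>]) blast
  then have "qeval U (\<zeta> ^ j) = 0" using U_f f(2) by simp
  then have "qeval f (\<zeta> ^ j) = 0"
    using fg[of "\<zeta> ^ j"] U_g[of "\<zeta> ^ j"] \<zeta> by (metis power_mult mult.commute power_one zero_neq_one)
  then show ?thesis using dvd[OF P] by (auto elim!: dvdE)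
qed

section \<open>The group algebra as an algebra of functions under convolution\<close>

definition qscale :: "rat \<Rightarrow> ('a \<Rightarrow> rat) \<Rightarrow> 'a \<Rightarrow> rat" (infixr "*\<^sub>Q" 75) where
  "c *\<^sub>Q a = (\<lambda>g. c * a g)"

lemma qscale_apply [simp]: "(c *\<^sub>Q a) g = c * a g" by (simp add: qscale_def)

text \<open>The vector space of all functions, used for comparing dimensions of its finite-dimensional subspaces.\<close>

interpretation QV: vector_space qscale
  by standard (auto simp: fun_eq_iff algebra_simps)

lemma sum_fun_apply: "(\<Sum>i\<in>I. f i) g = (\<Sum>i\<in>I. f i g)" for f :: "'i \<Rightarrow> 'a \<Rightarrow> rat"
  by (induction I rule: infinite_finite_induct) auto

definition functions_on :: "'a set \<Rightarrow> ('a \<Rightarrow> rat) set" where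
  "functions_on S = {a. \<forall>g. g \<notin> S \<longrightarrow> a g = 0}"

lemma functions_onD: "a \<in> functions_on S \<Longrightarrow> g \<notin> S \<Longrightarrow> a g = 0"
  by (simp add: functions_on_def)

lemma functions_on_mono: "a \<in> functions_on S \<Longrightarrow> S \<subseteq> T \<Longrightarrow> a \<in> functions_on T"
  by (auto simp: functions_on_def)

lemma functions_on_closed:
  "0 \<in> functions_on S"
  "a \<in> functions_on S \<Longrightarrow> b \<in> functions_on S \<Longrightarrow> a + b \<in> functions_on S"
  "a \<in> functions_on S \<Longrightarrow> b \<in> functions_on S \<Longrightarrow> a - b \<in> functions_on S"
  "a \<in> functions_on S \<Longrightarrow> - a \<in> functions_on S"
  "a \<in> functions_on S \<Longrightarrow> c *\<^sub>Q a \<in> functions_on S"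
  "(\<And>i. i \<in> I \<Longrightarrow> f i \<in> functions_on S) \<Longrightarrow> (\<Sum>i\<in>I. f i) \<in> functions_on S"
  "g \<in> S \<Longrightarrow> basis_elt g \<in> functions_on S"
  "S \<subseteq> T \<Longrightarrow> hat S \<in> functions_on T"
  by (auto simp: functions_on_def basis_elt_def hat_def sum_fun_apply)

lemma basis_expansion:
  assumes "finite S" "a \<in> functions_on S"
  shows "a = (\<Sum>g\<in>S. a g *\<^sub>Q basis_elt g)"
proof
  fix h
  have "(\<Sum>g\<in>S. a g *\<^sub>Q basis_elt g) h = (\<Sum>g\<in>S. if g = h then a h else 0)"
    by (auto simp: sum_fun_apply basis_elt_def intro!: sum.cong)
  also have "\<dots> = a h" using assms by (simp add: functions_on_def)
  finally show "a h = (\<Sum>g\<in>S. a g *\<^sub>Q basis_elt g) h" by simp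
qed

text \<open>Every additive structure below is a set of functions with pointwise addition. Sums can then be taken in
the type of functions, where no membership conditions arise.\<close>

lemma finsum_eq_sum:
  assumes R: "abelian_monoid R" and add: "ring.add R = (\<lambda>a b g. a g + b g)" and zero: "ring.zero R = (\<lambda>g. 0)"
    and f: "\<And>i. i \<in> I \<Longrightarrow> f i \<in> carrier R"
  shows "finsum R f I = (\<Sum>i\<in>I. f i :: 'a \<Rightarrow> rat)"
proof -
  interpret abelian_monoid R by (rule R)
  have "f \<in> J \<rightarrow> carrier R" if "J \<subseteq> I" for J using f that by auto
  then show ?thesis using f
  proof (induction I rule: infinite_finite_induct)
    case (infinite I)
    then show ?case by (simp add: finsum_infinite zero zero_fun_def)
  next
    case empty
    then show ?case by (simp add: zero zero_fun_def)
  next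
    case (insert i I)
    then have "f \<in> I \<rightarrow> carrier R" "f i \<in> carrier R" by auto
    then have "finsum R f (insert i I) = f i \<oplus>\<^bsub>R\<^esub> finsum R f I" using insert by simp
    also have "finsum R f I = (\<Sum>i\<in>I. f i)" using insert by auto
    finally show ?case using insert by (simp add: add plus_fun_def)
  qed
qed

locale finite_group = group G for G (structure) +
  assumes fin: "finite (carrier G)"
begin

abbreviation conv :: "('a \<Rightarrow> rat) \<Rightarrow> ('a \<Rightarrow> rat) \<Rightarrow> 'a \<Rightarrow> rat" (infixl "\<star>" 70) where
  "a \<star> b \<equiv> a \<otimes>\<^bsub>group_algebra G\<^esub> b"

abbreviation \<delta> :: "'a \<Rightarrow> 'a \<Rightarrow> rat" where "\<delta> \<equiv> basis_elt"

abbreviation conjugate :: "'a \<Rightarrow> ('a \<Rightarrow> rat) \<Rightarrow> 'a \<Rightarrow> rat" where "conjugate \<equiv> conj_by G"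

lemma conv_apply: "g \<in> carrier G \<Longrightarrow> (a \<star> b) g = (\<Sum>h\<in>carrier G. a h * b (inv h \<otimes> g))"
  and conv_outside: "g \<notin> carrier G \<Longrightarrow> (a \<star> b) g = 0"
  and carrier_group_algebra: "carrier (group_algebra G) = functions_on (carrier G)"
  and one_group_algebra: "\<one>\<^bsub>group_algebra G\<^esub> = \<delta> \<one>"
  and zero_group_algebra: "\<zero>\<^bsub>group_algebra G\<^esub> = 0"
  and add_group_algebra: "a \<oplus>\<^bsub>group_algebra G\<^esub> b = a + b"
  by (simp_all add: group_algebra_def functions_on_def basis_elt_def fun_eq_iff)

lemma conv_closed: "a \<star> b \<in> functions_on (carrier G)"
  by (simp add: functions_on_def conv_outside)

lemma sum_translate:
  assumes "k \<in> carrier G" shows "(\<Sum>h\<in>carrier G. f (k \<otimes> h)) = (\<Sum>h\<in>carrier G. f h)"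
  by (rule sum.reindex_bij_witness[where i = "\<lambda>h. inv k \<otimes> h" and j = "\<lambda>h. k \<otimes> h"])
     (use assms in \<open>auto simp: m_assoc[symmetric]\<close>)

text \<open>Convolution reads its arguments on the group only, so it is associative and bilinear on all functions;
membership in the group algebra matters only for the unit laws.\<close>

lemma conv_assoc: "a \<star> b \<star> c = a \<star> (b \<star> c)"
proof
  fix g
  show "(a \<star> b \<star> c) g = (a \<star> (b \<star> c)) g"
  proof (cases "g \<in> carrier G")
    case True
    have "(a \<star> b \<star> c) g = (\<Sum>h\<in>carrier G. \<Sum>k\<in>carrier G. a k * b (inv k \<otimes> h) * c (inv h \<otimes> g))"
      using True by (simp add: conv_apply sum_distrib_right)
    also have "\<dots> = (\<Sum>k\<in>carrier G. \<Sum>h\<in>carrier G. a k * b (inv k \<otimes> h) * c (inv h \<otimes> g))"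
      by (rule sum.swap)
    also have "\<dots> = (\<Sum>k\<in>carrier G. \<Sum>h\<in>carrier G. a k * b h * c (inv h \<otimes> (inv k \<otimes> g)))"
    proof (rule sum.cong[OF refl])
      fix k assume k: "k \<in> carrier G"
      have "(\<Sum>h\<in>carrier G. a k * b (inv k \<otimes> h) * c (inv h \<otimes> g)) =
        (\<Sum>h\<in>carrier G. a k * b (inv k \<otimes> (k \<otimes> h)) * c (inv (k \<otimes> h) \<otimes> g))"
        by (rule sum_translate[OF k, symmetric])
      also have "\<dots> = (\<Sum>h\<in>carrier G. a k * b h * c (inv h \<otimes> (inv k \<otimes> g)))"
        using k True by (intro sum.cong refl) (simp add: m_assoc[symmetric] inv_mult_group)
      finally show "(\<Sum>h\<in>carrier G. a k * b (inv k \<otimes> h) * c (inv h \<otimes> g)) =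
        (\<Sum>h\<in>carrier G. a k * b h * c (inv h \<otimes> (inv k \<otimes> g)))" .
    qed
    also have "\<dots> = (a \<star> (b \<star> c)) g"
      using True by (simp add: conv_apply sum_distrib_left mult.assoc)
    finally show ?thesis .
  qed (simp add: conv_outside)
qed

lemma conv_add_left: "(a + b) \<star> c = a \<star> c + b \<star> c"
  and conv_add_right: "a \<star> (b + c) = a \<star> b + a \<star> c"
  and conv_diff_left: "(a - b) \<star> c = a \<star> c - b \<star> c"
  and conv_diff_right: "a \<star> (b - c) = a \<star> b - a \<star> c"
  and conv_minus_left: "(- a) \<star> c = - (a \<star> c)"
  and conv_minus_right: "a \<star> (- c) = - (a \<star> c)"
  and conv_scale_left: "(q *\<^sub>Q a) \<star> c = q *\<^sub>Q (a \<star> c)"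
  and conv_scale_right: "a \<star> (q *\<^sub>Q c) = q *\<^sub>Q (a \<star> c)"
  and conv_zero_left [simp]: "0 \<star> c = 0"
  and conv_zero_right [simp]: "c \<star> 0 = 0"
  by (auto simp: group_algebra_def fun_eq_iff algebra_simps sum.distrib sum_subtractf sum_negf sum_distrib_left)

lemma conv_sum_left: "(\<Sum>i\<in>I. f i) \<star> c = (\<Sum>i\<in>I. f i \<star> c)"
proof
  fix g show "((\<Sum>i\<in>I. f i) \<star> c) g = (\<Sum>i\<in>I. f i \<star> c) g"
    by (cases "g \<in> carrier G")
       (simp_all add: sum_fun_apply conv_outside conv_apply sum_distrib_right sum.swap[of _ I])
qed

lemma conv_sum_right: "c \<star> (\<Sum>i\<in>I. f i) = (\<Sum>i\<in>I. c \<star> f i)"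
proof
  fix g show "(c \<star> (\<Sum>i\<in>I. f i)) g = (\<Sum>i\<in>I. c \<star> f i) g"
    by (cases "g \<in> carrier G")
       (simp_all add: sum_fun_apply conv_outside conv_apply sum_distrib_left sum.swap[of _ I])
qed

lemmas conv_linear = conv_add_left conv_add_right conv_diff_left conv_diff_right conv_minus_left
  conv_minus_right conv_scale_left conv_scale_right conv_sum_left conv_sum_right

lemma delta_conv_apply:
  assumes "g \<in> carrier G" "h \<in> carrier G" shows "(\<delta> g \<star> a) h = a (inv g \<otimes> h)"
proof -
  have "(\<delta> g \<star> a) h = (\<Sum>k\<in>carrier G. if k = g then a (inv g \<otimes> h) else 0)"
    unfolding conv_apply[OF assms(2)] by (intro sum.cong) (auto simp: basis_elt_def)
  then show ?thesis using assms fin by simp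
qed

lemma conv_delta_apply:
  assumes "g \<in> carrier G" "h \<in> carrier G" shows "(a \<star> \<delta> g) h = a (h \<otimes> inv g)"
proof -
  have eq: "(inv k \<otimes> h = g) = (k = h \<otimes> inv g)" if "k \<in> carrier G" for k
    using that assms by (metis inv_closed inv_inv inv_solve_left inv_solve_right' m_closed)
  have "(a \<star> \<delta> g) h = (\<Sum>k\<in>carrier G. if k = h \<otimes> inv g then a (h \<otimes> inv g) else 0)"
    unfolding conv_apply[OF assms(2)] by (intro sum.cong) (auto simp: basis_elt_def eq)
  then show ?thesis using assms fin by simp
qed

lemma conv_ext:
  assumes "\<And>g. g \<in> carrier G \<Longrightarrow> a g = b g" "a \<in> functions_on (carrier G)" "b \<in> functions_on (carrier G)"
  shows "a = b"
proof
  fix g show "a g = b g" using assms by (cases "g \<in> carrier G") (simp_all add: functions_on_def)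
qed

lemma delta_mult:
  assumes "g \<in> carrier G" "h \<in> carrier G" shows "\<delta> g \<star> \<delta> h = \<delta> (g \<otimes> h)"
proof (rule conv_ext[OF _ conv_closed])
  fix k assume "k \<in> carrier G"
  then show "(\<delta> g \<star> \<delta> h) k = \<delta> (g \<otimes> h) k" using assms
    by (subst delta_conv_apply) (auto simp: basis_elt_def inv_solve_left m_assoc[symmetric])
qed (use assms in \<open>simp add: functions_on_closed\<close>)

lemma delta_one_left: "a \<in> functions_on (carrier G) \<Longrightarrow> \<delta> \<one> \<star> a = a"
  and delta_one_right: "a \<in> functions_on (carrier G) \<Longrightarrow> a \<star> \<delta> \<one> = a"
  by (rule conv_ext; simp add: delta_conv_apply conv_delta_apply conv_closed)+

lemma delta_mult_assoc: "g \<in> carrier G \<Longrightarrow> h \<in> carrier G \<Longrightarrow> \<delta> g \<star> (\<delta> h \<star> a) = \<delta> (g \<otimes> h) \<star> a"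
  by (simp add: conv_assoc[symmetric] delta_mult)

lemma conv_delta_one_mid: "a \<star> (\<delta> \<one> \<star> b) = a \<star> b"
  by (metis conv_assoc conv_closed delta_one_right one_closed delta_one_left)

lemma delta_inv_cancel: "g \<in> carrier G \<Longrightarrow> a \<star> (\<delta> g \<star> (\<delta> (inv g) \<star> b)) = a \<star> b"
  "g \<in> carrier G \<Longrightarrow> a \<star> (\<delta> (inv g) \<star> (\<delta> g \<star> b)) = a \<star> b"
  by (simp_all add: delta_mult_assoc conv_delta_one_mid)

lemma functions_on_conv:
  assumes S: "subgroup S G" and a: "a \<in> functions_on S" and b: "b \<in> functions_on S"
  shows "a \<star> b \<in> functions_on S"
  unfolding functions_on_def mem_Collect_eq
proof (intro allI impI)
  fix g assume g: "g \<notin> S"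
  show "(a \<star> b) g = 0"
  proof (cases "g \<in> carrier G")
    case True
    have "a h * b (inv h \<otimes> g) = 0" if h: "h \<in> carrier G" for h
    proof (cases "h \<in> S")
      case True
      then have "inv h \<otimes> g \<notin> S"
        using g h \<open>g \<in> carrier G\<close> S by (metis inv_solve_left m_closed subgroup.m_closed subgroup.m_inv_closed inv_closed)
      then show ?thesis using b by (simp add: functions_on_def)
    qed (use a in \<open>simp add: functions_on_def\<close>)
    then show ?thesis unfolding conv_apply[OF True] by (intro sum.neutral) blast
  qed (simp add: conv_outside)
qed

lemma conv_commute_of_delta:
  assumes "S \<subseteq> carrier G" "a \<in> functions_on S" "\<And>g. g \<in> S \<Longrightarrow> \<delta> g \<star> b = b \<star> \<delta> g"
  shows "a \<star> b = b \<star> a"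
proof -
  have a: "a = (\<Sum>g\<in>S. a g *\<^sub>Q \<delta> g)"
    using assms fin finite_subset by (intro basis_expansion) auto
  show ?thesis by (subst (1 2) a) (simp add: conv_linear assms(3) cong: sum.cong)
qed

lemma conjugate_apply:
  "g \<in> carrier G \<Longrightarrow> h \<in> carrier G \<Longrightarrow> conjugate g a h = a (inv g \<otimes> h \<otimes> g)"
  by (simp add: conj_by_def conv_delta_apply delta_conv_apply m_assoc)

lemma conjugate_closed: "conjugate g a \<in> functions_on (carrier G)"
  by (simp add: conj_by_def conv_closed)

lemma conjugate_linear:
  "conjugate g (a + b) = conjugate g a + conjugate g b"
  "conjugate g (a - b) = conjugate g a - conjugate g b"
  "conjugate g (c *\<^sub>Q a) = c *\<^sub>Q conjugate g a"
  "conjugate g (- a) = - conjugate g a"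
  "conjugate g (\<Sum>i\<in>I. f i) = (\<Sum>i\<in>I. conjugate g (f i))"
  "conjugate g 0 = 0"
  by (simp_all add: conj_by_def conv_linear)

lemma conjugate_mult: "g \<in> carrier G \<Longrightarrow> conjugate g (a \<star> b) = conjugate g a \<star> conjugate g b"
  by (simp add: conj_by_def conv_assoc delta_inv_cancel)

lemma conjugate_conjugate:
  "g \<in> carrier G \<Longrightarrow> h \<in> carrier G \<Longrightarrow> conjugate g (conjugate h a) = conjugate (g \<otimes> h) a"
  by (simp add: conj_by_def conv_assoc delta_mult_assoc delta_mult inv_mult_group)

lemma conjugate_one: "a \<in> functions_on (carrier G) \<Longrightarrow> conjugate \<one> a = a"
  by (simp add: conj_by_def delta_one_left delta_one_right)

lemma conjugate_delta: "g \<in> carrier G \<Longrightarrow> h \<in> carrier G \<Longrightarrow> conjugate g (\<delta> h) = \<delta> (g \<otimes> h \<otimes> inv g)"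
  by (simp add: conj_by_def delta_mult)

lemma delta_conv_swap: "g \<in> carrier G \<Longrightarrow> \<delta> g \<star> a = conjugate g a \<star> \<delta> g"
  by (simp add: conj_by_def conv_assoc delta_mult) (metis conv_assoc conv_closed delta_one_right)

lemma conjugate_eq_self_iff:
  assumes "g \<in> carrier G" "a \<in> functions_on (carrier G)"
  shows "conjugate g a = a \<longleftrightarrow> \<delta> g \<star> a = a \<star> \<delta> g"
proof
  assume "conjugate g a = a"
  then show "\<delta> g \<star> a = a \<star> \<delta> g" using delta_conv_swap[OF assms(1), of a] by simp
next
  assume "\<delta> g \<star> a = a \<star> \<delta> g"
  then show "conjugate g a = a" using assms
    by (simp add: conj_by_def conv_assoc delta_mult delta_one_right)
qed

lemma hat_expansion: "finite S \<Longrightarrow> hat S = (\<Sum>s\<in>S. (1 / of_nat (card S)) *\<^sub>Q \<delta> s)"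
  using basis_expansion[of S "hat S"] by (simp add: functions_on_closed) (simp add: hat_def)

lemma hat_conv_fixed:
  assumes "S \<subseteq> carrier G" "S \<noteq> {}" "\<And>s. s \<in> S \<Longrightarrow> \<delta> s \<star> a = a"
  shows "hat S \<star> a = a"
proof -
  have "finite S" using assms fin finite_subset by blast
  then have "hat S \<star> a = (\<Sum>s\<in>S. (1 / of_nat (card S)) *\<^sub>Q a)"
    by (simp add: hat_expansion conv_linear assms(3))
  also have "\<dots> = a" using \<open>finite S\<close> assms(2) by (auto simp: fun_eq_iff sum_fun_apply)
  finally show ?thesis .
qed

lemma subgroup_mult_mem_iff:
  assumes "subgroup S G" "s \<in> S" "h \<in> carrier G"
  shows "s \<otimes> h \<in> S \<longleftrightarrow> h \<in> S" "h \<otimes> s \<in> S \<longleftrightarrow> h \<in> S"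
proof -
  have s: "s \<in> carrier G" "inv s \<in> S" using assms subgroup.mem_carrier subgroup.m_inv_closed by metis+
  have "inv s \<otimes> (s \<otimes> h) = h" "(h \<otimes> s) \<otimes> inv s = h"
    using s assms(3) by (simp add: m_assoc[symmetric], simp add: m_assoc)
  then show "s \<otimes> h \<in> S \<longleftrightarrow> h \<in> S" "h \<otimes> s \<in> S \<longleftrightarrow> h \<in> S"
    using subgroup.m_closed[OF assms(1)] s(2) assms(2) by metis+
qed

lemma delta_conv_hat:
  assumes "subgroup S G" "s \<in> S" shows "\<delta> s \<star> hat S = hat S" "hat S \<star> \<delta> s = hat S"
proof -
  have s: "s \<in> carrier G" using subgroup.mem_carrier[OF assms] .
  have "inv s \<otimes> h \<in> S \<longleftrightarrow> h \<in> S" "h \<otimes> inv s \<in> S \<longleftrightarrow> h \<in> S" if "h \<in> carrier G" for h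
    using subgroup_mult_mem_iff[OF assms(1) subgroup.m_inv_closed[OF assms] that] .
  note mem = this
  have hat_on: "hat S \<in> functions_on (carrier G)"
    using functions_on_closed(8)[OF subgroup.subset[OF assms(1)]] .
  show "\<delta> s \<star> hat S = hat S"
  proof (rule conv_ext[OF _ conv_closed hat_on])
    fix h assume "h \<in> carrier G"
    then show "(\<delta> s \<star> hat S) h = hat S h" using s mem by (simp add: delta_conv_apply) (simp add: hat_def)
  qed
  show "hat S \<star> \<delta> s = hat S"
  proof (rule conv_ext[OF _ conv_closed hat_on])
    fix h assume "h \<in> carrier G"
    then show "(hat S \<star> \<delta> s) h = hat S h" using s mem by (simp add: conv_delta_apply) (simp add: hat_def)
  qed
qed

lemma hat_mult_hat:
  assumes "subgroup S G" "subgroup M G" "S \<subseteq> M" shows "hat S \<star> hat M = hat M" "hat M \<star> hat S = hat M"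
proof -
  have M: "M \<subseteq> carrier G" and S: "S \<subseteq> carrier G" using assms subgroup.subset by auto
  have ne: "S \<noteq> {}" using assms(1) subgroup.one_closed by blast
  have "\<delta> s \<star> hat M = hat M" "hat M \<star> \<delta> s = hat M" if "s \<in> S" for s
    using delta_conv_hat[OF assms(2), of s] assms that by auto
  then show 1: "hat S \<star> hat M = hat M" and "hat M \<star> hat S = hat M"
    using hat_conv_fixed[OF S ne] conv_commute_of_delta[OF S, of "hat S" "hat M"] functions_on_closed(8)[of S S] by auto
qed

lemma conjugate_hat:
  assumes "g \<in> carrier G" "S \<subseteq> carrier G" "\<And>s. s \<in> carrier G \<Longrightarrow> inv g \<otimes> s \<otimes> g \<in> S \<longleftrightarrow> s \<in> S"
  shows "conjugate g (hat S) = hat S"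
proof (rule conv_ext[OF _ conjugate_closed functions_on_closed(8)[OF assms(2)]])
  fix h assume "h \<in> carrier G"
  then show "conjugate g (hat S) h = hat S h" using assms by (simp add: conjugate_apply) (simp add: hat_def)
qed

end

section \<open>Quotients and the linear characters of H/K\<close>

context finite_group
begin

lemma coset_eq_iff:
  assumes L: "subgroup L G" and a: "a \<in> carrier G" and b: "b \<in> carrier G"
  shows "L #> a = L #> b \<longleftrightarrow> a \<otimes> inv b \<in> L"
proof
  assume "L #> a = L #> b"
  then have "a \<in> L #> b" using rcos_self[OF a L] by simp
  then obtain l where "l \<in> L" "a = l \<otimes> b" by (auto simp: r_coset_def)
  then show "a \<otimes> inv b \<in> L" using b subgroup.mem_carrier[OF L] by (simp add: m_assoc)
next
  assume l: "a \<otimes> inv b \<in> L"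
  have "a = (a \<otimes> inv b) \<otimes> b" using a b by (simp add: m_assoc)
  then have "a \<in> L #> b" using l by (auto simp: r_coset_def)
  then show "L #> a = L #> b" using repr_independence[OF _ b L] by simp
qed

lemma subgroup_nat_pow_closed:
  assumes "subgroup S G" "a \<in> S" shows "a [^] (m::nat) \<in> S"
  by (induction m) (simp_all add: subgroup.one_closed[OF assms(1)] subgroup.m_closed[OF assms(1) _ assms(2)])

text \<open>Used for the three quotients \<open>H/K\<close>, \<open>N/K\<close> and \<open>N/H\<close>, so that computations in them become computations
with representatives in \<open>G\<close>.\<close>

lemma quotient_facts:
  assumes S: "subgroup S G" and L: "subgroup L G" and LS: "L \<subseteq> S"
    and norm: "\<forall>s\<in>S. \<forall>x\<in>L. s \<otimes> x \<otimes> inv s \<in> L"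
  shows quotient_group: "group (quot G S L)"
    and quotient_carrier: "carrier (quot G S L) = (\<lambda>a. L #> a) ` S"
    and quotient_one: "\<one>\<^bsub>quot G S L\<^esub> = L"
    and quotient_mult: "\<And>a b. a \<in> S \<Longrightarrow> b \<in> S \<Longrightarrow> (L #> a) \<otimes>\<^bsub>quot G S L\<^esub> (L #> b) = L #> (a \<otimes> b)"
    and quotient_inv: "\<And>a. a \<in> S \<Longrightarrow> inv\<^bsub>quot G S L\<^esub> (L #> a) = L #> inv a"
    and quotient_pow: "\<And>a m. a \<in> S \<Longrightarrow> (L #> a) [^]\<^bsub>quot G S L\<^esub> (m::nat) = L #> (a [^] m)"
proof -
  let ?S = "G\<lparr>carrier := S\<rparr>"
  interpret S: group ?S using subgroup_imp_group[OF S] .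
  have "subgroup L ?S" using subgroup_incl[OF L S LS] .
  moreover have "x \<otimes>\<^bsub>?S\<^esub> h \<otimes>\<^bsub>?S\<^esub> inv\<^bsub>?S\<^esub> x \<in> L" if "x \<in> carrier ?S" "h \<in> L" for x h
    using that norm m_inv_consistent[OF S, of x] by simp
  ultimately have N: "L \<lhd> ?S" by (rule S.normal_invI)
  interpret N: normal L ?S by (rule N)
  have coset: "L #>\<^bsub>?S\<^esub> a = L #> a" for a by (simp add: r_coset_def)
  have smult: "A <#>\<^bsub>?S\<^esub> B = A <#> B" for A B by (simp add: set_mult_def)
  show grp: "group (quot G S L)" by (rule N.factorgroup_is_group)
  then interpret Q: group "quot G S L" .
  show carr: "carrier (quot G S L) = (\<lambda>a. L #> a) ` S"
    by (auto simp: FactGroup_def RCOSETS_def coset)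
  show one: "\<one>\<^bsub>quot G S L\<^esub> = L" by (simp add: FactGroup_def)
  show mult: "(L #> a) \<otimes>\<^bsub>quot G S L\<^esub> (L #> b) = L #> (a \<otimes> b)" if "a \<in> S" "b \<in> S" for a b
    using N.rcos_sum[of a b] that by (simp add: FactGroup_def coset)
  have L1: "L = L #> \<one>" using coset_mult_one[OF subgroup.subset[OF L]] by simp
  have SG: "s \<in> carrier G" if "s \<in> S" for s using subgroup.mem_carrier[OF S that] .
  show "inv\<^bsub>quot G S L\<^esub> (L #> a) = L #> inv a" if a: "a \<in> S" for a
  proof (rule Q.inv_equality)
    show "(L #> inv a) \<otimes>\<^bsub>quot G S L\<^esub> (L #> a) = \<one>\<^bsub>quot G S L\<^esub>"
      unfolding mult[OF subgroup.m_inv_closed[OF S a] a] one l_inv[OF SG[OF a]] using L1 by simp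
  qed (use a subgroup.m_inv_closed[OF S a] carr in auto)
  show "(L #> a) [^]\<^bsub>quot G S L\<^esub> (m::nat) = L #> (a [^] m)" if a: "a \<in> S" for a m
  proof (induction m)
    case 0
    show ?case using one L1 by simp
  next
    case (Suc m)
    have "a [^] m \<in> S" by (rule subgroup_nat_pow_closed[OF S a])
    then show ?case using Suc mult[OF _ a] by simp
  qed
qed

end

locale strong_shoda = finite_group G for G (structure) +
  fixes H K :: "'a set" and y :: 'a and \<zeta> :: complex
  assumes ssp: "strong_shoda_pair G H K"
    and yH: "y \<in> H"
    and y_gen: "subgroup_generated (quot G H K) {K #> y} = quot G H K"
    and \<zeta>_primitive: "primitive_root_of_unity (card (carrier (quot G H K))) \<zeta>"
begin

abbreviation N :: "'a set" where "N \<equiv> normalizer G K"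
abbreviation \<epsilon> :: "'a \<Rightarrow> rat" where "\<epsilon> \<equiv> eps G H K"
definition k :: nat where "k = card (carrier (quot G H K))"

lemma sub_H: "subgroup H G" and sub_K: "subgroup K G" and K_le_H: "K \<subseteq> H"
  using ssp by (auto simp: strong_shoda_pair_def)

lemma sub_N: "subgroup N G"
  using normalizer_imp_subgroup subgroup.subset[OF sub_K] by blast

lemma H_le_N: "H \<subseteq> N" and H_normal: "n \<in> N \<Longrightarrow> h \<in> H \<Longrightarrow> n \<otimes> h \<otimes> inv n \<in> H"
proof -
  let ?N = "G\<lparr>carrier := N\<rparr>"
  have n: "H \<lhd> ?N" using ssp by (auto simp: strong_shoda_pair_def)
  interpret N: group ?N using subgroup_imp_group[OF sub_N] .
  show "H \<subseteq> N" using subgroup.subset[OF N.normal_invE(1)[OF n]] by simp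
  show "n \<otimes> h \<otimes> inv n \<in> H" if "n \<in> N" "h \<in> H"
    using N.normal_invE(2)[OF n, of n h] that m_inv_consistent[OF sub_N, of n] by simp
qed

lemma memG: "n \<in> N \<Longrightarrow> n \<in> carrier G" "h \<in> H \<Longrightarrow> h \<in> carrier G" "x \<in> K \<Longrightarrow> x \<in> carrier G"
  by (simp_all add: subgroup.mem_carrier[OF sub_N] subgroup.mem_carrier[OF sub_H] subgroup.mem_carrier[OF sub_K])

lemma H_in_N: "h \<in> H \<Longrightarrow> h \<in> N" using H_le_N by blast
lemma K_in_H: "x \<in> K \<Longrightarrow> x \<in> H" using K_le_H by blast

lemma N_iff: "n \<in> N \<longleftrightarrow> n \<in> carrier G \<and> n <# K #> inv n = K"
  using subgroup.subset[OF sub_K] by (auto simp: normalizer_def stabilizer_def)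

lemma K_normal: "n \<in> N \<Longrightarrow> x \<in> K \<Longrightarrow> n \<otimes> x \<otimes> inv n \<in> K"
  using N_iff[of n] by (auto simp: l_coset_def r_coset_def)

lemma N_closed: "a \<in> N \<Longrightarrow> b \<in> N \<Longrightarrow> a \<otimes> b \<in> N" "a \<in> N \<Longrightarrow> inv a \<in> N"
  "a \<in> N \<Longrightarrow> a [^] (m::nat) \<in> N"
  by (simp_all add: subgroup.m_closed[OF sub_N] subgroup.m_inv_closed[OF sub_N] subgroup_nat_pow_closed[OF sub_N])
lemma H_closed: "a \<in> H \<Longrightarrow> b \<in> H \<Longrightarrow> a \<otimes> b \<in> H" "a \<in> H \<Longrightarrow> inv a \<in> H"
  "a \<in> H \<Longrightarrow> a [^] (m::nat) \<in> H"
  by (simp_all add: subgroup.m_closed[OF sub_H] subgroup.m_inv_closed[OF sub_H] subgroup_nat_pow_closed[OF sub_H])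
lemma K_closed: "a \<in> K \<Longrightarrow> b \<in> K \<Longrightarrow> a \<otimes> b \<in> K" "a \<in> K \<Longrightarrow> inv a \<in> K"
  by (simp_all add: subgroup.m_closed[OF sub_K] subgroup.m_inv_closed[OF sub_K])

lemma H_normal_iff':
  assumes "n \<in> N" "x \<in> carrier G" shows "inv n \<otimes> x \<otimes> n \<in> H \<longleftrightarrow> x \<in> H"
proof
  assume a: "inv n \<otimes> x \<otimes> n \<in> H"
  have "n \<otimes> (inv n \<otimes> x \<otimes> n) \<otimes> inv n = x"
    using memG(1)[OF assms(1)] assms(2) by (simp add: m_assoc) (simp add: m_assoc[symmetric])
  then show "x \<in> H" using H_normal[OF assms(1) a] by simp
next
  assume "x \<in> H"
  then show "inv n \<otimes> x \<otimes> n \<in> H" using H_normal[OF N_closed(2)[OF assms(1)], of x] memG(1)[OF assms(1)] by simp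
qed

lemma conj_invariant: "\<forall>s\<in>H. \<forall>x\<in>K. s \<otimes> x \<otimes> inv s \<in> K" "\<forall>s\<in>N. \<forall>x\<in>K. s \<otimes> x \<otimes> inv s \<in> K"
    "\<forall>s\<in>N. \<forall>x\<in>H. s \<otimes> x \<otimes> inv s \<in> H"
  by (simp_all add: K_normal H_normal H_in_N)

lemmas HK_quotient = quotient_facts[OF sub_H sub_K K_le_H conj_invariant(1)]
lemmas NK_quotient = quotient_facts[OF sub_N sub_K order_trans[OF K_le_H H_le_N] conj_invariant(2)]
lemmas NH_quotient = quotient_facts[OF sub_N sub_H H_le_N conj_invariant(3)]

lemma finite_subset_G: "S \<subseteq> carrier G \<Longrightarrow> finite S" using fin finite_subset by blast
lemma fin_H: "finite H" and fin_K: "finite K" and fin_N: "finite N"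
  using finite_subset_G subgroup.subset sub_H sub_K sub_N by blast+

lemma fin_HK: "finite (carrier (quot G H K))" using HK_quotient(2) fin_H by simp

lemma k_pos: "k > 0"
proof -
  interpret Q: group "quot G H K" by (rule HK_quotient(1))
  show ?thesis using Q.one_closed fin_HK by (auto simp: k_def card_gt_0_iff)
qed

lemma y_pow_mem_K_iff: "y [^] (m::nat) \<in> K \<longleftrightarrow> k dvd m"
  and H_generated: "h \<in> H \<Longrightarrow> \<exists>m::nat. \<exists>x\<in>K. h = x \<otimes> y [^] m"
proof -
  interpret Q: group "quot G H K" by (rule HK_quotient(1))
  have yQ: "K #> y \<in> carrier (quot G H K)" using yH HK_quotient(2) by auto
  have gen: "carrier (quot G H K) = generate (quot G H K) {K #> y}"
    using arg_cong[OF y_gen, of carrier] yQ by (simp add: carrier_subgroup_generated)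
  have "Q.ord (K #> y) = k" using Q.generate_pow_card[OF yQ] gen by (simp add: k_def)
  then have "(K #> y) [^]\<^bsub>quot G H K\<^esub> m = \<one>\<^bsub>quot G H K\<^esub> \<longleftrightarrow> k dvd m" using Q.pow_eq_id[OF yQ, of m] by simp
  then have "K #> y [^] m = K \<longleftrightarrow> k dvd m" using HK_quotient(3) HK_quotient(6)[OF yH, of m] by simp
  moreover have "K #> y [^] m = K \<longleftrightarrow> y [^] m \<in> K"
    using coset_join1[OF _ _ sub_K] coset_join2[OF _ sub_K] memG(2)[OF H_closed(3)[OF yH]] by metis
  ultimately show "y [^] m \<in> K \<longleftrightarrow> k dvd m" by simp
  show "\<exists>m::nat. \<exists>x\<in>K. h = x \<otimes> y [^] m" if h: "h \<in> H"
  proof -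
    have "K #> h \<in> generate (quot G H K) {K #> y}" using h gen HK_quotient(2) by auto
    then obtain m :: nat where "K #> h = (K #> y) [^]\<^bsub>quot G H K\<^esub> m"
      using Q.generate_pow_on_finite_carrier[OF fin_HK yQ] by auto
    then have "K #> h = K #> y [^] m" using HK_quotient(6)[OF yH] by simp
    then have "h \<in> K #> y [^] m" using rcos_self[OF memG(2)[OF h] sub_K] by simp
    then show ?thesis by (auto simp: r_coset_def)
  qed
qed

lemma \<zeta>_pow_eq_1_iff: "\<zeta> ^ m = 1 \<longleftrightarrow> k dvd m"
proof -
  have z: "\<zeta> ^ k = 1" "\<And>j. 0 < j \<Longrightarrow> j < k \<Longrightarrow> \<zeta> ^ j \<noteq> 1"
    using \<zeta>_primitive by (auto simp: primitive_root_of_unity_def k_def)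
  have "\<zeta> ^ m = \<zeta> ^ (k * (m div k) + m mod k)" by simp
  also have "\<dots> = \<zeta> ^ (m mod k)" by (simp only: power_add power_mult z power_one mult_1)
  finally show ?thesis using z(2)[of "m mod k"] k_pos mod_less_divisor[OF k_pos, of m]
    by (cases "m mod k = 0") (auto simp: dvd_eq_mod_eq_0)
qed

lemma \<zeta>_nonzero: "\<zeta> \<noteq> 0"
  using \<zeta>_pow_eq_1_iff[of k] k_pos by (auto simp: zero_power)

text \<open>The character \<open>x y\<^sup>m \<mapsto> \<zeta>\<^sup>m\<close> of \<open>H\<close> with kernel \<open>K\<close>. The exponent is determined modulo the order of \<open>\<zeta>\<close>.\<close>

definition lin_char :: "'a \<Rightarrow> complex" where
  "lin_char h = \<zeta> ^ (SOME m. \<exists>x\<in>K. h = x \<otimes> y [^] m)"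

lemma lin_char_pow:
  assumes x: "x \<in> K" shows "lin_char (x \<otimes> y [^] (m::nat)) = \<zeta> ^ m"
proof -
  have le: "\<zeta> ^ a = \<zeta> ^ b" if eq: "x \<otimes> y [^] a = x' \<otimes> y [^] b" and x: "x \<in> K" "x' \<in> K" and "a \<le> b"
    for a b :: nat and x x'
  proof -
    obtain d where d: "b = d + a" using \<open>a \<le> b\<close> by (metis le_Suc_ex add.commute)
    have G: "x \<in> carrier G" "x' \<in> carrier G" "y \<in> carrier G" using memG x yH by auto
    have "x \<otimes> y [^] a = (x' \<otimes> y [^] d) \<otimes> y [^] a" using eq G by (simp add: d nat_pow_mult[symmetric] m_assoc)
    then have "x = x' \<otimes> y [^] d" using right_cancel[of "y [^] a" x "x' \<otimes> y [^] d"] G by simp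
    then have "y [^] d = inv x' \<otimes> x" using G by (simp add: m_assoc[symmetric])
    then have "y [^] d \<in> K" using x K_closed by simp
    then have "\<zeta> ^ d = 1" using \<zeta>_pow_eq_1_iff y_pow_mem_K_iff by simp
    then show ?thesis by (simp add: d power_add)
  qed
  define a where "a = (SOME a::nat. \<exists>x'\<in>K. x \<otimes> y [^] m = x' \<otimes> y [^] a)"
  have "\<exists>a. \<exists>x'\<in>K. x \<otimes> y [^] m = x' \<otimes> y [^] (a::nat)" using x by blast
  then have "\<exists>x'\<in>K. x \<otimes> y [^] m = x' \<otimes> y [^] a" unfolding a_def by (rule someI_ex)
  then obtain x' where "x' \<in> K" "x \<otimes> y [^] m = x' \<otimes> y [^] a" by blast
  then have "\<zeta> ^ a = \<zeta> ^ m" using le[of x m x' a] le[of x' a x m] x by (metis nat_le_linear)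
  then show ?thesis by (simp add: lin_char_def a_def)
qed

lemma lin_char_mult:
  assumes "g \<in> H" "h \<in> H" shows "lin_char (g \<otimes> h) = lin_char g * lin_char h"
proof -
  obtain a b x z where a: "x \<in> K" "g = x \<otimes> y [^] (a::nat)" and b: "z \<in> K" "h = z \<otimes> y [^] (b::nat)"
    using H_generated assms by metis
  have G: "x \<in> carrier G" "z \<in> carrier G" "y \<in> carrier G" using memG a b yH by auto
  define z' where "z' = y [^] a \<otimes> z \<otimes> inv (y [^] a)"
  have z': "z' \<in> K" unfolding z'_def using K_normal[OF H_in_N[OF H_closed(3)[OF yH]] b(1)] .
  have "z' \<otimes> y [^] a = y [^] a \<otimes> z" using G by (simp add: z'_def m_assoc)
  then have "g \<otimes> h = x \<otimes> (z' \<otimes> y [^] a) \<otimes> y [^] b" using G by (simp add: a b m_assoc)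
  also have "\<dots> = (x \<otimes> z') \<otimes> y [^] (a + b)" using G memG(3)[OF z'] by (simp add: m_assoc nat_pow_mult)
  finally show ?thesis using lin_char_pow[OF K_closed(1)[OF a(1) z']] lin_char_pow[OF a(1)] lin_char_pow[OF b(1)]
    by (simp add: a(2) b(2) power_add)
qed

lemma lin_char_eq_1_iff: assumes "h \<in> H" shows "lin_char h = 1 \<longleftrightarrow> h \<in> K"
proof -
  obtain a x where a: "x \<in> K" "h = x \<otimes> y [^] (a::nat)" using H_generated assms by metis
  have "h \<in> K \<longleftrightarrow> y [^] a \<in> K"
    using subgroup_mult_mem_iff(1)[OF sub_K a(1) memG(2)[OF H_closed(3)[OF yH]]] by (simp add: a(2))
  then show ?thesis using lin_char_pow[OF a(1), of a] \<zeta>_pow_eq_1_iff y_pow_mem_K_iff by (simp add: a(2))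
qed

text \<open>The linear extension to \<open>\<rat>H\<close> of the \<open>j\<close>-th power of that character. As \<open>H/K\<close> is cyclic, these are all
characters of \<open>H/K\<close>.\<close>

definition chi :: "nat \<Rightarrow> ('a \<Rightarrow> rat) \<Rightarrow> complex" where
  "chi j a = (\<Sum>h\<in>H. of_rat (a h) * lin_char h ^ j)"

lemma chi_diff: "chi j (a - b) = chi j a - chi j b"
  by (simp add: chi_def of_rat_diff algebra_simps sum_subtractf)

lemma sum_translate_subgroup:
  assumes S: "subgroup S G" and s: "s \<in> S" shows "(\<Sum>h\<in>S. f (s \<otimes> h)) = (\<Sum>h\<in>S. f h)"
proof (rule sum.reindex_bij_witness[where i = "\<lambda>h. inv s \<otimes> h" and j = "\<lambda>h. s \<otimes> h"])
  note c = subgroup.m_closed[OF S] subgroup.m_inv_closed[OF S] subgroup.mem_carrier[OF S]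
  fix h assume h: "h \<in> S"
  show "inv s \<otimes> (s \<otimes> h) = h" "s \<otimes> (inv s \<otimes> h) = h" "inv s \<otimes> h \<in> S" "s \<otimes> h \<in> S"
    using c s h by (simp_all add: m_assoc[symmetric])
qed simp

lemma chi_mult:
  assumes a: "a \<in> functions_on H" and b: "b \<in> functions_on H"
  shows "chi j (a \<star> b) = chi j a * chi j b"
proof -
  have HG: "H \<subseteq> carrier G" using subgroup.subset[OF sub_H] .
  have "chi j (a \<star> b) = (\<Sum>g\<in>H. (\<Sum>h\<in>H. of_rat (a h) * of_rat (b (inv h \<otimes> g))) * lin_char g ^ j)"
    unfolding chi_def
  proof (rule sum.cong[OF refl])
    fix g assume g: "g \<in> H"
    have "(a \<star> b) g = (\<Sum>h\<in>H. a h * b (inv h \<otimes> g))"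
      unfolding conv_apply[OF memG(2)[OF g]] using HG fin a
      by (intro sum.mono_neutral_right) (auto simp: functions_on_def)
    then show "of_rat ((a \<star> b) g) * lin_char g ^ j = (\<Sum>h\<in>H. of_rat (a h) * of_rat (b (inv h \<otimes> g))) * lin_char g ^ j"
      by (simp add: of_rat_sum of_rat_mult)
  qed
  also have "\<dots> = (\<Sum>h\<in>H. \<Sum>g\<in>H. of_rat (a h) * of_rat (b (inv h \<otimes> g)) * lin_char g ^ j)"
    unfolding sum_distrib_right by (rule sum.swap)
  also have "\<dots> = (\<Sum>h\<in>H. of_rat (a h) * lin_char h ^ j * chi j b)"
  proof (rule sum.cong[OF refl])
    fix h assume h: "h \<in> H"
    have "(\<Sum>g\<in>H. of_rat (a h) * of_rat (b (inv h \<otimes> g)) * lin_char g ^ j) =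
      (\<Sum>g\<in>H. of_rat (a h) * of_rat (b (inv h \<otimes> (h \<otimes> g))) * lin_char (h \<otimes> g) ^ j)"
      by (rule sum_translate_subgroup[OF sub_H h, symmetric])
    also have "\<dots> = (\<Sum>g\<in>H. of_rat (a h) * of_rat (b g) * (lin_char h * lin_char g) ^ j)"
      using h memG(2) by (intro sum.cong[OF refl]) (simp add: m_assoc[symmetric] lin_char_mult)
    also have "\<dots> = of_rat (a h) * lin_char h ^ j * chi j b"
      unfolding chi_def sum_distrib_left by (intro sum.cong[OF refl]) (simp add: power_mult_distrib)
    finally show "(\<Sum>g\<in>H. of_rat (a h) * of_rat (b (inv h \<otimes> g)) * lin_char g ^ j) = of_rat (a h) * lin_char h ^ j * chi j b" .
  qed
  also have "\<dots> = chi j a * chi j b" by (simp add: chi_def sum_distrib_right)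
  finally show ?thesis .
qed

text \<open>Orthogonality of characters on a subgroup: translating by \<open>m\<close> multiplies the sum over \<open>M\<close> by the value at
\<open>m\<close>.\<close>

lemma chi_hat:
  assumes M: "subgroup M G" "M \<subseteq> H"
  shows "(\<And>m. m \<in> M \<Longrightarrow> lin_char m ^ j = 1) \<Longrightarrow> chi j (hat M) = 1"
    and "m \<in> M \<Longrightarrow> lin_char m ^ j \<noteq> 1 \<Longrightarrow> chi j (hat M) = 0"
proof -
  have fin: "finite M" using M finite_subset_G subgroup.subset by blast
  have ne: "card M > 0" using fin subgroup.one_closed[OF M(1)] card_gt_0_iff by blast
  have eq: "chi j (hat M) = (\<Sum>m\<in>M. lin_char m ^ j) / of_nat (card M)"
  proof -
    have "chi j (hat M) = (\<Sum>m\<in>M. of_rat (hat M m) * lin_char m ^ j)"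
      unfolding chi_def using M(2) fin_H by (intro sum.mono_neutral_right) (auto simp: hat_def)
    also have "\<dots> = (\<Sum>m\<in>M. lin_char m ^ j / of_nat (card M))"
      by (intro sum.cong[OF refl]) (simp add: hat_def of_rat_divide)
    finally show ?thesis by (simp add: sum_divide_distrib)
  qed
  show "chi j (hat M) = 1" if "\<And>m. m \<in> M \<Longrightarrow> lin_char m ^ j = 1"
    using ne that by (simp add: eq)
  show "chi j (hat M) = 0" if m: "m \<in> M" "lin_char m ^ j \<noteq> 1"
  proof -
    have "(\<Sum>x\<in>M. lin_char x ^ j) = (\<Sum>x\<in>M. lin_char (m \<otimes> x) ^ j)"
      by (rule sum_translate_subgroup[OF M(1) m(1), symmetric])
    also have "\<dots> = lin_char m ^ j * (\<Sum>x\<in>M. lin_char x ^ j)"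
      unfolding sum_distrib_left using m M(2)
      by (intro sum.cong[OF refl]) (simp add: lin_char_mult subsetD power_mult_distrib)
    finally show ?thesis using m(2) by (simp add: eq)
  qed
qed

text \<open>The polynomial whose value at \<open>\<zeta>\<^sup>j\<close> is the \<open>j\<close>-th Fourier coefficient of a function constant on the cosets
of \<open>K\<close>; the factor is the size of a coset.\<close>

definition chi_poly :: "('a \<Rightarrow> rat) \<Rightarrow> rat poly" where
  "chi_poly a = (\<Sum>m<k. Polynomial.monom (of_nat (card K) * a (y [^] m)) m)"

lemma y_cosets_bij: "bij_betw (\<lambda>(m, x). x \<otimes> y [^] m) ({..<k} \<times> K) H"
proof (rule bij_betw_imageI)
  have G: "y \<in> carrier G" using memG yH by auto
  have diff: "a = b" if "a \<le> b" "b < k" "x \<in> K" "z \<in> K" "x \<otimes> y [^] a = z \<otimes> y [^] b" for a b :: nat and x z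
  proof -
    have "\<zeta> ^ a = \<zeta> ^ b" using lin_char_pow[OF that(3), of a] lin_char_pow[OF that(4), of b] that(5) by simp
    moreover have "\<zeta> ^ b = \<zeta> ^ a * \<zeta> ^ (b - a)" using that(1) by (simp add: power_add[symmetric])
    ultimately have "\<zeta> ^ (b - a) = 1" using \<zeta>_nonzero by simp
    then have "k dvd b - a" using \<zeta>_pow_eq_1_iff by simp
    then show ?thesis using that(1,2) by (metis diff_is_0_eq le_antisym less_imp_diff_less nat_dvd_not_less not_gr_zero)
  qed
  show "inj_on (\<lambda>(m, x). x \<otimes> y [^] m) ({..<k} \<times> K)"
  proof (rule inj_onI, clarsimp)
    fix a b x z assume *: "a < k" "b < k" "x \<in> K" "z \<in> K" "x \<otimes> y [^] a = z \<otimes> y [^] b"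
    then have "a = b" using diff[of a b x z] diff[of b a z x] by (metis nat_le_linear)
    then show "a = b \<and> x = z" using * G memG(3) right_cancel[of "y [^] a" x z] by simp
  qed
  show "(\<lambda>(m, x). x \<otimes> y [^] m) ` ({..<k} \<times> K) = H"
  proof (intro equalityI subsetI)
    fix h assume h: "h \<in> H"
    obtain a x where a: "x \<in> K" "h = x \<otimes> y [^] (a::nat)" using H_generated h by metis
    have "y [^] a = y [^] (k * (a div k)) \<otimes> y [^] (a mod k)" using G by (simp add: nat_pow_mult)
    moreover have "y [^] (k * (a div k)) \<in> K" using y_pow_mem_K_iff by simp
    ultimately have "h = (x \<otimes> y [^] (k * (a div k))) \<otimes> y [^] (a mod k)" "x \<otimes> y [^] (k * (a div k)) \<in> K"
      using a G memG(3)[OF a(1)] K_closed by (simp_all add: m_assoc)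
    moreover have "a mod k < k" using k_pos by simp
    ultimately show "h \<in> (\<lambda>(m, x). x \<otimes> y [^] m) ` ({..<k} \<times> K)" by (intro image_eqI[of _ _ "(a mod k, _)"]) auto
  next
    fix h assume "h \<in> (\<lambda>(m, x). x \<otimes> y [^] m) ` ({..<k} \<times> K)"
    then show "h \<in> H" using H_closed K_in_H yH by auto
  qed
qed

lemma chi_eq_chi_poly:
  assumes inv: "\<And>x h. x \<in> K \<Longrightarrow> h \<in> H \<Longrightarrow> a (x \<otimes> h) = a h"
  shows "chi j a = qeval (chi_poly a) (\<zeta> ^ j)"
proof -
  have "chi j a = (\<Sum>(m, x)\<in>{..<k} \<times> K. of_rat (a (x \<otimes> y [^] m)) * lin_char (x \<otimes> y [^] m) ^ j)"
    unfolding chi_def by (subst sum.reindex_bij_betw[OF y_cosets_bij, symmetric]) (simp add: case_prod_beta)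
  also have "\<dots> = (\<Sum>m<k. \<Sum>x\<in>K. of_rat (a (x \<otimes> y [^] m)) * lin_char (x \<otimes> y [^] m) ^ j)"
    by (simp add: sum.cartesian_product)
  also have "\<dots> = (\<Sum>m<k. of_rat (of_nat (card K) * a (y [^] m)) * (\<zeta> ^ j) ^ m)"
  proof (rule sum.cong[OF refl])
    fix m
    have "(\<Sum>x\<in>K. of_rat (a (x \<otimes> y [^] m)) * lin_char (x \<otimes> y [^] m) ^ j) = (\<Sum>x\<in>K. of_rat (a (y [^] m)) * (\<zeta> ^ m) ^ j)"
      using inv H_closed(3)[OF yH] by (intro sum.cong[OF refl]) (simp add: lin_char_pow)
    also have "\<dots> = of_rat (of_nat (card K) * a (y [^] m)) * (\<zeta> ^ j) ^ m"
      by (simp add: of_rat_mult power_mult[symmetric] mult.commute)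
    finally show "(\<Sum>x\<in>K. of_rat (a (x \<otimes> y [^] m)) * lin_char (x \<otimes> y [^] m) ^ j) = of_rat (of_nat (card K) * a (y [^] m)) * (\<zeta> ^ j) ^ m" .
  qed
  also have "\<dots> = qeval (chi_poly a) (\<zeta> ^ j)"
  proof -
    have "qeval (\<Sum>m\<in>I. Polynomial.monom (f m) m) z = (\<Sum>m\<in>I. of_rat (f m) * z ^ m)" if "finite I" for I f z
      using that by (induction I) simp_all
    then show ?thesis by (simp add: chi_poly_def)
  qed
  finally show ?thesis .
qed

text \<open>A polynomial of degree below \<open>k\<close> with the \<open>k\<close> roots \<open>1, \<zeta>, \<dots>, \<zeta>\<^sup>k\<^sup>-\<^sup>1\<close> vanishes, and its coefficients are
the values of the function up to a nonzero factor.\<close>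

lemma fourier_injective:
  assumes a: "a \<in> functions_on H" and inv: "\<And>x h. x \<in> K \<Longrightarrow> h \<in> H \<Longrightarrow> a (x \<otimes> h) = a h"
    and chi0: "\<And>j. j < k \<Longrightarrow> chi j a = 0"
  shows "a = 0"
proof -
  have "(map_poly of_rat (chi_poly a) :: complex poly) = 0"
  proof (rule poly_zero_on_roots_of_unity)
    have "degree (chi_poly a) \<le> k - 1"
      unfolding chi_poly_def using k_pos by (intro degree_sum_le) (auto intro!: order_trans[OF degree_monom_le])
    then show "degree (map_poly of_rat (chi_poly a) :: complex poly) < k"
      using k_pos by (simp add: degree_map_poly)
  next
    fix \<omega> :: complex assume w: "\<omega> ^ k = 1"
    have inj: "inj_on (\<lambda>j. \<zeta> ^ j) {..<k}"
    proof (rule inj_onI)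
      have diff: "a = b" if "a \<le> b" "b < k" "\<zeta> ^ a = \<zeta> ^ b" for a b
      proof -
        have "\<zeta> ^ b = \<zeta> ^ a * \<zeta> ^ (b - a)" using that(1) by (simp add: power_add[symmetric])
        then have "\<zeta> ^ (b - a) = 1" using that(3) \<zeta>_nonzero by simp
        then have "k dvd b - a" using \<zeta>_pow_eq_1_iff by simp
        then show ?thesis using that(1,2) by (metis diff_is_0_eq le_antisym less_imp_diff_less nat_dvd_not_less not_gr_zero)
      qed
      fix a b assume "a \<in> {..<k}" "b \<in> {..<k}" "\<zeta> ^ a = \<zeta> ^ b"
      then show "a = b" using diff[of a b] diff[of b a] by (metis lessThan_iff nat_le_linear)
    qed
    have "(\<lambda>j. \<zeta> ^ j) ` {..<k} = {\<omega>. \<omega> ^ k = 1}"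
    proof (rule card_subset_eq)
      show "finite {\<omega>::complex. \<omega> ^ k = 1}" using finite_roots_unity[of k] k_pos by simp
      show "(\<lambda>j. \<zeta> ^ j) ` {..<k} \<subseteq> {\<omega>. \<omega> ^ k = 1}"
        using \<zeta>_pow_eq_1_iff by (auto simp: power_mult[symmetric])
      show "card ((\<lambda>j. \<zeta> ^ j) ` {..<k}) = card {\<omega>::complex. \<omega> ^ k = 1}"
        using card_image[OF inj] card_roots_unity_eq[of k] k_pos by simp
    qed
    then obtain j where "j < k" "\<omega> = \<zeta> ^ j" using w by blast
    then show "qeval (chi_poly a) \<omega> = 0" using chi0[of j] chi_eq_chi_poly[OF inv] by simp
  qed
  then have z: "chi_poly a = 0" by (simp add: map_poly_eq_0_iff)
  have "a (y [^] m) = 0" if m: "m < k" for m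
  proof -
    have "coeff (chi_poly a) m = of_nat (card K) * a (y [^] m)"
      unfolding chi_poly_def coeff_sum using m by (simp add: sum.delta)
    moreover have "card K > 0" using fin_K subgroup.one_closed[OF sub_K] card_gt_0_iff by blast
    ultimately show ?thesis using z by simp
  qed
  then have "a h = 0" if "h \<in> H" for h
  proof -
    have "h \<in> (\<lambda>(m, x). x \<otimes> y [^] m) ` ({..<k} \<times> K)"
      using that bij_betw_imp_surj_on[OF y_cosets_bij] by simp
    then obtain p where "p \<in> {..<k} \<times> K" "h = (\<lambda>(m, x). x \<otimes> y [^] m) p" by (rule imageE)
    then have "fst p < k" "snd p \<in> K" "h = snd p \<otimes> y [^] fst p" by (auto simp: case_prod_beta)
    then show ?thesis using \<open>\<And>m. m < k \<Longrightarrow> a (y [^] m) = 0\<close> inv H_closed(3)[OF yH] by simp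
  qed
  then show ?thesis using functions_onD[OF a] by (auto simp: fun_eq_iff)
qed

end

section \<open>The idempotent and the field attached to a strong Shoda pair\<close>

text \<open>Invariance of dimension for an endomorphism of a finite-dimensional space of functions. It provides
inverses in \<open>\<rat>H\<epsilon>\<close> and the surjectivity of the representation of \<open>\<rat>N\<epsilon>\<close>.\<close>

lemma injective_linear_surjective:
  fixes L :: "('a \<Rightarrow> rat) \<Rightarrow> 'a \<Rightarrow> rat"
  assumes add: "\<And>a b. L (a + b) = L a + L b" and scale: "\<And>c a. L (c *\<^sub>Q a) = c *\<^sub>Q L a"
    and S: "finite S" "V \<subseteq> functions_on S" and V: "QV.subspace V"
    and LV: "\<And>v. v \<in> V \<Longrightarrow> L v \<in> V" and ker: "\<And>v. v \<in> V \<Longrightarrow> L v = 0 \<Longrightarrow> v = 0"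
    and w: "w \<in> V"
  shows "\<exists>v\<in>V. L v = w"
proof -
  have lin: "Vector_Spaces.linear qscale qscale L"
    by (unfold_locales) (simp_all add: add scale)
  interpret L: Vector_Spaces.linear qscale qscale L by (rule lin)
  have inj: "inj_on L V"
  proof (rule inj_onI)
    fix a b assume "a \<in> V" "b \<in> V" "L a = L b"
    then show "a = b" using ker[of "a - b"] QV.subspace_diff[OF V] L.diff[of a b] by simp
  qed
  obtain B where B: "B \<subseteq> V" "QV.independent B" "V \<subseteq> QV.span B"
    using QV.maximal_independent_subset by blast
  have span_B: "QV.span B = V" using B QV.span_minimal[OF B(1) V] by blast
  have "functions_on S \<subseteq> QV.span (basis_elt ` S)"
  proof
    fix a :: "'a \<Rightarrow> rat" assume a: "a \<in> functions_on S"
    show "a \<in> QV.span (basis_elt ` S)"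
      by (subst basis_expansion[OF S(1) a], rule QV.span_sum, rule QV.span_scale, rule QV.span_base) simp
  qed
  then have "B \<subseteq> QV.span (basis_elt ` S)" using B(1) S(2) by blast
  then have fin_B: "finite B" using QV.independent_span_bound[of "basis_elt ` S" B] S(1) B(2) by blast
  have ind: "QV.independent (L ` B)" using L.independent_injective_image[OF B(2)] inj span_B by simp
  have img: "L ` V = QV.span (L ` B)" using L.span_image[of B] span_B by simp
  have "w \<in> QV.span (L ` B)"
  proof (rule ccontr)
    assume nw: "w \<notin> QV.span (L ` B)"
    then have "QV.independent (insert w (L ` B))" using QV.independent_insertI ind by blast
    moreover have "insert w (L ` B) \<subseteq> QV.span B" using w B(1) LV span_B by blast
    ultimately have "card (insert w (L ` B)) \<le> card B" using QV.independent_span_bound[OF fin_B] by blast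
    moreover have "w \<notin> L ` B" using nw QV.span_base by blast
    moreover have "card (L ` B) = card B" using inj B(1) inj_on_subset card_image by blast
    ultimately show False using fin_B by simp
  qed
  then have "w \<in> L ` V" by (simp only: img)
  then obtain v where "v \<in> V" "w = L v" by (rule imageE)
  then show ?thesis by (intro bexI[of _ v]) simp_all
qed

context finite_group
begin

text \<open>The group algebra is not commutative, so the product defining \<open>\<epsilon>\<close> unfolds factor by factor only because
the factors commute with each other.\<close>

lemma finprod_commuting_insert:
  assumes A: "finite A" "x \<notin> A" and f: "\<And>i. i \<in> insert x A \<Longrightarrow> f i \<in> functions_on (carrier G)"
    and comm: "\<And>i j. i \<in> insert x A \<Longrightarrow> j \<in> insert x A \<Longrightarrow> f i \<star> f j = f j \<star> f i"
  shows "finprod (group_algebra G) f (insert x A) = f x \<star> finprod (group_algebra G) f A"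
proof -
  let ?D = "functions_on (carrier G)" and ?m = "(\<otimes>\<^bsub>group_algebra G\<^esub>) \<circ> f"
  have lc: "LCD (insert x A) ?D ?m"
  proof
    fix i j z assume "i \<in> insert x A" "j \<in> insert x A"
    then show "?m i (?m j z) = ?m j (?m i z)" using comm[of i j] by (simp add: conv_assoc[symmetric])
  next
    fix i z show "?m i z \<in> ?D" by (simp add: conv_closed)
  qed
  have "\<delta> \<one> \<in> ?D" by (simp add: functions_on_closed)
  then have "foldD ?D ?m (\<delta> \<one>) (insert x A) = ?m x (foldD ?D ?m (\<delta> \<one>) A)"
    using A by (intro LCD.foldD_insert[OF lc]) auto
  then show ?thesis using A
    by (simp add: finprod_def carrier_group_algebra one_group_algebra)
qed

lemma finprod_empty: "finprod (group_algebra G) f {} = \<delta> \<one>"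
  using foldD_empty[of "\<delta> \<one>" "functions_on (carrier G)"]
  by (simp add: finprod_def carrier_group_algebra one_group_algebra functions_on_closed)

lemma group_algebra_minus: "b \<in> functions_on (carrier G) \<Longrightarrow> a \<ominus>\<^bsub>group_algebra G\<^esub> b = a - b"
proof -
  assume b: "b \<in> functions_on (carrier G)"
  have "\<ominus>\<^bsub>group_algebra G\<^esub> b = - b"
    unfolding a_inv_def m_inv_def
  proof (rule the_equality)
    show "- b \<in> carrier (add_monoid (group_algebra G)) \<and> b \<otimes>\<^bsub>add_monoid (group_algebra G)\<^esub> - b = \<one>\<^bsub>add_monoid (group_algebra G)\<^esub> \<and>
       - b \<otimes>\<^bsub>add_monoid (group_algebra G)\<^esub> b = \<one>\<^bsub>add_monoid (group_algebra G)\<^esub>"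
      using b functions_on_closed(4)[OF b] by (simp add: carrier_group_algebra add_group_algebra zero_group_algebra)
  next
    fix c assume "c \<in> carrier (add_monoid (group_algebra G)) \<and> b \<otimes>\<^bsub>add_monoid (group_algebra G)\<^esub> c = \<one>\<^bsub>add_monoid (group_algebra G)\<^esub> \<and>
       c \<otimes>\<^bsub>add_monoid (group_algebra G)\<^esub> b = \<one>\<^bsub>add_monoid (group_algebra G)\<^esub>"
    then have "b + c = 0" by (simp add: add_group_algebra zero_group_algebra)
    then show "c = - b" by (rule minus_unique[symmetric])
  qed
  then show ?thesis by (simp add: a_minus_def add_group_algebra)
qed

end

context strong_shoda
begin

lemma lin_char_ne_0: "h \<in> H \<Longrightarrow> lin_char h \<noteq> 0"
  using \<zeta>_nonzero by (simp add: lin_char_def)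

lemma lin_char_eq_iff:
  assumes "g \<in> H" "h \<in> H" shows "lin_char g = lin_char h \<longleftrightarrow> g \<otimes> inv h \<in> K"
proof -
  have "g \<otimes> inv h \<otimes> h = g" using memG(2)[OF assms(1)] memG(2)[OF assms(2)] by (simp add: m_assoc)
  then have "lin_char g = lin_char (g \<otimes> inv h) * lin_char h"
    using lin_char_mult[OF H_closed(1)[OF assms(1) H_closed(2)[OF assms(2)]] assms(2)] by simp
  then show ?thesis
    using lin_char_eq_1_iff[OF H_closed(1)[OF assms(1) H_closed(2)[OF assms(2)]]] lin_char_ne_0[OF assms(2)] by auto
qed

lemma pow_conj:
  assumes "n \<in> carrier G" "h \<in> carrier G" shows "(n \<otimes> h \<otimes> inv n) [^] (m::nat) = n \<otimes> h [^] m \<otimes> inv n"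
proof (induction m)
  case (Suc m)
  have "n \<otimes> h [^] m \<otimes> inv n \<otimes> (n \<otimes> h \<otimes> inv n) = n \<otimes> h [^] m \<otimes> ((inv n \<otimes> n) \<otimes> h \<otimes> inv n)"
    using assms by (simp only: m_assoc m_closed inv_closed nat_pow_closed)
  also have "\<dots> = n \<otimes> (h [^] m \<otimes> h) \<otimes> inv n" using assms by (simp add: m_assoc)
  finally show ?case using Suc by simp
qed (use assms in simp)

lemma lin_char_nat_pow: "h \<in> H \<Longrightarrow> lin_char (h [^] (m::nat)) = lin_char h ^ m"
proof (induction m)
  case 0
  show ?case using lin_char_eq_1_iff[OF subgroup.one_closed[OF sub_H]] subgroup.one_closed[OF sub_K] by simp
next
  case (Suc m)
  then show ?case using lin_char_mult[OF H_closed(3)[OF Suc.prems, of m] Suc.prems] by simp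
qed

text \<open>\<open>N\<close> acts on the cyclic group \<open>H/K\<close> by automorphisms, which are power maps \<open>h \<mapsto> h\<^sup>r\<close>.\<close>

lemma lin_char_conj:
  assumes n: "n \<in> N" shows "\<exists>r. \<forall>h\<in>H. lin_char (n \<otimes> h \<otimes> inv n) = lin_char h ^ r"
proof -
  obtain r x where r: "x \<in> K" "n \<otimes> y \<otimes> inv n = x \<otimes> y [^] (r::nat)"
    using H_generated[OF H_normal[OF n yH]] by blast
  have yr: "lin_char (n \<otimes> y \<otimes> inv n) = \<zeta> ^ r" using lin_char_pow[OF r(1)] r(2) by simp
  have "lin_char (n \<otimes> h \<otimes> inv n) = lin_char h ^ r" if h: "h \<in> H" for h
  proof -
    obtain m z where m: "z \<in> K" "h = z \<otimes> y [^] (m::nat)" using H_generated[OF h] by blast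
    have G: "n \<in> carrier G" "z \<in> carrier G" "y \<in> carrier G" using memG n m(1) yH by blast+
    have "n \<otimes> h \<otimes> inv n = n \<otimes> z \<otimes> ((inv n \<otimes> n) \<otimes> y [^] m \<otimes> inv n)"
      using G unfolding m(2) by (simp add: m_assoc)
    also have "\<dots> = (n \<otimes> z \<otimes> inv n) \<otimes> (n \<otimes> y [^] m \<otimes> inv n)"
      using G by (simp only: m_assoc m_closed inv_closed nat_pow_closed)
    also have "n \<otimes> y [^] m \<otimes> inv n = (n \<otimes> y \<otimes> inv n) [^] m" using pow_conj G by simp
    finally have eq: "n \<otimes> h \<otimes> inv n = (n \<otimes> z \<otimes> inv n) \<otimes> (n \<otimes> y \<otimes> inv n) [^] m" .
    have H: "n \<otimes> z \<otimes> inv n \<in> H" "n \<otimes> y \<otimes> inv n \<in> H" using H_normal[OF n] yH K_in_H[OF m(1)] by simp_all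
    have "lin_char (n \<otimes> z \<otimes> inv n) = 1"
      using lin_char_eq_1_iff[OF H(1)] K_normal[OF n m(1)] by simp
    then have "lin_char (n \<otimes> h \<otimes> inv n) = (\<zeta> ^ r) ^ m"
      unfolding eq using lin_char_mult[OF H(1) H_closed(3)[OF H(2)]] lin_char_nat_pow[OF H(2)] yr by simp
    also have "\<dots> = lin_char h ^ r" using lin_char_pow[OF m(1), of m] by (simp add: m(2) power_mult[symmetric] mult.commute)
    finally show ?thesis .
  qed
  then show ?thesis by blast
qed

text \<open>Power maps preserve every subgroup of the cyclic group \<open>H/K\<close>.\<close>

lemma intermediate_normal:
  assumes M: "subgroup M G" "K \<subseteq> M" "M \<subseteq> H" and n: "n \<in> N" and m: "m \<in> M"
  shows "n \<otimes> m \<otimes> inv n \<in> M"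
proof -
  obtain r where r: "\<And>h. h \<in> H \<Longrightarrow> lin_char (n \<otimes> h \<otimes> inv n) = lin_char h ^ r" using lin_char_conj[OF n] by blast
  have mH: "m \<in> H" using m M(3) by blast
  have "lin_char (n \<otimes> m \<otimes> inv n) = lin_char (m [^] r)" using r[OF mH] lin_char_nat_pow[OF mH] by simp
  then have "n \<otimes> m \<otimes> inv n \<otimes> inv (m [^] r) \<in> M"
    using lin_char_eq_iff[OF H_normal[OF n mH] H_closed(3)[OF mH]] M(2) by blast
  then have "n \<otimes> m \<otimes> inv n \<otimes> inv (m [^] r) \<otimes> m [^] r \<in> M"
    using subgroup.m_closed[OF M(1)] subgroup_nat_pow_closed[OF M(1) m] by blast
  then show ?thesis using memG(1)[OF n] memG(2)[OF mH] by (simp add: m_assoc)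
qed

text \<open>The part of \<open>\<rat>H\<close> that commutes with \<open>N\<close>. It contains the averages of all subgroups between \<open>K\<close> and \<open>H\<close>,
hence \<open>\<epsilon>\<close>, and its elements commute with each other.\<close>

definition N_central :: "('a \<Rightarrow> rat) set" where
  "N_central = {a \<in> functions_on H. \<forall>n\<in>N. \<delta> n \<star> a = a \<star> \<delta> n}"

lemma H_le_G: "H \<subseteq> carrier G" and N_le_G: "N \<subseteq> carrier G"
  using subgroup.subset sub_H sub_N by blast+

lemma hat_N_central:
  assumes M: "subgroup M G" "K \<subseteq> M" "M \<subseteq> H" shows "hat M \<in> N_central"
proof -
  have "\<delta> n \<star> hat M = hat M \<star> \<delta> n" if n: "n \<in> N" for n
  proof -
    have "inv n \<otimes> s \<otimes> n \<in> M \<longleftrightarrow> s \<in> M" if s: "s \<in> carrier G" for s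
    proof
      assume "inv n \<otimes> s \<otimes> n \<in> M"
      then have "n \<otimes> (inv n \<otimes> s \<otimes> n) \<otimes> inv n \<in> M" by (rule intermediate_normal[OF M n])
      moreover have "n \<otimes> (inv n \<otimes> s \<otimes> n) \<otimes> inv n = s"
        using memG(1)[OF n] s by (simp add: m_assoc) (simp add: m_assoc[symmetric])
      ultimately show "s \<in> M" by simp
    next
      assume "s \<in> M"
      then show "inv n \<otimes> s \<otimes> n \<in> M"
        using intermediate_normal[OF M N_closed(2)[OF n]] memG(1)[OF n] by simp
    qed
    then have "conjugate n (hat M) = hat M"
      using memG(1)[OF n] subgroup.subset[OF M(1)] by (intro conjugate_hat)
    then show ?thesis using delta_conv_swap[OF memG(1)[OF n], of "hat M"] by simp
  qed
  then show ?thesis using functions_on_closed(8)[OF M(3)] by (simp add: N_central_def)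
qed

lemma N_central_closed:
  "\<delta> \<one> \<in> N_central" "a \<in> N_central \<Longrightarrow> b \<in> N_central \<Longrightarrow> a - b \<in> N_central" "a \<in> N_central \<Longrightarrow> b \<in> N_central \<Longrightarrow> a \<star> b \<in> N_central"
proof -
  show "\<delta> \<one> \<in> N_central" using memG(1) subgroup.one_closed[OF sub_H] by (simp add: N_central_def functions_on_closed delta_mult)
  show "a - b \<in> N_central" if "a \<in> N_central" "b \<in> N_central" using that by (simp add: N_central_def functions_on_closed conv_linear)
  show "a \<star> b \<in> N_central" if "a \<in> N_central" "b \<in> N_central"
  proof -
    have "\<delta> n \<star> (a \<star> b) = a \<star> b \<star> \<delta> n" if n: "n \<in> N" for n
    proof -
      have "\<delta> n \<star> (a \<star> b) = (a \<star> \<delta> n) \<star> b" using \<open>a \<in> N_central\<close> n by (simp add: N_central_def conv_assoc[symmetric])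
      also have "\<dots> = a \<star> (b \<star> \<delta> n)" using \<open>b \<in> N_central\<close> n by (simp add: N_central_def conv_assoc)
      finally show ?thesis by (simp add: conv_assoc)
    qed
    then show ?thesis using that functions_on_conv[OF sub_H] by (simp add: N_central_def)
  qed
qed

lemma N_central_commute: "a \<in> N_central \<Longrightarrow> b \<in> functions_on N \<Longrightarrow> b \<star> a = a \<star> b"
  using conv_commute_of_delta[OF N_le_G, of b a] by (simp add: N_central_def)

lemma N_central_on_N: "a \<in> N_central \<Longrightarrow> a \<in> functions_on N" and N_central_on_G: "a \<in> N_central \<Longrightarrow> a \<in> functions_on (carrier G)"
  and N_central_on_H: "a \<in> N_central \<Longrightarrow> a \<in> functions_on H"
  using functions_on_mono[OF _ H_le_N] functions_on_mono[OF _ H_le_G] by (simp_all add: N_central_def)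

abbreviation (input) minimal_above :: "'a set set" where "minimal_above \<equiv> minimal_normals_above G H K"

lemma minimal_above_facts:
  assumes "M \<in> minimal_above" shows "subgroup M G" "M \<subseteq> H" "K \<subset> M"
proof -
  have n: "M \<lhd> G\<lparr>carrier := H\<rparr>" and K: "K \<subset> M" using assms by (auto simp: minimal_normals_above_def)
  have "subgroup M (G\<lparr>carrier := H\<rparr>)" using n by (rule normal_imp_subgroup)
  then show "subgroup M G" "M \<subseteq> H" using incl_subgroup[OF sub_H] subgroup.subset by fastforce+
  show "K \<subset> M" by (rule K)
qed

lemma minimal_above_exists:
  assumes L: "subgroup L G" "K \<subset> L" "L \<subseteq> H" shows "\<exists>M\<in>minimal_above. M \<subseteq> L"
proof -
  let ?H = "G\<lparr>carrier := H\<rparr>"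
  interpret Hg: group ?H using subgroup_imp_group[OF sub_H] .
  let ?P = "\<lambda>M. M \<lhd> ?H \<and> K \<subset> M \<and> M \<subseteq> L"
  have "subgroup L ?H" using subgroup_incl[OF L(1) sub_H L(3)] .
  moreover have "x \<otimes>\<^bsub>?H\<^esub> h \<otimes>\<^bsub>?H\<^esub> inv\<^bsub>?H\<^esub> x \<in> L" if "x \<in> carrier ?H" "h \<in> L" for x h
    using that intermediate_normal[OF L(1) _ L(3) H_in_N, of x h] L(2) m_inv_consistent[OF sub_H, of x] by auto
  ultimately have "L \<lhd> ?H" by (rule Hg.normal_invI)
  then have "?P L" using L by blast
  then obtain M where M: "?P M" "\<And>M'. ?P M' \<Longrightarrow> card M \<le> card M'"
    using ex_has_least_nat[of ?P L card] by blast
  have "L' = M" if "L' \<lhd> ?H \<and> K \<subset> L' \<and> L' \<subseteq> M" for L'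
  proof -
    have "M \<subseteq> H" using M(1) L(3) by (meson order_trans)
    then have "finite M" using fin_H by (rule finite_subset)
    moreover have "L' \<subseteq> M" using that by simp
    moreover have "card M \<le> card L'" by (rule M(2)) (use that M(1) in auto)
    ultimately show ?thesis by (rule card_seteq)
  qed
  then have "M \<in> minimal_above" using M(1) by (simp add: minimal_normals_above_def)
  then show ?thesis using M(1) by blast
qed

text \<open>All properties of \<open>\<epsilon>\<close> are inherited by partial products, which makes induction over the set of factors
possible. Each factor \<open>K\<close>-average minus \<open>M\<close>-average is an idempotent killed by the average of \<open>M\<close>,
and the faithful character takes the value \<open>1 - 0\<close> on it.\<close>

lemma eps_product:
  assumes "A \<subseteq> minimal_above"
  defines "f \<equiv> \<lambda>M. hat K \<ominus>\<^bsub>group_algebra G\<^esub> hat M"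
  defines "p \<equiv> finprod (group_algebra G) f A"
  shows "p \<in> N_central \<and> p \<star> p = p \<and> chi 1 p = 1 \<and> (\<forall>M\<in>A. hat M \<star> p = 0) \<and> (A \<noteq> {} \<longrightarrow> hat K \<star> p = p)"
proof -
  have "finite minimal_above" using minimal_above_facts(2) fin_H by (intro finite_subset[of minimal_above "Pow H"]) auto
  then have "finite A" using assms(1) finite_subset by blast
  then show ?thesis using assms(1) unfolding p_def
  proof (induction A)
    case empty
    have one: "\<one> \<in> H" using subgroup.one_closed[OF sub_H] .
    have "chi 1 (\<delta> \<one>) = (\<Sum>h\<in>H. if h = \<one> then lin_char \<one> else 0)"
      unfolding chi_def by (intro sum.cong) (auto simp: basis_elt_def)
    also have "\<dots> = 1" using fin_H one lin_char_eq_1_iff[OF one] subgroup.one_closed[OF sub_K] by simp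
    finally show ?case using N_central_closed(1) by (simp add: finprod_empty delta_mult)
  next
    case (insert M A)
    have f: "f L = hat K - hat L" if "L \<in> minimal_above" for L
      using that minimal_above_facts(2)[OF that] H_le_G unfolding f_def
      by (intro group_algebra_minus functions_on_closed(8)) blast
    have f_central: "f L \<in> N_central" if "L \<in> minimal_above" for L
      unfolding f[OF that] using minimal_above_facts[OF that]
      by (intro N_central_closed(2) hat_N_central[OF sub_K order_refl K_le_H] hat_N_central) auto
    let ?q = "finprod (group_algebra G) f A"
    have q: "?q \<in> N_central" "?q \<star> ?q = ?q" "chi 1 ?q = 1" "\<And>L. L \<in> A \<Longrightarrow> hat L \<star> ?q = 0" using insert by auto
    have M: "M \<in> minimal_above" using insert by blast
    note Mf = minimal_above_facts[OF M]
    have Mh: "hat M \<in> N_central" using hat_N_central Mf by blast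
    have Kh: "hat K \<in> N_central" using hat_N_central[OF sub_K order_refl K_le_H] .
    have eq: "finprod (group_algebra G) f (insert M A) = f M \<star> ?q"
    proof (rule finprod_commuting_insert)
      show "f i \<in> functions_on (carrier G)" if "i \<in> insert M A" for i using that insert.prems f_central N_central_on_G by blast
      show "f i \<star> f j = f j \<star> f i" if "i \<in> insert M A" "j \<in> insert M A" for i j
      proof -
        have "f i \<in> N_central" "f j \<in> N_central" using that insert.prems by (auto intro: f_central)
        then show ?thesis using N_central_commute[OF _ N_central_on_N] by blast
      qed
    qed (use insert in auto)
    have KK: "hat K \<star> hat K = hat K" and KM: "hat K \<star> hat M = hat M" "hat M \<star> hat K = hat M" and MM_idem: "hat M \<star> hat M = hat M"
      using hat_mult_hat sub_K Mf by auto
    have ff: "f M \<star> f M = f M" and Kf: "hat K \<star> f M = f M" and Mf0: "hat M \<star> f M = 0"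
      by (simp_all add: f[OF M] conv_linear KK KM MM_idem)
    have "chi 1 (hat M) = 0"
    proof -
      obtain m where "m \<in> M" "m \<notin> K" using Mf(3) by blast
      then show ?thesis using chi_hat(2)[OF Mf(1,2), of m 1] lin_char_eq_1_iff[of m] Mf(2) by auto
    qed
    moreover have "chi 1 (hat K) = 1" using lin_char_eq_1_iff[OF K_in_H] by (intro chi_hat(1)[OF sub_K K_le_H]) simp
    ultimately have chi_f: "chi 1 (f M) = 1" by (simp add: f[OF M] chi_diff)
    have "f M \<star> ?q \<in> N_central" using N_central_closed(3) f_central[OF M] q(1) by blast
    moreover have "f M \<star> ?q \<star> (f M \<star> ?q) = f M \<star> ?q"
    proof -
      have "f M \<star> ?q \<star> (f M \<star> ?q) = f M \<star> (?q \<star> f M) \<star> ?q" by (simp add: conv_assoc)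
      also have "\<dots> = f M \<star> f M \<star> (?q \<star> ?q)" unfolding N_central_commute[OF f_central[OF M] N_central_on_N[OF q(1)]] by (simp add: conv_assoc)
      finally show ?thesis by (simp add: ff q)
    qed
    moreover have "chi 1 (f M \<star> ?q) = 1" using chi_mult[OF N_central_on_H[OF f_central[OF M]] N_central_on_H[OF q(1)]] chi_f q(3) by simp
    moreover have "hat L \<star> (f M \<star> ?q) = 0" if "L \<in> insert M A" for L
    proof (cases "L = M")
      case True
      then show ?thesis using Mf0 by (simp add: conv_assoc[symmetric])
    next
      case False
      then have L: "L \<in> A" using that by blast
      then have LM: "L \<in> minimal_above" using insert.prems by auto
      have "hat L \<in> N_central" by (rule hat_N_central[OF minimal_above_facts(1)[OF LM] _ minimal_above_facts(2)[OF LM]]) (use minimal_above_facts(3)[OF LM] in auto)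
      then have "hat L \<star> (f M \<star> ?q) = f M \<star> (hat L \<star> ?q)"
        using N_central_commute[OF f_central[OF M], of "hat L"] N_central_on_N by (simp add: conv_assoc[symmetric])
      then show ?thesis using q(4)[OF L] by simp
    qed
    moreover have "hat K \<star> (f M \<star> ?q) = f M \<star> ?q" using Kf by (simp add: conv_assoc[symmetric])
    ultimately show ?case unfolding eq by blast
  qed
qed

lemma eps_facts:
  shows eps_N_central: "\<epsilon> \<in> N_central" and eps_idem: "\<epsilon> \<star> \<epsilon> = \<epsilon>" and chi_eps: "chi 1 \<epsilon> = 1"
    and hat_K_eps: "hat K \<star> \<epsilon> = \<epsilon>" and hat_M_eps: "M \<in> minimal_above \<Longrightarrow> hat M \<star> \<epsilon> = 0"
proof -
  have "\<epsilon> \<in> N_central \<and> \<epsilon> \<star> \<epsilon> = \<epsilon> \<and> chi 1 \<epsilon> = 1 \<and> hat K \<star> \<epsilon> = \<epsilon> \<and> (\<forall>M\<in>minimal_above. hat M \<star> \<epsilon> = 0)"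
  proof (cases "H = K")
    case True
    have "chi 1 (hat K) = 1" using lin_char_eq_1_iff[OF K_in_H] by (intro chi_hat(1)[OF sub_K K_le_H]) simp
    moreover have "minimal_above = {}" using minimal_above_facts True by blast
    ultimately show ?thesis using True hat_N_central[OF sub_K order_refl K_le_H] hat_mult_hat[OF sub_K sub_K]
      by (simp add: eps_def)
  next
    case False
    then have "minimal_above \<noteq> {}" using minimal_above_exists[OF sub_H _ order_refl] K_le_H by blast
    then show ?thesis using eps_product[OF order_refl] False by (simp add: eps_def)
  qed
  then show "\<epsilon> \<in> N_central" "\<epsilon> \<star> \<epsilon> = \<epsilon>" "chi 1 \<epsilon> = 1" "hat K \<star> \<epsilon> = \<epsilon>" "M \<in> minimal_above \<Longrightarrow> hat M \<star> \<epsilon> = 0" by blast+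
qed

text \<open>The \<open>j\<close>-th power of the character is trivial on a subgroup properly containing \<open>K\<close>, hence on one of the
minimal subgroups \<open>M\<close>. It takes the value \<open>1\<close> on the average of \<open>M\<close>, and this average kills \<open>\<epsilon>\<close>.\<close>

lemma chi_eps_noncoprime:
  assumes "\<not> coprime j k" shows "chi j \<epsilon> = 0"
proof -
  define d where "d = gcd j k"
  have "d \<noteq> 1" using assms unfolding d_def coprime_iff_gcd_eq_1 .
  moreover have "d \<noteq> 0" using k_pos by (simp add: d_def)
  ultimately have d1: "d > 1" by linarith
  have d: "d > 1" "d dvd j" "d dvd k" using d1 by (simp_all add: d_def)
  define L where "L = {h \<in> H. lin_char h ^ j = 1}"
  have L1: "subgroup L G"
  proof (rule subgroup.intro)
    show "L \<subseteq> carrier G" using H_le_G by (auto simp: L_def)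
    show "\<one> \<in> L" using lin_char_nat_pow[OF yH, of 0] subgroup.one_closed[OF sub_H] by (simp add: L_def)
    show "a \<otimes> b \<in> L" if "a \<in> L" "b \<in> L" for a b
      using that H_closed by (simp add: L_def lin_char_mult power_mult_distrib)
    show "inv a \<in> L" if a: "a \<in> L" for a
    proof -
      have aH: "a \<in> H" "inv a \<in> H" using a H_closed by (auto simp: L_def)
      have "lin_char (a \<otimes> inv a) = 1"
        using lin_char_nat_pow[OF yH, of 0] memG(2)[OF aH(1)] by simp
      then have "(lin_char a * lin_char (inv a)) ^ j = 1" using lin_char_mult[OF aH] by simp
      then show ?thesis using a aH by (simp add: L_def power_mult_distrib)
    qed
  qed
  have "K \<subseteq> L"
  proof
    fix x assume x: "x \<in> K"
    then have "lin_char x = 1" using lin_char_eq_1_iff[OF K_in_H] by blast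
    then show "x \<in> L" using K_in_H[OF x] by (simp add: L_def)
  qed
  moreover have "y [^] (k div d) \<in> L - K"
  proof -
    obtain i where i: "j = d * i" using d(2) by blast
    have "lin_char (y [^] (k div d)) = \<zeta> ^ (k div d)"
      using lin_char_pow[OF subgroup.one_closed[OF sub_K], of "k div d"] memG(2)[OF yH] by simp
    then have "lin_char (y [^] (k div d)) ^ j = \<zeta> ^ ((k div d) * d * i)" by (simp add: power_mult[symmetric] i mult.assoc)
    also have "\<dots> = 1" using d(3) \<zeta>_pow_eq_1_iff by simp
    finally have "y [^] (k div d) \<in> L" using H_closed(3)[OF yH] by (simp add: L_def)
    moreover have "k div d > 0" "k div d < k"
      using dvd_imp_le[OF d(3) k_pos] d1 k_pos by (simp_all add: div_greater_zero_iff)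
    then have "\<not> k dvd k div d" by (intro nat_dvd_not_less)
    ultimately show ?thesis using y_pow_mem_K_iff by simp
  qed
  ultimately have L2: "K \<subset> L" by blast
  obtain M where M: "M \<in> minimal_above" "M \<subseteq> L" using minimal_above_exists[OF L1 L2] by (auto simp: L_def)
  have "chi j (hat M) = 1" using minimal_above_facts[OF M(1)] M(2) by (intro chi_hat(1)) (auto simp: L_def)
  moreover have "chi j (hat M \<star> \<epsilon>) = chi j (hat M) * chi j \<epsilon>"
    using minimal_above_facts[OF M(1)] N_central_on_H[OF eps_N_central] by (intro chi_mult functions_on_closed(8))
  ultimately show ?thesis using hat_M_eps[OF M(1)] by (simp add: chi_def)
qed

text \<open>The field \<open>\<rat>H\<epsilon>\<close>.\<close>

definition E :: "('a \<Rightarrow> rat) set" where "E = {a \<in> functions_on H. a \<star> \<epsilon> = a}"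
text \<open>The crossed product \<open>\<rat>N\<epsilon>\<close>.\<close>

definition A :: "('a \<Rightarrow> rat) set" where "A = {a \<in> functions_on N. a \<star> \<epsilon> = a}"

lemma E_subset_A: "a \<in> E \<Longrightarrow> a \<in> A"
  using functions_on_mono[OF _ H_le_N] by (simp add: E_def A_def)
lemma A_on_G: "a \<in> A \<Longrightarrow> a \<in> functions_on (carrier G)"
  using functions_on_mono[OF _ N_le_G] by (simp add: A_def)

lemma A_closed: "0 \<in> A" "a \<in> A \<Longrightarrow> b \<in> A \<Longrightarrow> a + b \<in> A" "a \<in> A \<Longrightarrow> b \<in> A \<Longrightarrow> a - b \<in> A"
  "a \<in> A \<Longrightarrow> c *\<^sub>Q a \<in> A" "a \<in> A \<Longrightarrow> b \<in> A \<Longrightarrow> a \<star> b \<in> A" "\<epsilon> \<in> A" "(\<And>i. i \<in> I \<Longrightarrow> f i \<in> A) \<Longrightarrow> (\<Sum>i\<in>I. f i) \<in> A"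
  using functions_on_conv[OF sub_N] N_central_on_N[OF eps_N_central] eps_idem
  by (auto simp: A_def functions_on_closed conv_linear conv_assoc)
lemma E_closed: "0 \<in> E" "a \<in> E \<Longrightarrow> b \<in> E \<Longrightarrow> a + b \<in> E" "a \<in> E \<Longrightarrow> b \<in> E \<Longrightarrow> a - b \<in> E"
  "a \<in> E \<Longrightarrow> c *\<^sub>Q a \<in> E" "a \<in> E \<Longrightarrow> b \<in> E \<Longrightarrow> a \<star> b \<in> E" "\<epsilon> \<in> E" "(\<And>i. i \<in> I \<Longrightarrow> f i \<in> E) \<Longrightarrow> (\<Sum>i\<in>I. f i) \<in> E"
  "a \<in> E \<Longrightarrow> - a \<in> E"
  using functions_on_conv[OF sub_H] N_central_on_H[OF eps_N_central] eps_idem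
  by (auto simp: E_def functions_on_closed conv_linear conv_assoc)

lemma A_eps: "a \<in> A \<Longrightarrow> a \<star> \<epsilon> = a" "a \<in> A \<Longrightarrow> \<epsilon> \<star> a = a"
  using N_central_commute[OF eps_N_central, of a] by (auto simp: A_def)
lemma E_eps: "a \<in> E \<Longrightarrow> a \<star> \<epsilon> = a" "a \<in> E \<Longrightarrow> \<epsilon> \<star> a = a"
  using A_eps E_subset_A by blast+

lemma alg_component_carrier:
  assumes S: "subgroup S G" and c: "c \<star> c = c" "\<And>a. a \<in> functions_on S \<Longrightarrow> a \<star> c \<in> functions_on S"
  shows "carrier (alg_component G S c) = {a \<in> functions_on S. a \<star> c = a}"
proof -
  have "{a \<in> carrier (group_algebra G). \<forall>g. g \<notin> S \<longrightarrow> a g = 0} = functions_on S"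
    using functions_on_mono[OF _ subgroup.subset[OF S]] unfolding carrier_group_algebra by (auto simp: functions_on_def)
  then have "carrier (alg_component G S c) = (\<lambda>a. a \<star> c) ` functions_on S"
    by (simp add: alg_component_def)
  also have "\<dots> = {a \<in> functions_on S. a \<star> c = a}"
    using c by (auto simp: conv_assoc image_iff) metis
  finally show ?thesis .
qed

lemma QHe_carrier: "carrier (QHe G H K) = E"
  unfolding E_def using functions_on_conv[OF sub_H _ N_central_on_H[OF eps_N_central]] by (intro alg_component_carrier[OF sub_H eps_idem])
lemma QNe_carrier: "carrier (QNe G H K) = A"
  unfolding A_def using functions_on_conv[OF sub_N _ N_central_on_N[OF eps_N_central]] by (intro alg_component_carrier[OF sub_N eps_idem])

lemma delta_K_eps: "x \<in> K \<Longrightarrow> \<delta> x \<star> \<epsilon> = \<epsilon>"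
  by (metis hat_K_eps conv_assoc delta_conv_hat(1)[OF sub_K])

lemma delta_K_A: "x \<in> K \<Longrightarrow> a \<in> A \<Longrightarrow> \<delta> x \<star> a = a"
  by (metis A_eps(2) conv_assoc delta_K_eps)

lemma A_K_invariant:
  assumes "a \<in> A" "x \<in> K" "h \<in> carrier G" shows "a (x \<otimes> h) = a h"
proof -
  have "(\<delta> (inv x) \<star> a) h = a (inv (inv x) \<otimes> h)" using assms memG(3) by (intro delta_conv_apply) auto
  then show ?thesis using delta_K_A[OF K_closed(2)[OF assms(2)] assms(1)] memG(3)[OF assms(2)] by simp
qed

text \<open>The faithful character identifies \<open>\<rat>H\<epsilon>\<close> with a subfield of \<open>\<complex>\<close>. If it vanishes on \<open>a\<close>, then so does every
power of it: coprime powers are Galois conjugate, the others vanish on \<open>\<epsilon>\<close>.\<close>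

lemma E_chi_injective:
  assumes a: "a \<in> E" and z: "chi 1 a = 0" shows "a = 0"
proof (rule fourier_injective)
  show "a \<in> functions_on H" using a by (simp add: E_def)
  show inv: "a (x \<otimes> h) = a h" if "x \<in> K" "h \<in> H" for x h
    using A_K_invariant[OF E_subset_A[OF a] that(1)] memG(2)[OF that(2)] by simp
  fix j assume j: "j < k"
  show "chi j a = 0"
  proof (cases "coprime j k")
    case True
    have P: "qeval (chi_poly a) \<zeta> = 0" using chi_eq_chi_poly[OF inv, of 1] z by simp
    have zk: "\<zeta> ^ k = 1" using \<zeta>_pow_eq_1_iff by simp
    show ?thesis
    proof (cases "j = 0")
      case True
      then have "k = 1" using \<open>coprime j k\<close> by simp
      then have "\<zeta> ^ j = \<zeta>" using zk True by simp
      then show ?thesis using chi_eq_chi_poly[OF inv, of j] P by simp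
    next
      case False
      then show ?thesis using rational_relation_conjugates[OF k_pos zk P True] chi_eq_chi_poly[OF inv, of j] by simp
    qed
  next
    case False
    have "chi j a = chi j (a \<star> \<epsilon>)" using E_eps(1)[OF a] by simp
    also have "\<dots> = chi j a * chi j \<epsilon>" using a N_central_on_H[OF eps_N_central] by (intro chi_mult) (simp add: E_def)
    finally show ?thesis using chi_eps_noncoprime[OF False] by simp
  qed
qed

lemma eps_nonzero: "\<epsilon> \<noteq> 0" using chi_eps by (auto simp: chi_def)

lemma E_domain:
  assumes "a \<in> E" "b \<in> E" "a \<star> b = 0" shows "a = 0 \<or> b = 0"
proof -
  have "chi 1 a * chi 1 b = chi 1 (a \<star> b)" using assms by (intro chi_mult[symmetric]) (auto simp: E_def)
  then have "chi 1 a = 0 \<or> chi 1 b = 0" using assms(3) by (simp add: chi_def)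
  then show ?thesis using E_chi_injective assms by blast
qed

lemma E_subspace: "QV.subspace E" and A_subspace: "QV.subspace A"
  using E_closed A_closed by (simp_all add: QV.subspace_def)

text \<open>Multiplication by a nonzero element of a finite-dimensional domain is injective, hence surjective.\<close>

lemma E_inverse:
  assumes a: "a \<in> E" "a \<noteq> 0" shows "\<exists>b\<in>E. a \<star> b = \<epsilon>"
proof (rule injective_linear_surjective[where S = H])
  show "a \<star> v \<in> E" if "v \<in> E" for v using E_closed(5)[OF a(1) that] .
  show "v = 0" if "v \<in> E" "a \<star> v = 0" for v using E_domain[OF a(1) that] a(2) by blast
qed (use fin_H E_subspace E_closed in \<open>auto simp: conv_linear E_def\<close>)

text \<open>Conjugation by \<open>h\<close> moves an element of \<open>H\<close> within its coset of \<open>K\<close>, since \<open>H/K\<close> is abelian, and the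
elements of \<open>\<rat>H\<epsilon>\<close> are constant on these cosets.\<close>

lemma E_conj_H:
  assumes a: "a \<in> E" and h: "h \<in> H" shows "\<delta> h \<star> a = a \<star> \<delta> h"
proof -
  have aG: "a \<in> functions_on (carrier G)" using A_on_G[OF E_subset_A[OF a]] .
  have "conjugate h a = a"
  proof (rule conv_ext[OF _ conjugate_closed aG])
    fix g assume g: "g \<in> carrier G"
    show "conjugate h a g = a g"
    proof (cases "g \<in> H")
      case True
      have H: "inv h \<otimes> g \<otimes> h \<in> H" using True h H_closed by simp
      have "lin_char (inv h \<otimes> g \<otimes> h) = lin_char (inv h \<otimes> h) * lin_char g"
        using True h H_closed by (simp add: lin_char_mult)
      also have "\<dots> = lin_char g" using memG(2)[OF h] lin_char_nat_pow[OF yH, of 0] by simp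
      finally have "inv h \<otimes> g \<otimes> h \<otimes> inv g \<in> K" using lin_char_eq_iff[OF H True] by simp
      then have "a ((inv h \<otimes> g \<otimes> h \<otimes> inv g) \<otimes> g) = a g" using A_K_invariant[OF E_subset_A[OF a]] g by blast
      then show ?thesis using g memG(2)[OF h] by (simp add: conjugate_apply m_assoc)
    next
      case False
      then show ?thesis using a H_normal_iff'[OF H_in_N[OF h] g] memG(2)[OF h] g
        by (simp add: conjugate_apply E_def functions_on_def)
    qed
  qed
  then show ?thesis using conjugate_eq_self_iff[OF memG(2)[OF h] aG] by simp
qed

lemma conj_H_E: "h \<in> H \<Longrightarrow> v \<in> E \<Longrightarrow> conjugate h v = v"
  using E_conj_H[of v h] conjugate_eq_self_iff[OF memG(2) A_on_G[OF E_subset_A]] by blast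

lemma E_commute: "a \<in> E \<Longrightarrow> b \<in> E \<Longrightarrow> a \<star> b = b \<star> a"
  using conv_commute_of_delta[OF H_le_G, of a b] E_conj_H by (simp add: E_def)

lemma eps_delta_N: "n \<in> N \<Longrightarrow> \<delta> n \<star> \<epsilon> = \<epsilon> \<star> \<delta> n"
  using eps_N_central by (simp add: N_central_def)

lemma conj_eps: "n \<in> N \<Longrightarrow> conjugate n \<epsilon> = \<epsilon>"
  using conjugate_eq_self_iff[OF memG(1)] N_central_on_G[OF eps_N_central] eps_delta_N by simp

lemma E_conj_N:
  assumes a: "a \<in> E" and n: "n \<in> N" shows "conjugate n a \<in> E"
proof -
  have "conjugate n a \<in> functions_on H"
    unfolding functions_on_def mem_Collect_eq
  proof (intro allI impI)
    fix g assume g: "g \<notin> H"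
    show "conjugate n a g = 0"
    proof (cases "g \<in> carrier G")
      case True
      then show ?thesis using g a H_normal_iff'[OF n True] memG(1)[OF n]
        by (simp add: conjugate_apply E_def functions_on_def)
    qed (use functions_onD[OF conjugate_closed] in blast)
  qed
  moreover have "conjugate n a \<star> \<epsilon> = conjugate n a"
    using conjugate_mult[OF memG(1)[OF n], of a \<epsilon>] conj_eps[OF n] E_eps(1)[OF a] by simp
  ultimately show ?thesis by (simp add: E_def)
qed

end

section \<open>The crossed product and its faithful representation\<close>

lemma (in group) generate_commute:
  assumes S: "S \<subseteq> carrier G" and comm: "\<And>a b. a \<in> S \<Longrightarrow> b \<in> S \<Longrightarrow> a \<otimes> b = b \<otimes> a"
    and ab: "a \<in> generate G S" "b \<in> generate G S"
  shows "a \<otimes> b = b \<otimes> a"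
proof -
  have step: "a \<otimes> b = b \<otimes> a"
    if a: "a \<in> carrier G" and c: "\<And>s. s \<in> S \<Longrightarrow> a \<otimes> s = s \<otimes> a" and b: "b \<in> generate G S" for a b
    using b
  proof (induction b rule: generate.induct)
    case one
    show ?case using a by simp
  next
    case (incl s)
    then show ?case by (rule c)
  next
    case (inv s)
    then have s: "s \<in> carrier G" using S by blast
    have "inv s \<otimes> (s \<otimes> a) \<otimes> inv s = inv s \<otimes> (a \<otimes> s) \<otimes> inv s" using c[OF inv] by simp
    moreover have "inv s \<otimes> (s \<otimes> a) \<otimes> inv s = a \<otimes> inv s" using a s by (simp add: m_assoc[symmetric])
    moreover have "inv s \<otimes> (a \<otimes> s) \<otimes> inv s = inv s \<otimes> a" using a s by (simp add: m_assoc)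
    ultimately show ?case by simp
  next
    case (eng h1 h2)
    have h: "h1 \<in> carrier G" "h2 \<in> carrier G" using eng generate_in_carrier[OF S] by auto
    have "a \<otimes> (h1 \<otimes> h2) = (a \<otimes> h1) \<otimes> h2" using a h by (simp add: m_assoc)
    also have "\<dots> = h1 \<otimes> (a \<otimes> h2)" unfolding eng(3) using a h by (simp add: m_assoc)
    also have "\<dots> = (h1 \<otimes> h2) \<otimes> a" unfolding eng(4) using a h by (simp add: m_assoc)
    finally show ?case .
  qed
  have "a \<otimes> s = s \<otimes> a" if s: "s \<in> S" for s
  proof -
    have "s \<otimes> a = a \<otimes> s" using s S by (intro step[OF _ _ ab(1)] comm) auto
    then show ?thesis by simp
  qed
  then show ?thesis using step[OF generate_in_carrier[OF S ab(1)] _ ab(2)] by blast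
qed

context strong_shoda
begin

lemma delta_eps_A: "n \<in> N \<Longrightarrow> \<delta> n \<star> \<epsilon> \<in> A"
  using functions_on_conv[OF sub_N functions_on_closed(7) N_central_on_N[OF eps_N_central]] by (simp add: A_def conv_assoc eps_idem)

lemma delta_eps_E: "h \<in> H \<Longrightarrow> \<delta> h \<star> \<epsilon> \<in> E"
  using functions_on_conv[OF sub_H functions_on_closed(7) N_central_on_H[OF eps_N_central]] by (simp add: E_def conv_assoc eps_idem)

lemma chi_delta_eps: "h \<in> H \<Longrightarrow> chi 1 (\<delta> h \<star> \<epsilon>) = lin_char h"
proof -
  assume h: "h \<in> H"
  have "chi 1 (\<delta> h) = (\<Sum>g\<in>H. if g = h then lin_char h else 0)"
    unfolding chi_def by (intro sum.cong) (auto simp: basis_elt_def)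
  also have "\<dots> = lin_char h" using h fin_H by simp
  finally show ?thesis
    using chi_mult[OF functions_on_closed(7)[OF h] N_central_on_H[OF eps_N_central]] chi_eps by simp
qed

lemma delta_eps_eq_iff:
  assumes "g \<in> H" "h \<in> H" shows "\<delta> g \<star> \<epsilon> = \<delta> h \<star> \<epsilon> \<longleftrightarrow> lin_char g = lin_char h"
proof
  assume "\<delta> g \<star> \<epsilon> = \<delta> h \<star> \<epsilon>"
  then show "lin_char g = lin_char h" using chi_delta_eps assms by metis
next
  assume "lin_char g = lin_char h"
  then have K: "g \<otimes> inv h \<in> K" using lin_char_eq_iff assms by blast
  have "\<delta> g \<star> \<epsilon> = \<delta> (g \<otimes> inv h) \<star> (\<delta> h \<star> \<epsilon>)"
    using memG(2)[OF assms(1)] memG(2)[OF assms(2)] by (simp add: delta_mult_assoc m_assoc)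
  also have "\<dots> = \<delta> h \<star> \<epsilon>" using delta_K_A[OF K delta_eps_A[OF H_in_N[OF assms(2)]]] .
  finally show "\<delta> g \<star> \<epsilon> = \<delta> h \<star> \<epsilon>" .
qed

text \<open>The left stabilizer of \<open>\<epsilon>\<close> lies in \<open>H\<close> because \<open>\<epsilon>\<close> is supported there, and then the faithful character
detects it.\<close>

lemma delta_eps_eq_eps:
  assumes g: "g \<in> carrier G" and eq: "\<delta> g \<star> \<epsilon> = \<epsilon>" shows "g \<in> K"
proof -
  obtain h where h: "\<epsilon> h \<noteq> 0" using eps_nonzero by (auto simp: fun_eq_iff)
  then have hH: "h \<in> H" using functions_onD[OF N_central_on_H[OF eps_N_central]] by blast
  have "\<epsilon> (inv g \<otimes> h) \<noteq> 0" using h eq delta_conv_apply[OF g memG(2)[OF hH], of \<epsilon>] by simp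
  then have "inv g \<otimes> h \<in> H" using functions_onD[OF N_central_on_H[OF eps_N_central]] by blast
  then have "inv g \<in> H" using subgroup_mult_mem_iff(2)[OF sub_H hH inv_closed[OF g]] by simp
  then have gH: "g \<in> H" using H_closed(2)[of "inv g"] g by simp
  have "lin_char g = 1" using chi_delta_eps[OF gH] eq chi_eps by simp
  then show ?thesis using lin_char_eq_1_iff[OF gH] by simp
qed

text \<open>\<open>K\<close> is the left stabilizer of \<open>\<epsilon>\<close>, so an element that fixes \<open>\<epsilon>\<close> under conjugation normalizes \<open>K\<close>.\<close>

lemma centralizer_eps:
  assumes g: "g \<in> carrier G" and eq: "conjugate g \<epsilon> = \<epsilon>" shows "g \<in> N"
proof -
  have K1: "g \<otimes> x \<otimes> inv g \<in> K" if x: "x \<in> K" for x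
  proof (rule delta_eps_eq_eps)
    have "conjugate g (\<delta> x \<star> \<epsilon>) = \<delta> (g \<otimes> x \<otimes> inv g) \<star> \<epsilon>"
      using conjugate_mult[OF g] conjugate_delta[OF g memG(3)[OF x]] eq by simp
    then show "\<delta> (g \<otimes> x \<otimes> inv g) \<star> \<epsilon> = \<epsilon>" using delta_K_eps[OF x] eq by simp
  qed (use g memG(3)[OF x] in simp)
  have sub: "g <# K #> inv g \<subseteq> K" using K1 by (auto simp: l_coset_def r_coset_def)
  have "g <# K #> inv g = (\<lambda>x. g \<otimes> x \<otimes> inv g) ` K" by (auto simp: l_coset_def r_coset_def)
  moreover have "inj_on (\<lambda>x. g \<otimes> x \<otimes> inv g) K"
  proof (rule inj_onI)
    fix a b assume ab: "a \<in> K" "b \<in> K" "g \<otimes> a \<otimes> inv g = g \<otimes> b \<otimes> inv g"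
    then have "g \<otimes> a = g \<otimes> b" using g memG(3) right_cancel[of "inv g" "g \<otimes> a" "g \<otimes> b"] by simp
    then show "a = b" using g memG(3) ab by simp
  qed
  ultimately have "card (g <# K #> inv g) = card K" by (simp add: card_image)
  then have "g <# K #> inv g = K" using card_subset_eq[OF fin_K sub] by simp
  then show ?thesis using N_iff g by blast
qed

text \<open>An element \<open>n\<close> that acts trivially commutes with \<open>H\<close> modulo \<open>K\<close>. Then \<open>nK\<close> and \<open>H/K\<close> generate an abelian
subgroup of \<open>N/K\<close>, which equals \<open>H/K\<close> by maximality.\<close>

lemma N_faithful:
  assumes n: "n \<in> N" and fix_E: "\<And>v. v \<in> E \<Longrightarrow> conjugate n v = v" shows "n \<in> H"
proof -
  let ?Q = "quot G N K"
  interpret Q: group ?Q by (rule NK_quotient(1))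
  have nG: "n \<in> carrier G" using memG(1)[OF n] .
  obtain r where r: "\<And>h. h \<in> H \<Longrightarrow> lin_char (n \<otimes> h \<otimes> inv n) = lin_char h ^ r" using lin_char_conj[OF n] by blast
  have lin_fix: "lin_char (n \<otimes> h \<otimes> inv n) = lin_char h" if h: "h \<in> H" for h
  proof -
    have "\<delta> (n \<otimes> h \<otimes> inv n) \<star> \<epsilon> = conjugate n (\<delta> h \<star> \<epsilon>)"
      using conjugate_mult[OF nG] conjugate_delta[OF nG memG(2)[OF h]] conj_eps[OF n] by simp
    also have "\<dots> = \<delta> h \<star> \<epsilon>" using fix_E delta_eps_E[OF h] by blast
    finally show ?thesis using delta_eps_eq_iff[OF H_normal[OF n h] h] by simp
  qed
  define S where "S = insert (K #> n) (carrier (quot G H K))"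
  have HKc: "carrier (quot G H K) = (\<lambda>a. K #> a) ` H" by (rule HK_quotient(2))
  have Qc: "carrier ?Q = (\<lambda>a. K #> a) ` N" by (rule NK_quotient(2))
  have S_sub: "S \<subseteq> carrier ?Q" unfolding S_def HKc Qc using n H_le_N by auto
  have comm_nh: "(K #> n) \<otimes>\<^bsub>?Q\<^esub> (K #> h) = (K #> h) \<otimes>\<^bsub>?Q\<^esub> (K #> n)" if h: "h \<in> H" for h
  proof -
    have hG: "h \<in> carrier G" using memG(2)[OF h] .
    have "n \<otimes> h \<otimes> inv n \<otimes> inv h \<in> K" using lin_char_eq_iff[OF H_normal[OF n h] h] lin_fix[OF h] by simp
    moreover have "n \<otimes> h \<otimes> inv (h \<otimes> n) = n \<otimes> h \<otimes> inv n \<otimes> inv h" using nG hG by (simp add: inv_mult_group m_assoc)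
    ultimately have "K #> (n \<otimes> h) = K #> (h \<otimes> n)" using coset_eq_iff[OF sub_K] nG hG by simp
    then show ?thesis using NK_quotient(4)[OF n H_in_N[OF h]] NK_quotient(4)[OF H_in_N[OF h] n] by simp
  qed
  have comm_hh: "(K #> g) \<otimes>\<^bsub>?Q\<^esub> (K #> h) = (K #> h) \<otimes>\<^bsub>?Q\<^esub> (K #> g)" if g: "g \<in> H" and h: "h \<in> H" for g h
  proof -
    have "lin_char (g \<otimes> h) = lin_char (h \<otimes> g)" using lin_char_mult g h by (simp add: mult.commute)
    then have "K #> (g \<otimes> h) = K #> (h \<otimes> g)"
      using lin_char_eq_iff[OF H_closed(1)[OF g h] H_closed(1)[OF h g]] coset_eq_iff[OF sub_K] memG(2)[OF g] memG(2)[OF h] by simp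
    then show ?thesis using NK_quotient(4)[OF H_in_N[OF g] H_in_N[OF h]] NK_quotient(4)[OF H_in_N[OF h] H_in_N[OF g]] by simp
  qed
  have S_comm: "a \<otimes>\<^bsub>?Q\<^esub> b = b \<otimes>\<^bsub>?Q\<^esub> a" if "a \<in> S" "b \<in> S" for a b
    using that comm_nh comm_hh unfolding S_def HKc by auto
  define B where "B = generate ?Q S"
  have B: "subgroup B ?Q" unfolding B_def by (rule Q.generate_is_subgroup[OF S_sub])
  have BB: "a \<otimes>\<^bsub>?Q\<^esub> b = b \<otimes>\<^bsub>?Q\<^esub> a" if "a \<in> B" "b \<in> B" for a b
    using Q.generate_commute[OF S_sub S_comm] that unfolding B_def by blast
  have grpB: "group (?Q\<lparr>carrier := B\<rparr>)" using Q.subgroup_imp_group[OF B] .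
  have "comm_group (?Q\<lparr>carrier := B\<rparr>)"
    by (rule group.group_comm_groupI[OF grpB]) (use BB in auto)
  moreover have "carrier (quot G H K) \<subseteq> B"
  proof
    fix c assume "c \<in> carrier (quot G H K)"
    then show "c \<in> B" unfolding B_def by (intro generate.incl) (simp add: S_def)
  qed
  ultimately have "B = carrier (quot G H K)"
    using ssp B unfolding strong_shoda_pair_def maximal_abelian_subgroup_def by blast
  moreover have "K #> n \<in> B" unfolding B_def by (rule generate.incl) (simp add: S_def)
  ultimately obtain h where h: "h \<in> H" "K #> n = K #> h" using HKc by auto
  then have "n \<otimes> inv h \<in> H" using coset_eq_iff[OF sub_K nG memG(2)[OF h(1)]] K_in_H by blast
  then show ?thesis using subgroup_mult_mem_iff(2)[OF sub_H H_closed(2)[OF h(1)] nG] by simp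
qed

text \<open>\<open>N\<close> acts on \<open>\<rat>H\<epsilon>\<close> through automorphisms of a cyclic group, and these commute.\<close>

lemma conj_commute_E:
  assumes s: "s \<in> N" and t: "t \<in> N" and v: "v \<in> E"
  shows "conjugate s (conjugate t v) = conjugate t (conjugate s v)"
proof -
  have sG: "s \<in> carrier G" and tG: "t \<in> carrier G" using memG(1) s t by blast+
  obtain r where r: "\<And>h. h \<in> H \<Longrightarrow> lin_char (s \<otimes> h \<otimes> inv s) = lin_char h ^ r" using lin_char_conj[OF s] by blast
  obtain q where q: "\<And>h. h \<in> H \<Longrightarrow> lin_char (t \<otimes> h \<otimes> inv t) = lin_char h ^ q" using lin_char_conj[OF t] by blast
  have d: "conjugate n (\<delta> h \<star> \<epsilon>) = \<delta> (n \<otimes> h \<otimes> inv n) \<star> \<epsilon>" if "n \<in> N" "h \<in> H" for n h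
    using conjugate_mult[OF memG(1)[OF that(1)]] conjugate_delta[OF memG(1)[OF that(1)] memG(2)[OF that(2)]] conj_eps[OF that(1)] by simp
  have base: "conjugate s (conjugate t (\<delta> h \<star> \<epsilon>)) = conjugate t (conjugate s (\<delta> h \<star> \<epsilon>))" if h: "h \<in> H" for h
  proof -
    have H: "t \<otimes> h \<otimes> inv t \<in> H" "s \<otimes> h \<otimes> inv s \<in> H" using H_normal s t h by blast+
    have "lin_char (s \<otimes> (t \<otimes> h \<otimes> inv t) \<otimes> inv s) = lin_char (t \<otimes> (s \<otimes> h \<otimes> inv s) \<otimes> inv t)"
      using r[OF H(1)] q[OF H(2)] r[OF h] q[OF h] by (simp add: power_mult[symmetric] mult.commute)
    then show ?thesis
      using delta_eps_eq_iff[OF H_normal[OF s H(1)] H_normal[OF t H(2)]] d[OF s H(1)] d[OF t H(2)] d[OF t h] d[OF s h] by simp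
  qed
  have v_eq: "v = (\<Sum>h\<in>H. v h *\<^sub>Q (\<delta> h \<star> \<epsilon>))"
  proof -
    have "v = v \<star> \<epsilon>" using E_eps(1)[OF v] by simp
    also have "\<dots> = (\<Sum>h\<in>H. v h *\<^sub>Q \<delta> h) \<star> \<epsilon>"
      using basis_expansion[OF fin_H, of v] v by (simp add: E_def)
    finally show ?thesis by (simp add: conv_linear)
  qed
  show ?thesis by (subst (1 2) v_eq) (simp add: conjugate_linear base cong: sum.cong)
qed

text \<open>The fixed field of \<open>N\<close> in \<open>\<rat>H\<epsilon>\<close>.\<close>

definition F :: "('a \<Rightarrow> rat) set" where "F = {v \<in> E. \<forall>n\<in>N. conjugate n v = v}"

lemma fixed_field_eq: "fixed_field G H K = F"
  by (simp add: fixed_field_def F_def QHe_carrier)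

lemma F_E: "v \<in> F \<Longrightarrow> v \<in> E" and F_conj: "v \<in> F \<Longrightarrow> n \<in> N \<Longrightarrow> conjugate n v = v"
  by (auto simp: F_def)

lemma F_closed: "0 \<in> F" "a \<in> F \<Longrightarrow> b \<in> F \<Longrightarrow> a + b \<in> F" "a \<in> F \<Longrightarrow> b \<in> F \<Longrightarrow> a - b \<in> F"
  "a \<in> F \<Longrightarrow> c *\<^sub>Q a \<in> F" "a \<in> F \<Longrightarrow> b \<in> F \<Longrightarrow> a \<star> b \<in> F" "\<epsilon> \<in> F" "(\<And>i. i \<in> I \<Longrightarrow> f i \<in> F) \<Longrightarrow> (\<Sum>i\<in>I. f i) \<in> F"
  "a \<in> F \<Longrightarrow> - a \<in> F"
  using E_closed(1-6,8) E_closed(7)[of I f] conj_eps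
  by (simp_all add: F_def conjugate_linear conjugate_mult memG(1))

lemma F_commute:
  assumes "l \<in> F" "a \<in> A" shows "a \<star> l = l \<star> a"
proof -
  have "\<delta> n \<star> l = l \<star> \<delta> n" if "n \<in> N" for n
    using conjugate_eq_self_iff[OF memG(1)[OF that] A_on_G[OF E_subset_A[OF F_E[OF assms(1)]]]] F_conj[OF assms(1) that] by simp
  then show ?thesis using conv_commute_of_delta[OF N_le_G, of a l] assms(2) by (simp add: A_def)
qed

lemma F_inverse:
  assumes "l \<in> F" "l \<noteq> 0" shows "\<exists>m\<in>F. l \<star> m = \<epsilon>"
proof -
  obtain m where m: "m \<in> E" "l \<star> m = \<epsilon>" using E_inverse[OF F_E[OF assms(1)] assms(2)] by blast
  have "conjugate n m = m" if n: "n \<in> N" for n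
  proof -
    have "l \<star> conjugate n m = \<epsilon>"
      using conjugate_mult[OF memG(1)[OF n], of l m] m(2) conj_eps[OF n] F_conj[OF assms(1) n] by simp
    then have "l \<star> (conjugate n m - m) = 0" using m(2) by (simp add: conv_linear)
    then show ?thesis using E_domain[OF F_E[OF assms(1)] E_closed(3)[OF E_conj_N[OF m(1) n] m(1)]] assms(2) by simp
  qed
  then show ?thesis using m by (auto simp: F_def)
qed

end

text \<open>Trivial twisting means that \<open>\<phi>\<close> splits the extension of \<open>N/H\<close> by \<open>H/K\<close>; the transversal \<open>T\<close> represents its
image.\<close>

locale split_strong_shoda = strong_shoda +
  fixes \<phi> :: "'a set \<Rightarrow> 'a set" and T :: "'a set"
  assumes twisting_trivial: "\<And>g g'. g \<in> N \<Longrightarrow> g' \<in> N \<Longrightarrow> twisting G H K \<phi> y \<zeta> (H #> g) (H #> g') = 1"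
    and T_lifting: "transversal_lifting G H K \<phi> T"
begin

lemma T_in_N: "t \<in> T \<Longrightarrow> t \<in> N" and T_rep: "n \<in> N \<Longrightarrow> \<exists>!t. t \<in> T \<and> t \<in> H #> n"
  and T_phi: "t \<in> T \<Longrightarrow> \<phi> (H #> t) = K #> t"
  using T_lifting by (auto simp: transversal_lifting_def)

lemma T_in_G: "t \<in> T \<Longrightarrow> t \<in> carrier G" using memG(1) T_in_N by blast
lemma fin_T: "finite T" using finite_subset[OF _ fin_N] T_in_N by blast

lemma mem_coset_iff:
  assumes "t \<in> N" "n \<in> N" shows "t \<in> H #> n \<longleftrightarrow> n \<otimes> inv t \<in> H"
proof -
  have G: "t \<in> carrier G" "n \<in> carrier G" using memG(1) assms by blast+
  have "t \<in> H #> n \<longleftrightarrow> H #> n = H #> t"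
    using repr_independence[OF _ G(2) sub_H] rcos_self[OF G(1) sub_H] by blast
  then show ?thesis using coset_eq_iff[OF sub_H G(2) G(1)] by simp
qed

lemma T_exists: assumes "n \<in> N" obtains t where "t \<in> T" "n \<otimes> inv t \<in> H"
  using T_rep[OF assms] mem_coset_iff[OF T_in_N assms] that by blast

lemma T_unique:
  assumes "n \<in> N" "t \<in> T" "n \<otimes> inv t \<in> H" "s \<in> T" "n \<otimes> inv s \<in> H" shows "t = s"
  using T_rep[OF assms(1)] mem_coset_iff[OF T_in_N assms(1)] assms by blast

lemma T_nonempty: "T \<noteq> {}"
  using T_exists[OF subgroup.one_closed[OF sub_N]] by blast

text \<open>Trivial twisting says that \<open>\<phi>\<close> is multiplicative: the exponent \<open>j\<close> in its definition satisfies \<open>\<zeta>\<^sup>j = 1\<close>,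
hence \<open>y\<^sup>j \<in> K\<close>. As \<open>T\<close> represents \<open>\<phi>\<close>, it is closed under multiplication modulo \<open>K\<close>.\<close>

lemma T_mult:
  assumes t: "t \<in> T" and s: "s \<in> T" obtains u x where "u \<in> T" "x \<in> K" "t \<otimes> s = x \<otimes> u"
proof -
  let ?NH = "quot G N H" and ?NK = "quot G N K"
  have N: "t \<in> N" "s \<in> N" "t \<otimes> s \<in> N" using T_in_N t s N_closed by auto
  obtain u where u: "u \<in> T" "t \<otimes> s \<otimes> inv u \<in> H" using T_exists[OF N(3)] .
  have uN: "u \<in> N" using T_in_N[OF u(1)] .
  have G: "t \<in> carrier G" "s \<in> carrier G" "u \<in> carrier G" "y \<in> carrier G" using memG N uN yH by blast+
  have cd: "(H #> t) \<otimes>\<^bsub>?NH\<^esub> (H #> s) = H #> u"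
    using NH_quotient(4)[OF N(1,2)] coset_eq_iff[OF sub_H, of "t \<otimes> s" u] u(2) G by simp
  have elt: "inv\<^bsub>?NK\<^esub> (\<phi> ((H #> t) \<otimes>\<^bsub>?NH\<^esub> (H #> s))) \<otimes>\<^bsub>?NK\<^esub> \<phi> (H #> t) \<otimes>\<^bsub>?NK\<^esub> \<phi> (H #> s) = K #> (inv u \<otimes> t \<otimes> s)"
    unfolding cd T_phi[OF t] T_phi[OF s] T_phi[OF u(1)]
    using NK_quotient(4,5) N uN N_closed by simp
  have "inv u \<otimes> (t \<otimes> s \<otimes> inv u) \<otimes> u \<in> H" using H_normal[OF N_closed(2)[OF uN] u(2)] G by simp
  then have H: "inv u \<otimes> t \<otimes> s \<in> H" using G by (simp add: m_assoc)
  have ypow: "(K #> y) [^]\<^bsub>?NK\<^esub> j = K #> y [^] j" for j :: nat using NK_quotient(6)[OF H_in_N[OF yH]] .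
  obtain m x where m: "x \<in> K" "inv u \<otimes> t \<otimes> s = x \<otimes> y [^] (m::nat)" using H_generated[OF H] by blast
  have "K #> (inv u \<otimes> t \<otimes> s) = (K #> y) [^]\<^bsub>?NK\<^esub> m"
    unfolding ypow m(2) using coset_eq_iff[OF sub_K, of "x \<otimes> y [^] m" "y [^] m"] G memG(3)[OF m(1)] m(1) by (simp add: m_assoc)
  then have ex: "\<exists>j::nat. K #> (inv u \<otimes> t \<otimes> s) = (K #> y) [^]\<^bsub>?NK\<^esub> j" by blast
  define j where "j = (SOME j::nat. K #> (inv u \<otimes> t \<otimes> s) = (K #> y) [^]\<^bsub>?NK\<^esub> j)"
  have j: "K #> (inv u \<otimes> t \<otimes> s) = (K #> y) [^]\<^bsub>?NK\<^esub> j" unfolding j_def by (rule someI_ex[OF ex])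
  have "\<zeta> ^ j = 1"
    using twisting_trivial[OF N(1,2)] unfolding twisting_def Let_def elt j_def .
  then have "y [^] j \<in> K" using \<zeta>_pow_eq_1_iff y_pow_mem_K_iff by simp
  then have "K #> y [^] j = K" using coset_join2[of "y [^] j" K] sub_K G by simp
  then have "K #> (inv u \<otimes> t \<otimes> s) = K" using j ypow by simp
  then have K: "inv u \<otimes> t \<otimes> s \<in> K" using rcos_self[of "inv u \<otimes> t \<otimes> s" K] sub_K G by simp
  define z where "z = u \<otimes> (inv u \<otimes> t \<otimes> s) \<otimes> inv u"
  have "z \<in> K" unfolding z_def by (rule K_normal[OF uN K])
  moreover have "t \<otimes> s = z \<otimes> u" unfolding z_def using G by (simp add: m_assoc) (simp add: m_assoc[symmetric])
  ultimately show thesis using that u(1) by blast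
qed

definition n :: nat where "n = card T"

lemma n_pos: "n > 0" using fin_T T_nonempty by (simp add: n_def card_gt_0_iff)

lemma T_bij: "bij_betw (\<lambda>t. H #> t) T (carrier (quot G N H))"
proof (rule bij_betw_imageI)
  show "inj_on (\<lambda>t. H #> t) T"
  proof (rule inj_onI)
    fix s t assume s: "s \<in> T" and t: "t \<in> T" and "H #> s = H #> t"
    then have "s \<otimes> inv t \<in> H" using coset_eq_iff[OF sub_H T_in_G T_in_G] by blast
    moreover have "s \<otimes> inv s \<in> H" using T_in_G[OF s] subgroup.one_closed[OF sub_H] by simp
    ultimately show "s = t" using T_unique[OF T_in_N[OF s]] s t by blast
  qed
  show "(\<lambda>t. H #> t) ` T = carrier (quot G N H)"
    unfolding NH_quotient(2)
  proof (intro equalityI subsetI)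
    fix c assume "c \<in> (\<lambda>a. H #> a) ` N"
    then obtain g where g: "g \<in> N" "c = H #> g" by blast
    obtain t where t: "t \<in> T" "g \<otimes> inv t \<in> H" using T_exists[OF g(1)] .
    then have "c = H #> t" using coset_eq_iff[OF sub_H memG(1)[OF g(1)] T_in_G[OF t(1)]] g(2) by simp
    then show "c \<in> (\<lambda>t. H #> t) ` T" using t(1) by blast
  qed (use T_in_N in blast)
qed

lemma n_eq: "card (carrier (quot G N H)) = n"
  using bij_betw_same_card[OF T_bij] by (simp add: n_def)

definition f :: "'a \<Rightarrow> rat" where "f = hat T \<star> \<epsilon>"

lemma f_eq: "f = (\<Sum>t\<in>T. (1 / of_nat n) *\<^sub>Q (\<delta> t \<star> \<epsilon>))"
  unfolding f_def hat_expansion[OF fin_T] by (simp add: conv_linear n_def)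

lemma f_in_A: "f \<in> A"
  unfolding f_eq by (intro A_closed(7) A_closed(4) delta_eps_A T_in_N)

text \<open>Left multiplication by \<open>t\<close> permutes \<open>T\<close> modulo \<open>K\<close>, and \<open>K\<close> acts trivially on \<open>\<epsilon>\<close>.\<close>

lemma delta_T_f: assumes t: "t \<in> T" shows "\<delta> t \<star> f = f"
proof -
  have ex: "\<forall>s\<in>T. \<exists>u\<in>T. \<exists>x\<in>K. t \<otimes> s = x \<otimes> u" using T_mult[OF t] by metis
  then obtain g where g: "\<And>s. s \<in> T \<Longrightarrow> g s \<in> T \<and> (\<exists>x\<in>K. t \<otimes> s = x \<otimes> g s)" by metis
  have tG: "t \<in> carrier G" using T_in_G[OF t] .
  have inj: "inj_on g T"
  proof (rule inj_onI)
    fix s s' assume s: "s \<in> T" "s' \<in> T" "g s = g s'"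
    obtain x x' where x: "x \<in> K" "t \<otimes> s = x \<otimes> g s" "x' \<in> K" "t \<otimes> s' = x' \<otimes> g s" using g s by metis
    have G: "x \<in> carrier G" "x' \<in> carrier G" "g s \<in> carrier G" "s \<in> carrier G" "s' \<in> carrier G"
      using memG x T_in_G g s by auto
    have "s \<otimes> inv s' = inv t \<otimes> ((t \<otimes> s) \<otimes> inv (t \<otimes> s')) \<otimes> t"
      using G tG by (simp add: m_assoc inv_mult_group) (simp add: m_assoc[symmetric])
    also have "(t \<otimes> s) \<otimes> inv (t \<otimes> s') = x \<otimes> inv x'" unfolding x(2,4) using G by (simp add: m_assoc inv_mult_group)
       (simp add: m_assoc[symmetric])
    finally have "s \<otimes> inv s' = inv t \<otimes> (x \<otimes> inv x') \<otimes> t" .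
    moreover have "inv t \<otimes> (x \<otimes> inv x') \<otimes> t \<in> H"
      using H_normal_iff'[OF T_in_N[OF t], of "x \<otimes> inv x'"] x K_closed K_in_H G by simp
    ultimately have "s \<otimes> inv s' \<in> H" by simp
    moreover have "s \<otimes> inv s \<in> H" using G subgroup.one_closed[OF sub_H] by simp
    ultimately show "s = s'" using T_unique[OF T_in_N[OF s(1)]] s by blast
  qed
  have img: "g ` T = T" using g inj fin_T by (metis card_image card_subset_eq image_subsetI)
  have "\<delta> t \<star> (\<delta> s \<star> \<epsilon>) = \<delta> (g s) \<star> \<epsilon>" if s: "s \<in> T" for s
  proof -
    obtain x where x: "x \<in> K" "t \<otimes> s = x \<otimes> g s" using g s by blast
    have gs: "g s \<in> T" using g s by blast
    have "\<delta> t \<star> (\<delta> s \<star> \<epsilon>) = \<delta> x \<star> (\<delta> (g s) \<star> \<epsilon>)"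
      using delta_mult_assoc[OF tG T_in_G[OF s]] delta_mult_assoc[OF memG(3)[OF x(1)] T_in_G[OF gs]] x(2) by simp
    then show ?thesis using delta_K_A[OF x(1) delta_eps_A[OF T_in_N[OF gs]]] by simp
  qed
  then have "\<delta> t \<star> f = (\<Sum>s\<in>T. (1 / of_nat n) *\<^sub>Q (\<delta> (g s) \<star> \<epsilon>))"
    unfolding f_eq by (simp add: conv_linear cong: sum.cong)
  also have "\<dots> = (\<Sum>s\<in>g ` T. (1 / of_nat n) *\<^sub>Q (\<delta> s \<star> \<epsilon>))"
    by (simp add: sum.reindex[OF inj])
  finally show ?thesis unfolding img by (simp add: f_eq)
qed

text \<open>The coefficient in \<open>\<rat>H\<epsilon>\<close> at \<open>t\<epsilon>\<close> of an element of the crossed product, read off on the coset \<open>H t\<close>.\<close>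

definition coord :: "'a \<Rightarrow> ('a \<Rightarrow> rat) \<Rightarrow> 'a \<Rightarrow> rat" where
  "coord t a = (\<lambda>h. if h \<in> H then a (h \<otimes> t) else 0)"

lemma coord_linear: "coord t (a + b) = coord t a + coord t b" "coord t (c *\<^sub>Q a) = c *\<^sub>Q coord t a"
  "coord t (a - b) = coord t a - coord t b" "coord t 0 = 0"
  by (auto simp: coord_def fun_eq_iff)

lemma coord_in_E:
  assumes a: "a \<in> A" and t: "t \<in> N" shows "coord t a \<in> E"
proof -
  have tG: "t \<in> carrier G" using memG(1)[OF t] .
  define c where "c = a \<star> \<delta> (inv t)"
  have c: "c \<star> \<epsilon> = c"
    using eps_delta_N[OF N_closed(2)[OF t]] A_eps(1)[OF a] by (simp add: c_def conv_assoc) (simp add: conv_assoc[symmetric])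
  have cc: "coord t a h = (if h \<in> H then c h else 0)" for h
    using conv_delta_apply[of "inv t" h a] memG(2)[of h] tG by (simp add: coord_def c_def)
  have "(coord t a \<star> \<epsilon>) h = coord t a h" for h
  proof (cases "h \<in> H")
    case True
    have hG: "h \<in> carrier G" using memG(2)[OF True] .
    have "(coord t a \<star> \<epsilon>) h = (\<Sum>g\<in>carrier G. c g * \<epsilon> (inv g \<otimes> h))"
      unfolding conv_apply[OF hG]
    proof (rule sum.cong[OF refl])
      fix g assume g: "g \<in> carrier G"
      show "coord t a g * \<epsilon> (inv g \<otimes> h) = c g * \<epsilon> (inv g \<otimes> h)"
      proof (cases "g \<in> H")
        case False
        have "inv g \<otimes> h \<notin> H"
          using subgroup_mult_mem_iff(2)[OF sub_H True inv_closed[OF g]] False H_closed(2)[of "inv g"] g by auto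
        then show ?thesis using functions_onD[OF N_central_on_H[OF eps_N_central]] by simp
      qed (simp add: cc)
    qed
    also have "\<dots> = c h" using fun_cong[OF c, of h] by (simp add: conv_apply[OF hG])
    finally show ?thesis using True by (simp add: cc)
  next
    case False
    have "coord t a \<in> functions_on H" by (simp add: functions_on_def coord_def)
    then have "coord t a \<star> \<epsilon> \<in> functions_on H" using functions_on_conv[OF sub_H _ N_central_on_H[OF eps_N_central]] by blast
    then show ?thesis using False by (simp add: functions_on_def coord_def)
  qed
  then show ?thesis by (auto simp: E_def functions_on_def coord_def fun_eq_iff)
qed

lemma coord_expansion:
  assumes a: "a \<in> A" shows "a = (\<Sum>t\<in>T. coord t a \<star> \<delta> t)"
proof (rule conv_ext[OF _ A_on_G[OF a]])
  show "(\<Sum>t\<in>T. coord t a \<star> \<delta> t) \<in> functions_on (carrier G)" by (intro functions_on_closed conv_closed)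
  fix g assume g: "g \<in> carrier G"
  have val: "(coord t a \<star> \<delta> t) g = (if g \<otimes> inv t \<in> H then a g else 0)" if "t \<in> T" for t
    using conv_delta_apply[OF T_in_G[OF that] g, of "coord t a"] T_in_G[OF that] g by (simp add: coord_def m_assoc)
  show "a g = (\<Sum>t\<in>T. coord t a \<star> \<delta> t) g"
  proof (cases "g \<in> N")
    case True
    obtain t where t: "t \<in> T" "g \<otimes> inv t \<in> H" using T_exists[OF True] .
    have "(\<Sum>s\<in>T. (coord s a \<star> \<delta> s) g) = (\<Sum>s\<in>T. if s = t then a g else 0)"
      using T_unique[OF True] t by (intro sum.cong[OF refl]) (auto simp: val)
    then show ?thesis using t(1) fin_T by (simp add: sum_fun_apply)
  next
    case False
    then have "a g = 0" using a by (simp add: A_def functions_on_def)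
    moreover have "(\<Sum>t\<in>T. (coord t a \<star> \<delta> t) g) = 0" using \<open>a g = 0\<close> by (intro sum.neutral) (simp add: val)
    ultimately show ?thesis by (simp add: sum_fun_apply)
  qed
qed

lemma coord_sum:
  assumes x: "\<And>t. t \<in> T \<Longrightarrow> x t \<in> E" and s: "s \<in> T" shows "coord s (\<Sum>t\<in>T. x t \<star> \<delta> t) = x s"
proof
  fix h
  show "coord s (\<Sum>t\<in>T. x t \<star> \<delta> t) h = x s h"
  proof (cases "h \<in> H")
    case True
    have G: "h \<in> carrier G" "s \<in> carrier G" using memG(2)[OF True] T_in_G[OF s] .
    have "(\<Sum>t\<in>T. (x t \<star> \<delta> t) (h \<otimes> s)) = (\<Sum>t\<in>T. if t = s then x s h else 0)"
    proof (rule sum.cong[OF refl])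
      fix t assume t: "t \<in> T"
      have tG: "t \<in> carrier G" using T_in_G[OF t] .
      have val: "(x t \<star> \<delta> t) (h \<otimes> s) = x t (h \<otimes> s \<otimes> inv t)" using conv_delta_apply[OF tG] G by simp
      show "(x t \<star> \<delta> t) (h \<otimes> s) = (if t = s then x s h else 0)"
      proof (cases "t = s")
        case True
        then show ?thesis using val G by (simp add: m_assoc)
      next
        case False
        have "h \<otimes> s \<otimes> inv t \<notin> H"
        proof
          assume "h \<otimes> s \<otimes> inv t \<in> H"
          then have "s \<otimes> inv t \<in> H" using subgroup_mult_mem_iff(1)[OF sub_H True, of "s \<otimes> inv t"] G tG by (simp add: m_assoc)
          moreover have "s \<otimes> inv s \<in> H" using G subgroup.one_closed[OF sub_H] by simp
          ultimately show False using T_unique[OF T_in_N[OF s] t _ s] False by blast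
        qed
        then show ?thesis using val False x[OF t] by (simp add: E_def functions_on_def)
      qed
    qed
    then show ?thesis using True s fin_T by (simp add: coord_def sum_fun_apply)
  next
    case False
    then show ?thesis using x[OF s] by (simp add: coord_def E_def functions_on_def)
  qed
qed

lemma E_delta_eps: "v \<in> E \<Longrightarrow> t \<in> N \<Longrightarrow> v \<star> (\<delta> t \<star> \<epsilon>) = v \<star> \<delta> t"
  unfolding eps_delta_N conv_assoc[symmetric] by (simp add: E_eps(1))

lemma sum_in_A: "(\<And>t. t \<in> T \<Longrightarrow> x t \<in> E) \<Longrightarrow> (\<Sum>t\<in>T. x t \<star> \<delta> t) \<in> A"
proof (rule A_closed(7))
  fix t assume x: "\<And>t. t \<in> T \<Longrightarrow> x t \<in> E" and t: "t \<in> T"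
  have "x t \<star> \<delta> t = x t \<star> (\<delta> t \<star> \<epsilon>)" using E_delta_eps[OF x[OF t] T_in_N[OF t]] by simp
  then show "x t \<star> \<delta> t \<in> A" using A_closed(5)[OF E_subset_A[OF x[OF t]] delta_eps_A[OF T_in_N[OF t]]] by simp
qed

text \<open>The action \<open>x t\<epsilon> \<cdot> v = x (t v t\<^sup>-\<^sup>1)\<close> of the crossed product on \<open>\<rat>H\<epsilon>\<close>.\<close>

definition rho :: "('a \<Rightarrow> rat) \<Rightarrow> ('a \<Rightarrow> rat) \<Rightarrow> 'a \<Rightarrow> rat" where
  "rho a v = (\<Sum>t\<in>T. coord t a \<star> conjugate t v)"

lemma rho_in_E: "a \<in> A \<Longrightarrow> v \<in> E \<Longrightarrow> rho a v \<in> E"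
  unfolding rho_def by (intro E_closed(7) E_closed(5) coord_in_E E_conj_N T_in_N)

text \<open>Since \<open>T\<close> fixes \<open>f\<close>, moving \<open>t\<close> through \<open>v\<close> and absorbing it into \<open>f\<close> turns multiplication in the group
algebra into the action on \<open>\<rat>H\<epsilon>\<close>. Multiplicativity of the action follows from associativity.\<close>

lemma act_f: assumes a: "a \<in> A" shows "a \<star> v \<star> f = rho a v \<star> f"
proof -
  have "a \<star> v \<star> f = (\<Sum>t\<in>T. coord t a \<star> \<delta> t \<star> v \<star> f)"
    by (subst coord_expansion[OF a]) (simp add: conv_linear)
  also have "\<dots> = (\<Sum>t\<in>T. coord t a \<star> conjugate t v \<star> f)"
  proof (rule sum.cong[OF refl])
    fix t assume t: "t \<in> T"
    have "coord t a \<star> \<delta> t \<star> v \<star> f = coord t a \<star> (\<delta> t \<star> v) \<star> f" by (simp add: conv_assoc)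
    also have "\<dots> = coord t a \<star> conjugate t v \<star> (\<delta> t \<star> f)" by (simp only: delta_conv_swap[OF T_in_G[OF t], of v] conv_assoc)
    finally show "coord t a \<star> \<delta> t \<star> v \<star> f = coord t a \<star> conjugate t v \<star> f" using delta_T_f[OF t] by simp
  qed
  finally show ?thesis by (simp add: rho_def conv_linear)
qed

lemma E_f_injective: assumes v: "v \<in> E" and z: "v \<star> f = 0" shows "v = 0"
proof -
  obtain s where s: "s \<in> T" using T_nonempty by blast
  have "v \<star> f = (\<Sum>t\<in>T. ((1 / of_nat n) *\<^sub>Q v) \<star> \<delta> t)"
  proof -
    have "v \<star> (\<delta> t \<star> \<epsilon>) = v \<star> \<delta> t" if "t \<in> T" for t
      using E_delta_eps[OF v T_in_N[OF that]] .
    then show ?thesis unfolding f_eq by (simp add: conv_linear cong: sum.cong)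
  qed
  then have "coord s (v \<star> f) = (1 / of_nat n) *\<^sub>Q v" using coord_sum[OF E_closed(4)[OF v] s] by simp
  then have "(1 / of_nat n) *\<^sub>Q v = 0" unfolding z coord_linear(4) by simp
  then show ?thesis using n_pos by (simp add: fun_eq_iff)
qed

lemma E_f_cancel: "u \<in> E \<Longrightarrow> v \<in> E \<Longrightarrow> u \<star> f = v \<star> f \<Longrightarrow> u = v"
  using E_f_injective[of "u - v"] E_closed(3) by (simp add: conv_linear)

lemma rho_eqI: "a \<in> A \<Longrightarrow> v \<in> E \<Longrightarrow> u \<in> E \<Longrightarrow> a \<star> v \<star> f = u \<star> f \<Longrightarrow> rho a v = u"
  using act_f[of a v] E_f_cancel[OF rho_in_E] by simp

lemma separate:
  assumes "c \<in> T" "d \<in> T" "c \<noteq> d" shows "\<exists>v\<in>E. conjugate c v \<noteq> conjugate d v"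
proof (rule ccontr)
  assume "\<not> (\<exists>v\<in>E. conjugate c v \<noteq> conjugate d v)"
  then have eq: "\<And>v. v \<in> E \<Longrightarrow> conjugate c v = conjugate d v" by blast
  have G: "c \<in> carrier G" "d \<in> carrier G" using T_in_G assms by blast+
  have "inv d \<otimes> c \<in> H"
  proof (rule N_faithful)
    show "inv d \<otimes> c \<in> N" using T_in_N assms N_closed by blast
    fix v assume v: "v \<in> E"
    have "conjugate (inv d \<otimes> c) v = conjugate (inv d) (conjugate d v)"
      using conjugate_conjugate[of "inv d" c v] eq[OF v] G by simp
    also have "\<dots> = v" using conjugate_conjugate[of "inv d" d v] G conjugate_one A_on_G[OF E_subset_A[OF v]] by simp
    finally show "conjugate (inv d \<otimes> c) v = v" .
  qed
  then have "d \<otimes> (inv d \<otimes> c) \<otimes> inv d \<in> H" using H_normal T_in_N assms(2) by blast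
  then have "c \<otimes> inv d \<in> H" using G by (simp add: m_assoc[symmetric])
  moreover have "c \<otimes> inv c \<in> H" using G subgroup.one_closed[OF sub_H] by simp
  ultimately show False using T_unique[OF T_in_N[OF assms(1)]] assms by blast
qed

text \<open>Dedekind's argument. If \<open>a\<close> acts as zero and has two nonzero coefficients, at \<open>c\<close> and \<open>d\<close>, choose \<open>v\<close> on
which \<open>c\<close> and \<open>d\<close> act differently. Then \<open>a v - (c v c\<^sup>-\<^sup>1) a\<close> acts as zero, has no coefficient at \<open>c\<close>, and
still has one at \<open>d\<close>, so induction on the number of nonzero coefficients applies. With a single
nonzero coefficient, evaluate at \<open>\<epsilon>\<close>.\<close>

lemma rho_injective:
  assumes "a \<in> A" "\<And>v. v \<in> E \<Longrightarrow> rho a v = 0" shows "a = 0"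
  using assms
proof (induction "card {t \<in> T. coord t a \<noteq> 0}" arbitrary: a rule: less_induct)
  case less
  show ?case
  proof (rule ccontr)
    assume "a \<noteq> 0"
    have "\<exists>c\<in>T. coord c a \<noteq> 0"
    proof (rule ccontr)
      assume "\<not> (\<exists>c\<in>T. coord c a \<noteq> 0)"
      then have "(\<Sum>t\<in>T. coord t a \<star> \<delta> t) = 0" by (intro sum.neutral) auto
      then show False using coord_expansion[OF less.prems(1)] \<open>a \<noteq> 0\<close> by simp
    qed
    then obtain c where c: "c \<in> T" "coord c a \<noteq> 0" by blast
    show False
    proof (cases "\<exists>d\<in>T. d \<noteq> c \<and> coord d a \<noteq> 0")
      case True
      then obtain d where d: "d \<in> T" "d \<noteq> c" "coord d a \<noteq> 0" by blast
      obtain v where v: "v \<in> E" "conjugate d v \<noteq> conjugate c v" using separate[OF d(1) c(1) d(2)] by blast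
      define u where "u = conjugate c v"
      have u: "u \<in> E" unfolding u_def using E_conj_N[OF v(1) T_in_N[OF c(1)]] .
      define x where "x t = coord t a \<star> (conjugate t v - u)" for t
      have xE: "x t \<in> E" if "t \<in> T" for t
        unfolding x_def using coord_in_E[OF less.prems(1) T_in_N[OF that]] E_conj_N[OF v(1) T_in_N[OF that]] u E_closed(3,5) by blast
      define a' where "a' = a \<star> v - u \<star> a"
      have a': "a' \<in> A" unfolding a'_def using less.prems(1) E_subset_A v(1) u A_closed(3,5) by blast
      have "a' = (\<Sum>t\<in>T. x t \<star> \<delta> t)"
      proof -
        have "a \<star> v = (\<Sum>t\<in>T. coord t a \<star> conjugate t v \<star> \<delta> t)"
        proof -
          have "a \<star> v = (\<Sum>t\<in>T. coord t a \<star> \<delta> t \<star> v)"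
            by (subst coord_expansion[OF less.prems(1)]) (simp add: conv_linear)
          also have "\<dots> = (\<Sum>t\<in>T. coord t a \<star> conjugate t v \<star> \<delta> t)"
            by (rule sum.cong[OF refl]) (simp add: conv_assoc delta_conv_swap[OF T_in_G, of _ v])
          finally show ?thesis .
        qed
        moreover have "u \<star> a = (\<Sum>t\<in>T. coord t a \<star> u \<star> \<delta> t)"
        proof -
          have "u \<star> a = (\<Sum>t\<in>T. u \<star> (coord t a \<star> \<delta> t))"
            by (subst coord_expansion[OF less.prems(1)]) (simp add: conv_linear)
          also have "\<dots> = (\<Sum>t\<in>T. coord t a \<star> u \<star> \<delta> t)"
          proof (rule sum.cong[OF refl])
            fix t assume "t \<in> T"
            then have "u \<star> coord t a = coord t a \<star> u" using E_commute[OF u coord_in_E[OF less.prems(1) T_in_N]] by blast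
            then show "u \<star> (coord t a \<star> \<delta> t) = coord t a \<star> u \<star> \<delta> t" by (simp add: conv_assoc[symmetric])
          qed
          finally show ?thesis .
        qed
        ultimately show ?thesis by (simp add: a'_def x_def conv_linear sum_subtractf)
      qed
      then have coord_a': "coord t a' = x t" if "t \<in> T" for t using coord_sum[OF xE that] by simp
      have "{t \<in> T. coord t a' \<noteq> 0} \<subset> {t \<in> T. coord t a \<noteq> 0}"
      proof -
        have "c \<notin> {t \<in> T. coord t a' \<noteq> 0}" using coord_a' by (auto simp: x_def u_def)
        moreover have "{t \<in> T. coord t a' \<noteq> 0} \<subseteq> {t \<in> T. coord t a \<noteq> 0}" using coord_a' by (auto simp: x_def)
        ultimately show ?thesis using c by blast
      qed
      then have less_card: "card {t \<in> T. coord t a' \<noteq> 0} < card {t \<in> T. coord t a \<noteq> 0}" using fin_T by (intro psubset_card_mono) auto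
      have "rho a' z = 0" if z: "z \<in> E" for z
      proof (rule rho_eqI[OF a' z E_closed(1)])
        have "a' \<star> z \<star> f = a \<star> (v \<star> z) \<star> f - u \<star> (a \<star> z \<star> f)" by (simp add: a'_def conv_linear conv_assoc)
        also have "\<dots> = rho a (v \<star> z) \<star> f - u \<star> (rho a z \<star> f)" by (simp only: act_f[OF less.prems(1)])
        finally show "a' \<star> z \<star> f = 0 \<star> f" using less.prems(2)[OF z] less.prems(2)[OF E_closed(5)[OF v(1) z]] by simp
      qed
      then have "a' = 0" using less.hyps[OF less_card a'] by blast
      then have "x d = 0" using coord_a'[OF d(1)] coord_linear(4) by simp
      then have "coord d a = 0 \<or> conjugate d v - u = 0" unfolding x_def
        using E_domain coord_in_E[OF less.prems(1) T_in_N[OF d(1)]] E_closed(3)[OF E_conj_N[OF v(1) T_in_N[OF d(1)]] u] by blast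
      then show False using d(3) v(2) by (simp add: u_def)
    next
      case False
      have "rho a \<epsilon> = (\<Sum>t\<in>T. if t = c then coord c a \<star> \<epsilon> else 0)"
        unfolding rho_def using False conj_eps[OF T_in_N] by (intro sum.cong[OF refl]) auto
      also have "\<dots> = coord c a" using c(1) fin_T E_eps(1)[OF coord_in_E[OF less.prems(1) T_in_N[OF c(1)]]] by simp
      finally show False using less.prems(2)[OF E_closed(6)] c(2) by simp
    qed
  qed
qed

lemma rho_linear:
  "rho (a + b) v = rho a v + rho b v" "rho (a - b) v = rho a v - rho b v" "rho (c *\<^sub>Q a) v = c *\<^sub>Q rho a v"
  "rho a (v + w) = rho a v + rho a w" "rho a (c *\<^sub>Q v) = c *\<^sub>Q rho a v"
  by (simp_all add: rho_def coord_linear conv_linear conjugate_linear sum.distrib sum_subtractf QV.scale_sum_right)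

lemma rho_zero: "rho 0 v = 0" "rho a 0 = 0"
  using rho_linear(3)[of 0 0 v] rho_linear(5)[of a 0 0] by (simp_all only: QV.scale_zero_left)

lemma rho_sum: "rho a (\<Sum>i\<in>I. v i) = (\<Sum>i\<in>I. rho a (v i))"
  by (simp add: rho_def conv_linear conjugate_linear sum.swap[of _ I T])

lemma rho_F: assumes a: "a \<in> A" and l: "l \<in> F" and v: "v \<in> E" shows "rho a (l \<star> v) = l \<star> rho a v"
proof (rule rho_eqI[OF a])
  show "l \<star> v \<in> E" "l \<star> rho a v \<in> E" using F_E[OF l] v rho_in_E[OF a v] E_closed(5) by blast+
  have "a \<star> (l \<star> v) \<star> f = (a \<star> l) \<star> v \<star> f" by (simp add: conv_assoc)
  also have "\<dots> = l \<star> (a \<star> v \<star> f)" unfolding F_commute[OF l a] by (simp add: conv_assoc)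
  also have "\<dots> = l \<star> rho a v \<star> f" unfolding act_f[OF a] by (simp add: conv_assoc)
  finally show "a \<star> (l \<star> v) \<star> f = l \<star> rho a v \<star> f" .
qed

lemma rho_mult: assumes a: "a \<in> A" and b: "b \<in> A" and v: "v \<in> E" shows "rho (a \<star> b) v = rho a (rho b v)"
proof (rule rho_eqI[OF A_closed(5)[OF a b] v rho_in_E[OF a rho_in_E[OF b v]]])
  have "a \<star> b \<star> v \<star> f = a \<star> (b \<star> v \<star> f)" by (simp add: conv_assoc)
  also have "\<dots> = a \<star> rho b v \<star> f" unfolding act_f[OF b] by (simp add: conv_assoc)
  finally show "a \<star> b \<star> v \<star> f = rho a (rho b v) \<star> f" unfolding act_f[OF a] .
qed

lemma rho_eps: "v \<in> E \<Longrightarrow> rho \<epsilon> v = v"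
  by (intro rho_eqI) (simp_all add: A_closed E_eps)

lemma rho_f: "v \<in> E \<Longrightarrow> rho f v = (1 / of_nat n) *\<^sub>Q (\<Sum>t\<in>T. conjugate t v)"
proof (rule rho_eqI[OF f_in_A])
  assume v: "v \<in> E"
  show "(1 / of_nat n) *\<^sub>Q (\<Sum>t\<in>T. conjugate t v) \<in> E" by (intro E_closed E_conj_N[OF v] T_in_N)
  have "\<delta> t \<star> \<epsilon> \<star> v \<star> f = conjugate t v \<star> f" if t: "t \<in> T" for t
  proof -
    have "\<delta> t \<star> \<epsilon> \<star> v \<star> f = \<delta> t \<star> (\<epsilon> \<star> v) \<star> f" by (simp add: conv_assoc)
    also have "\<dots> = conjugate t v \<star> (\<delta> t \<star> f)" by (simp only: E_eps(2)[OF v] delta_conv_swap[OF T_in_G[OF t], of v] conv_assoc)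
    finally show ?thesis unfolding delta_T_f[OF t] .
  qed
  then show "f \<star> v \<star> f = (1 / of_nat n) *\<^sub>Q (\<Sum>t\<in>T. conjugate t v) \<star> f"
    by (subst f_eq) (simp add: conv_linear QV.scale_sum_right cong: sum.cong)
qed

end

section \<open>Normal bases\<close>

context finite_group
begin

lemma alg_component_simps [simp]:
  "a \<otimes>\<^bsub>alg_component G S c\<^esub> b = a \<star> b" "a \<oplus>\<^bsub>alg_component G S c\<^esub> b = a + b"
  "\<zero>\<^bsub>alg_component G S c\<^esub> = 0" "\<one>\<^bsub>alg_component G S c\<^esub> = c"
  by (simp_all add: alg_component_def group_algebra_def plus_fun_def zero_fun_def)

lemma alg_component_add: "ring.add (alg_component G S c) = (\<lambda>a b g. a g + b g)"
  and alg_component_zero: "ring.zero (alg_component G S c) = (\<lambda>g. 0)"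
  by (simp_all add: alg_component_def group_algebra_def)

lemma abelian_group_alg_component:
  assumes "\<And>a b. a \<in> carrier (alg_component G S c) \<Longrightarrow> b \<in> carrier (alg_component G S c) \<Longrightarrow> a + b \<in> carrier (alg_component G S c)"
    and "0 \<in> carrier (alg_component G S c)"
    and "\<And>a. a \<in> carrier (alg_component G S c) \<Longrightarrow> - a \<in> carrier (alg_component G S c)"
  shows "abelian_group (alg_component G S c)"
proof (rule abelian_groupI)
  fix x assume x: "x \<in> carrier (alg_component G S c)"
  show "\<exists>z\<in>carrier (alg_component G S c). z \<oplus>\<^bsub>alg_component G S c\<^esub> x = \<zero>\<^bsub>alg_component G S c\<^esub>"
    using assms(3)[OF x] by (intro bexI[of _ "- x"]) (simp_all only: alg_component_simps left_minus)
qed (simp_all only: alg_component_simps assms add.assoc add_0_left, simp only: add.commute)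

end

context strong_shoda
begin

lemma QHe_field: "field (QHe G H K)"
proof (rule cring.cring_fieldI2)
  show "cring (QHe G H K)"
  proof (rule cringI)
    show "abelian_group (QHe G H K)"
      by (rule abelian_group_alg_component) (simp_all add: QHe_carrier E_closed)
    show "comm_monoid (QHe G H K)"
      by (rule comm_monoidI) (auto simp: QHe_carrier E_closed conv_assoc E_eps E_commute)
  qed (simp add: conv_linear)
  show "\<zero>\<^bsub>QHe G H K\<^esub> \<noteq> \<one>\<^bsub>QHe G H K\<^esub>" using eps_nonzero by simp
  show "\<exists>b\<in>carrier (QHe G H K). a \<otimes>\<^bsub>QHe G H K\<^esub> b = \<one>\<^bsub>QHe G H K\<^esub>"
    if "a \<in> carrier (QHe G H K)" "a \<noteq> \<zero>\<^bsub>QHe G H K\<^esub>" for a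
    using E_inverse[of a] that by (simp add: QHe_carrier)
qed

lemma F_subfield: "subfield F (QHe G H K)"
proof -
  interpret R: field "QHe G H K" by (rule QHe_field)
  have minus: "\<ominus>\<^bsub>QHe G H K\<^esub> a = - a" if "a \<in> E" for a
    using E_closed(8)[OF that] that by (intro R.minus_equality) (simp_all add: QHe_carrier)
  have sr: "subring F (QHe G H K)"
    using F_closed F_E minus by (intro R.subringI) (auto simp: QHe_carrier)
  show ?thesis
  proof (rule R.subfieldI)
    show "subcring F (QHe G H K)"
      by (rule R.subcringI[OF sr]) (simp add: E_commute F_E)
    show "Units (QHe G H K\<lparr>carrier := F\<rparr>) = F - {\<zero>\<^bsub>QHe G H K\<^esub>}"
    proof (intro equalityI subsetI)
      fix a assume "a \<in> Units (QHe G H K\<lparr>carrier := F\<rparr>)"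
      then have "a \<in> F" "\<exists>b. b \<star> a = \<epsilon>" by (auto simp: Units_def)
      then show "a \<in> F - {\<zero>\<^bsub>QHe G H K\<^esub>}" using eps_nonzero by auto
    next
      fix a assume a: "a \<in> F - {\<zero>\<^bsub>QHe G H K\<^esub>}"
      then obtain b where b: "b \<in> F" "a \<star> b = \<epsilon>" using F_inverse[of a] by auto
      then have "b \<star> a = \<epsilon>" using E_commute[of a b] F_E a by auto
      then show "a \<in> Units (QHe G H K\<lparr>carrier := F\<rparr>)" using a b by (auto simp: Units_def)
    qed
  qed
qed

lemma QHe_combine:
  assumes "length Ks = length Us"
  shows "ring.combine (QHe G H K) Ks Us = (\<Sum>i<length Us. Ks ! i \<star> Us ! i)"
proof -
  interpret R: field "QHe G H K" by (rule QHe_field)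
  show ?thesis using assms
  proof (induction Ks Us rule: list_induct2)
    case Nil
    show ?case by (simp only: R.combine.simps alg_component_simps list.size lessThan_0 sum.empty)
  next
    case (Cons k Ks u Us)
    have "(\<Sum>i<length (u # Us). (k # Ks) ! i \<star> (u # Us) ! i) = k \<star> u + (\<Sum>i<length Us. Ks ! i \<star> Us ! i)"
      by (simp only: list.size add_0_right plus_1_eq_Suc add_Suc_right One_nat_def sum.lessThan_Suc_shift nth_Cons_0 nth_Cons_Suc)
    then show ?case by (simp only: R.combine.simps alg_component_simps Cons.IH)
  qed
qed

lemma conj_inj_E: "t \<in> N \<Longrightarrow> u \<in> E \<Longrightarrow> v \<in> E \<Longrightarrow> conjugate t u = conjugate t v \<Longrightarrow> u = v"
  using conjugate_conjugate[of "inv t" t] memG(1) conjugate_one A_on_G E_subset_A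
  by (metis inv_closed l_inv)

lemma conj_inv_E: "t \<in> N \<Longrightarrow> v \<in> E \<Longrightarrow> conjugate t (conjugate (inv t) v) = v"
  "t \<in> N \<Longrightarrow> v \<in> E \<Longrightarrow> conjugate (inv t) (conjugate t v) = v"
  using conjugate_conjugate[of t "inv t"] conjugate_conjugate[of "inv t" t] memG(1) conjugate_one A_on_G E_subset_A
  by simp_all

lemma Gal_conj:
  assumes \<sigma>: "\<sigma> \<in> Gal (QHe G H K) F" and t: "t \<in> N"
  shows "(\<lambda>v\<in>E. conjugate t (\<sigma> v)) \<in> Gal (QHe G H K) F"
proof -
  have hom: "\<sigma> \<in> ring_hom (QHe G H K) (QHe G H K)" and bij: "bij_betw \<sigma> E E" and fix_F: "\<And>x. x \<in> F \<Longrightarrow> \<sigma> x = x"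
    using \<sigma> by (auto simp: Gal_def ring_iso_def QHe_carrier)
  have \<sigma>E: "\<sigma> v \<in> E" if "v \<in> E" for v using bij that by (auto simp: bij_betw_def)
  have "bij_betw (conjugate t) E E"
    by (rule bij_betw_byWitness[where f' = "conjugate (inv t)"])
       (use E_conj_N t N_closed conj_inv_E in auto)
  then have "bij_betw (\<lambda>v. conjugate t (\<sigma> v)) E E" using bij_betw_trans[OF bij] by (simp add: comp_def)
  then have b: "bij_betw (\<lambda>v\<in>E. conjugate t (\<sigma> v)) E E" by (simp cong: bij_betw_cong)
  have "(\<lambda>v\<in>E. conjugate t (\<sigma> v)) \<in> ring_hom (QHe G H K) (QHe G H K)"
  proof (rule ring_hom_memI)
    fix a c assume "a \<in> carrier (QHe G H K)" "c \<in> carrier (QHe G H K)"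
    then have ac: "a \<in> E" "c \<in> E" by (simp_all add: QHe_carrier)
    have "\<sigma> (a \<star> c) = \<sigma> a \<star> \<sigma> c" "\<sigma> (a + c) = \<sigma> a + \<sigma> c"
      using ring_hom_mult[OF hom, of a c] ring_hom_add[OF hom, of a c] ac by (simp_all add: QHe_carrier)
    then show "(\<lambda>v\<in>E. conjugate t (\<sigma> v)) (a \<otimes>\<^bsub>QHe G H K\<^esub> c) = (\<lambda>v\<in>E. conjugate t (\<sigma> v)) a \<otimes>\<^bsub>QHe G H K\<^esub> (\<lambda>v\<in>E. conjugate t (\<sigma> v)) c"
      "(\<lambda>v\<in>E. conjugate t (\<sigma> v)) (a \<oplus>\<^bsub>QHe G H K\<^esub> c) = (\<lambda>v\<in>E. conjugate t (\<sigma> v)) a \<oplus>\<^bsub>QHe G H K\<^esub> (\<lambda>v\<in>E. conjugate t (\<sigma> v)) c"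
      using ac E_closed conjugate_mult[OF memG(1)[OF t]] by (simp_all add: conjugate_linear)
  next
    fix a assume "a \<in> carrier (QHe G H K)"
    then show "(\<lambda>v\<in>E. conjugate t (\<sigma> v)) a \<in> carrier (QHe G H K)" using \<sigma>E E_conj_N t by (simp add: QHe_carrier)
  next
    show "(\<lambda>v\<in>E. conjugate t (\<sigma> v)) \<one>\<^bsub>QHe G H K\<^esub> = \<one>\<^bsub>QHe G H K\<^esub>"
      using ring_hom_one[OF hom] conj_eps[OF t] E_closed(6) by simp
  qed
  then show ?thesis using b fix_F F_conj[OF _ t] F_E by (simp add: Gal_def ring_iso_def QHe_carrier)
qed

lemma Gal_id: "(\<lambda>v\<in>E. v) \<in> Gal (QHe G H K) F"
proof -
  have "(\<lambda>v\<in>E. v) \<in> ring_hom (QHe G H K) (QHe G H K)"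
    by (rule ring_hom_memI) (simp_all add: QHe_carrier E_closed)
  moreover have "bij_betw (\<lambda>v\<in>E. v) E E" by (simp add: bij_betw_def inj_on_def)
  ultimately show ?thesis using F_E by (simp add: Gal_def ring_iso_def QHe_carrier)
qed

end

locale normal_basis = split_strong_shoda +
  fixes w :: "'a \<Rightarrow> rat" and bs :: "('a \<Rightarrow> rat) list"
  assumes w_normal: "normal_element (QHe G H K) (fixed_field G H K) w"
    and bs_distinct: "distinct bs"
    and bs_set: "set bs = (\<lambda>\<sigma>. \<sigma> w) ` Gal (QHe G H K) (fixed_field G H K)"
begin

text \<open>A normal element comes with some ordering of its conjugates that is a basis. Independence and span depend
only on the set of conjugates, so the given ordering is a basis too.\<close>

lemma bs_basis: "ring.independent (QHe G H K) F bs" "ring.Span (QHe G H K) F bs = E" "set bs \<subseteq> E"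
proof -
  interpret R: field "QHe G H K" by (rule QHe_field)
  interpret EA: embedded_algebra F "QHe G H K" using F_subfield R.ring_axioms by (intro embedded_algebra.intro)
  obtain bs' where bs': "set bs' = set bs" "R.independent F bs'" "R.Span F bs' = E"
    using w_normal bs_set by (auto simp: normal_element_def ordered_basis_def fixed_field_eq QHe_carrier)
  have sub: "set bs' \<subseteq> carrier (QHe G H K)" using R.independent_in_carrier[OF bs'(2)] .
  have "distinct bs'" using R.independent_distinct[OF F_subfield bs'(2)] .
  then have "length bs' = length bs" using bs'(1) bs_distinct by (metis distinct_card)
  then show "R.independent F bs" using R.independent_same_set[OF F_subfield bs'(1)] bs'(2) by blast
  show "R.Span F bs = E" using R.Span_same_set[OF F_subfield sub bs'(1)] bs'(3) by simp
  show "set bs \<subseteq> E" using sub bs'(1) by (simp add: QHe_carrier)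
qed

definition basis_set :: "('a \<Rightarrow> rat) set" where "basis_set = set bs"

lemma fin_basis_set: "finite basis_set" and basis_set_E: "b \<in> basis_set \<Longrightarrow> b \<in> E"
  using bs_basis(3) by (auto simp: basis_set_def)

lemma sum_basis_set: "(\<Sum>b\<in>basis_set. g b) = (\<Sum>i<length bs. g (bs ! i))"
  unfolding basis_set_def by (rule sum.reindex_bij_betw[OF bij_betw_nth[OF bs_distinct refl refl], symmetric])

lemma bs_independent:
  assumes c: "\<And>i. i < length bs \<Longrightarrow> c i \<in> F" and z: "(\<Sum>i<length bs. c i \<star> bs ! i) = 0" and i: "i < length bs"
  shows "c i = 0"
proof -
  interpret R: field "QHe G H K" by (rule QHe_field)
  let ?Ks = "map c [0..<length bs]"
  have "R.combine ?Ks bs = (\<Sum>i<length bs. c i \<star> bs ! i)"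
    unfolding QHe_combine[of ?Ks bs, simplified] by (rule sum.cong[OF refl]) simp
  then have "R.combine ?Ks bs = \<zero>\<^bsub>QHe G H K\<^esub>" unfolding z by (simp only: alg_component_simps)
  then have "set (take (length bs) ?Ks) \<subseteq> {\<zero>\<^bsub>QHe G H K\<^esub>}"
    using c by (intro R.independent_imp_trivial_combine[OF F_subfield bs_basis(1)]) auto
  moreover have "c i \<in> set (take (length bs) ?Ks)" using i by simp
  ultimately have "c i \<in> {\<zero>\<^bsub>QHe G H K\<^esub>}" by (rule subsetD)
  then show ?thesis by simp
qed

lemma bs_span:
  assumes v: "v \<in> E" shows "\<exists>c. (\<forall>i<length bs. c i \<in> F) \<and> v = (\<Sum>i<length bs. c i \<star> bs ! i)"
proof -
  interpret R: field "QHe G H K" by (rule QHe_field)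
  have "v \<in> R.Span F bs" using v bs_basis(2) by simp
  then obtain Ks where Ks: "set Ks \<subseteq> F" "length Ks = length bs" "v = R.combine Ks bs"
    using R.Span_mem_iff_length_version[OF F_subfield] bs_basis(3) by (auto simp: QHe_carrier)
  show ?thesis
    by (rule exI[of _ "\<lambda>i. Ks ! i"]) (use Ks QHe_combine[OF Ks(2)] nth_mem in auto)
qed

lemma basis_set_independent:
  assumes c: "\<And>b. b \<in> basis_set \<Longrightarrow> c b \<in> F" and z: "(\<Sum>b\<in>basis_set. c b \<star> b) = 0" and b: "b \<in> basis_set"
  shows "c b = 0"
proof -
  obtain i where i: "i < length bs" "b = bs ! i" using b by (auto simp: basis_set_def in_set_conv_nth)
  have "c (bs ! i) = 0"
  proof (rule bs_independent[of "\<lambda>i. c (bs ! i)"])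
    show "(\<Sum>i<length bs. c (bs ! i) \<star> bs ! i) = 0" using z unfolding sum_basis_set .
  qed (use c i in \<open>simp_all add: basis_set_def\<close>)
  then show ?thesis using i by simp
qed

lemma w_basis_set: "w \<in> basis_set"
proof -
  have "w \<in> E" using w_normal by (simp add: normal_element_def QHe_carrier)
  then have "w = (\<lambda>v\<in>E. v) w" by simp
  then show ?thesis unfolding basis_set_def bs_set fixed_field_eq using Gal_id by (rule image_eqI)
qed

lemma basis_set_conj: assumes b: "b \<in> basis_set" and t: "t \<in> N" shows "conjugate t b \<in> basis_set"
proof -
  obtain \<sigma> where s: "\<sigma> \<in> Gal (QHe G H K) F" "b = \<sigma> w" using b by (auto simp: basis_set_def bs_set fixed_field_eq)
  have "w \<in> E" using w_normal by (simp add: normal_element_def QHe_carrier)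
  then have "conjugate t b = (\<lambda>v\<in>E. conjugate t (\<sigma> v)) w" using s(2) by simp
  then show ?thesis unfolding basis_set_def bs_set fixed_field_eq using Gal_conj[OF s(1) t] by (rule image_eqI)
qed

definition orbit_of :: "('a \<Rightarrow> rat) \<Rightarrow> ('a \<Rightarrow> rat) set" where "orbit_of u = (\<lambda>t. conjugate t u) ` N"

lemma orbit_sub: "u \<in> basis_set \<Longrightarrow> orbit_of u \<subseteq> basis_set" using basis_set_conj by (auto simp: orbit_of_def)

lemma orbit_self: "u \<in> basis_set \<Longrightarrow> u \<in> orbit_of u"
proof -
  assume "u \<in> basis_set"
  then have "u = conjugate \<one> u" using conjugate_one A_on_G E_subset_A basis_set_E by simp
  then show ?thesis unfolding orbit_of_def using subgroup.one_closed[OF sub_N] by (rule image_eqI)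
qed

lemma orbit_conj: assumes u: "u \<in> basis_set" and t: "t \<in> N" shows "conjugate t ` orbit_of u = orbit_of u"
proof -
  have c: "conjugate s (conjugate r u) = conjugate (s \<otimes> r) u" if "s \<in> N" "r \<in> N" for s r
    using conjugate_conjugate memG(1) that by blast
  show ?thesis
  proof (intro equalityI subsetI)
    fix v assume "v \<in> conjugate t ` orbit_of u"
    then obtain r where "r \<in> N" "v = conjugate t (conjugate r u)" by (auto simp: orbit_of_def)
    then show "v \<in> orbit_of u" unfolding orbit_of_def using c[OF t] N_closed(1)[OF t] by auto
  next
    fix v assume "v \<in> orbit_of u"
    then obtain r where r: "r \<in> N" "v = conjugate r u" by (auto simp: orbit_of_def)
    then have vE: "v \<in> E" using E_conj_N basis_set_E u by blast
    have "conjugate (inv t) v = conjugate (inv t \<otimes> r) u" using r c N_closed(2)[OF t] by simp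
    then have "conjugate (inv t) v \<in> orbit_of u" unfolding orbit_of_def using N_closed t r by auto
    then show "v \<in> conjugate t ` orbit_of u" using conj_inv_E(1)[OF t vE] by (metis image_eqI)
  qed
qed

lemma orbit_sum_F: assumes u: "u \<in> basis_set" shows "(\<Sum>b\<in>orbit_of u. b) \<in> F"
proof -
  have "conjugate t (\<Sum>b\<in>orbit_of u. b) = (\<Sum>b\<in>orbit_of u. b)" if t: "t \<in> N" for t
  proof -
    have inj: "inj_on (conjugate t) (orbit_of u)"
      using conj_inj_E[OF t] orbit_sub[OF u] basis_set_E by (intro inj_onI) blast
    have "conjugate t (\<Sum>b\<in>orbit_of u. b) = (\<Sum>b\<in>orbit_of u. conjugate t b)" by (rule conjugate_linear)
    also have "\<dots> = (\<Sum>b\<in>conjugate t ` orbit_of u. b)" by (simp only: sum.reindex[OF inj] o_def)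
    finally show ?thesis by (simp only: orbit_conj[OF u t])
  qed
  moreover have "(\<Sum>b\<in>orbit_of u. b) \<in> E" using orbit_sub[OF u] basis_set_E by (intro E_closed(7)) blast
  ultimately show ?thesis by (simp add: F_def)
qed

text \<open>The Galois group of \<open>\<rat>H\<epsilon>\<close> over \<open>F\<close> might a priori be larger than the image of \<open>N\<close>. The sums \<open>s\<close> and \<open>s'\<close>
over two different \<open>N\<close>-orbits of basis elements would lie in \<open>F\<close>, and \<open>s' s - s s' = 0\<close> would be a
linear relation over \<open>F\<close> between the elements of the two orbits.\<close>

lemma single_orbit: "orbit_of w = basis_set"
proof (rule ccontr)
  assume "orbit_of w \<noteq> basis_set"
  then obtain u where u: "u \<in> basis_set" "u \<notin> orbit_of w" using orbit_sub[OF w_basis_set] by blast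
  let ?O = "orbit_of w" and ?U = "orbit_of u"
  have disj: "?O \<inter> ?U = {}"
  proof (rule ccontr)
    assume "?O \<inter> ?U \<noteq> {}"
    then obtain v where v': "v \<in> ?O" "v \<in> ?U" by blast
    then obtain r where v: "v \<in> ?O" "r \<in> N" "v = conjugate r u" unfolding orbit_of_def[of u] by blast
    then have "u = conjugate (inv r) v" using conj_inv_E(2) basis_set_E u by simp
    then have "u \<in> conjugate (inv r) ` ?O" using v(1) by blast
    then show False using u(2) orbit_conj[OF w_basis_set N_closed(2)[OF v(2)]] by simp
  qed
  define s where "s = (\<Sum>b\<in>?O. b)"
  define s' where "s' = (\<Sum>b\<in>?U. b)"
  have sF: "s \<in> F" "s' \<in> F" unfolding s_def s'_def using orbit_sum_F w_basis_set u(1) by blast+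
  have sub: "?O \<subseteq> basis_set" "?U \<subseteq> basis_set" using orbit_sub w_basis_set u(1) by blast+
  have split: "(\<Sum>b\<in>basis_set. (if b \<in> ?O then p else if b \<in> ?U then q else 0) \<star> b) = p \<star> s + q \<star> s'" for p q
  proof -
    have "(\<Sum>b\<in>basis_set. (if b \<in> ?O then p else if b \<in> ?U then q else 0) \<star> b) =
      (\<Sum>b\<in>?O \<union> ?U. (if b \<in> ?O then p else if b \<in> ?U then q else 0) \<star> b)"
      using fin_basis_set sub by (intro sum.mono_neutral_right) auto
    also have "\<dots> = (\<Sum>b\<in>?O. (if b \<in> ?O then p else if b \<in> ?U then q else 0) \<star> b) +
        (\<Sum>b\<in>?U. (if b \<in> ?O then p else if b \<in> ?U then q else 0) \<star> b)"
      using sub fin_basis_set finite_subset disj by (intro sum.union_disjoint) blast+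
    also have "(\<Sum>b\<in>?O. (if b \<in> ?O then p else if b \<in> ?U then q else 0) \<star> b) = p \<star> s"
      unfolding s_def conv_sum_right by (rule sum.cong[OF refl]) auto
    also have "(\<Sum>b\<in>?U. (if b \<in> ?O then p else if b \<in> ?U then q else 0) \<star> b) = q \<star> s'"
      unfolding s'_def conv_sum_right using disj by (intro sum.cong[OF refl]) auto
    finally show ?thesis .
  qed
  have "s' \<star> s + (- s) \<star> s' = 0" using E_commute[OF F_E[OF sF(1)] F_E[OF sF(2)]] by (simp add: conv_linear)
  then have zero: "(\<Sum>b\<in>basis_set. (if b \<in> ?O then s' else if b \<in> ?U then - s else 0) \<star> b) = 0"
    unfolding split .
  have "(\<lambda>b. if b \<in> ?O then s' else if b \<in> ?U then - s else 0) w = 0"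
    by (rule basis_set_independent[OF _ zero w_basis_set]) (use sF F_closed(1,8) in simp)
  then have "s' = 0" using orbit_self[OF w_basis_set] by simp
  then have "0 \<star> s + \<epsilon> \<star> s' = 0" by (simp only: conv_zero_left conv_zero_right add_0_left)
  then have zero: "(\<Sum>b\<in>basis_set. (if b \<in> ?O then 0 else if b \<in> ?U then \<epsilon> else 0) \<star> b) = 0"
    unfolding split .
  have "(\<lambda>b. if b \<in> ?O then 0 else if b \<in> ?U then \<epsilon> else 0) u = 0"
    by (rule basis_set_independent[OF _ zero u(1)]) (use F_closed(1,6) in simp)
  then show False using u(2) orbit_self[OF u(1)] eps_nonzero by simp
qed

text \<open>The action of \<open>N/H\<close> on the basis is regular. It is transitive because there is one orbit; if \<open>s\<close> and \<open>t\<close> agree at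
one basis element, they agree at all of them because the action is commutative, hence on all of
\<open>\<rat>H\<epsilon>\<close>. In particular \<open>\<rat>H\<epsilon>\<close> has dimension \<open>[N : H]\<close> over \<open>F\<close>.\<close>

lemma T_basis_bij: assumes b: "b \<in> basis_set" shows "bij_betw (\<lambda>t. conjugate t b) T basis_set"
proof -
  have wE: "w \<in> E" using basis_set_E w_basis_set .
  have inj: "inj_on (\<lambda>t. conjugate t w) T"
  proof (rule inj_onI, rule ccontr)
    fix s t assume st: "s \<in> T" "t \<in> T" "conjugate s w = conjugate t w" "s \<noteq> t"
    then obtain v where v: "v \<in> E" "conjugate s v \<noteq> conjugate t v" using separate by blast
    have N: "s \<in> N" "t \<in> N" using T_in_N st by blast+
    have bst: "conjugate s b = conjugate t b" if bX: "b \<in> basis_set" for b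
    proof -
      obtain c where c: "c \<in> N" "b = conjugate c w" using bX unfolding single_orbit[symmetric] orbit_of_def by blast
      then show ?thesis using conj_commute_E[OF N(1) c(1) wE] conj_commute_E[OF N(2) c(1) wE] st(3) by simp
    qed
    obtain c where c: "\<And>i. i < length bs \<Longrightarrow> c i \<in> F" "v = (\<Sum>i<length bs. c i \<star> bs ! i)"
      using bs_span[OF v(1)] by blast
    have conj_v: "conjugate r v = (\<Sum>i<length bs. c i \<star> conjugate r (bs ! i))" if r: "r \<in> N" for r
      unfolding c(2) conjugate_linear by (rule sum.cong[OF refl]) (use r c(1) F_conj conjugate_mult[OF memG(1)[OF r]] in auto)
    have "conjugate s v = conjugate t v"
      unfolding conj_v[OF N(1)] conj_v[OF N(2)] by (rule sum.cong[OF refl]) (use bst basis_set_def in simp)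
    then show False using v(2) by simp
  qed
  have "(\<lambda>t. conjugate t w) ` T = basis_set"
  proof (intro equalityI subsetI)
    fix b assume "b \<in> basis_set"
    then obtain c where c: "c \<in> N" "b = conjugate c w" unfolding single_orbit[symmetric] orbit_of_def by blast
    obtain t where t: "t \<in> T" "c \<otimes> inv t \<in> H" using T_exists[OF c(1)] .
    have G: "c \<in> carrier G" "t \<in> carrier G" using memG(1) c(1) T_in_G t(1) by blast+
    have "conjugate (c \<otimes> inv t) (conjugate t w) = conjugate c w"
      using conjugate_conjugate[of "c \<otimes> inv t" t w] G by (simp add: m_assoc)
    then have "b = conjugate t w" using conj_H_E[OF t(2) E_conj_N[OF wE T_in_N[OF t(1)]]] c(2) by simp
    then show "b \<in> (\<lambda>t. conjugate t w) ` T" using t(1) by blast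
  qed (use basis_set_conj w_basis_set T_in_N in blast)
  with inj have bw: "bij_betw (\<lambda>t. conjugate t w) T basis_set" by (simp add: bij_betw_def)
  obtain c where c: "c \<in> N" "b = conjugate c w" using b unfolding single_orbit[symmetric] orbit_of_def by blast
  have "bij_betw (conjugate c) basis_set basis_set"
    using orbit_conj[OF w_basis_set c(1)] single_orbit conj_inj_E[OF c(1)] basis_set_E by (auto simp: bij_betw_def inj_on_def)
  then have "bij_betw (\<lambda>t. conjugate c (conjugate t w)) T basis_set" using bij_betw_trans[OF bw] by (simp add: comp_def)
  moreover have "conjugate t b = conjugate c (conjugate t w)" if "t \<in> T" for t
    using conj_commute_E[OF T_in_N[OF that] c(1) wE] c(2) by simp
  ultimately show ?thesis by (simp cong: bij_betw_cong)
qed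

lemma length_bs: "length bs = n"
  using bij_betw_same_card[OF T_basis_bij[OF w_basis_set]] distinct_card[OF bs_distinct] by (simp add: n_def basis_set_def)

abbreviation \<beta> :: "nat \<Rightarrow> 'a \<Rightarrow> rat" where "\<beta> i \<equiv> bs ! i"

lemma \<beta>_basis_set: "i < n \<Longrightarrow> \<beta> i \<in> basis_set" using length_bs by (simp add: basis_set_def)
lemma \<beta>_E: "i < n \<Longrightarrow> \<beta> i \<in> E" using \<beta>_basis_set basis_set_E by blast

lemmas \<beta>_independent = bs_independent[unfolded length_bs]
lemmas \<beta>_span = bs_span[unfolded length_bs]

text \<open>The elements of \<open>\<rat>H\<epsilon>\<close> whose coordinates are the columns of \<open>P\<close>.\<close>

definition p :: "nat \<Rightarrow> 'a \<Rightarrow> rat" where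
  "p j = (if j = 0 then (\<Sum>i<n. \<beta> i) else \<beta> 0 - \<beta> j)"

lemma p0_eq: "p 0 = (\<Sum>b\<in>basis_set. b)"
  using sum_basis_set[of "\<lambda>b. b"] by (simp add: p_def length_bs)

lemma p_E: "j < n \<Longrightarrow> p j \<in> E"
  using n_pos \<beta>_E E_closed(3)[of "\<beta> 0" "\<beta> j"] E_closed(7)[of "{..<n}" "\<beta>"] by (auto simp: p_def)

lemma sum_single: "j < n \<Longrightarrow> (\<Sum>i<n. (if i = j then q else 0) \<star> \<beta> i) = q \<star> \<beta> j"
proof -
  assume j: "j < n"
  have "(\<Sum>i<n. (if i = j then q else 0) \<star> \<beta> i) = (\<Sum>i<n. if i = j then q \<star> \<beta> j else 0)"
    by (intro sum.cong[OF refl]) auto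
  then show ?thesis using j by simp
qed

lemma p_nonzero: assumes j: "j < n" shows "p j \<noteq> 0"
proof
  assume z: "p j = 0"
  show False
  proof (cases "j = 0")
    case True
    have "(\<Sum>i<n. \<epsilon> \<star> \<beta> i) = (\<Sum>i<n. \<beta> i)" by (rule sum.cong[OF refl]) (simp add: E_eps(2) \<beta>_E)
    also have "\<dots> = 0" using z True unfolding p_def by (simp only: if_True simp_thms)
    finally have "\<epsilon> = 0" using \<beta>_independent[of "\<lambda>_. \<epsilon>" 0] F_closed(6) n_pos by blast
    then show False using eps_nonzero by simp
  next
    case False
    then have "\<beta> 0 = \<beta> j" using z by (simp add: p_def)
    then show False using False nth_eq_iff_index_eq[OF bs_distinct] length_bs j n_pos by auto
  qed
qed

lemma \<beta>_p: "\<beta> 0 = (1 / of_nat n) *\<^sub>Q (\<Sum>j<n. p j)" "0 < j \<Longrightarrow> \<beta> j = \<beta> 0 - p j"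
proof -
  show "0 < j \<Longrightarrow> \<beta> j = \<beta> 0 - p j" by (simp add: p_def)
  have "(\<Sum>j<n. p j) = of_nat n *\<^sub>Q \<beta> 0"
  proof
    fix g
    obtain m where m: "n = Suc m" using n_pos by (cases n) auto
    have "(\<Sum>j<n. p j) g = p 0 g + (\<Sum>j<m. p (Suc j) g)"
      unfolding sum_fun_apply m by (rule sum.lessThan_Suc_shift)
    also have "p 0 g = \<beta> 0 g + (\<Sum>j<m. \<beta> (Suc j) g)"
      unfolding p_def m by (simp only: if_True simp_thms sum_fun_apply sum.lessThan_Suc_shift plus_fun_apply)
    also have "(\<Sum>j<m. p (Suc j) g) = of_nat m * \<beta> 0 g - (\<Sum>j<m. \<beta> (Suc j) g)"
      by (simp add: p_def sum_subtractf)
    finally show "(\<Sum>j<n. p j) g = (of_nat n *\<^sub>Q \<beta> 0) g" by (simp add: m algebra_simps)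
  qed
  then show "\<beta> 0 = (1 / of_nat n) *\<^sub>Q (\<Sum>j<n. p j)" using n_pos by (simp add: fun_eq_iff)
qed

lemma p_span:
  assumes v: "v \<in> E" shows "\<exists>c. (\<forall>i<n. c i \<in> F) \<and> v = (\<Sum>i<n. c i \<star> p i)"
proof -
  let ?P = "\<lambda>v. \<exists>c. (\<forall>i<n. c i \<in> F) \<and> v = (\<Sum>i<n. c i \<star> p i)"
  have P_add: "?P (a + b)" if "?P a" "?P b" for a b
  proof -
    obtain c d where "\<forall>i<n. c i \<in> F" "a = (\<Sum>i<n. c i \<star> p i)" "\<forall>i<n. d i \<in> F" "b = (\<Sum>i<n. d i \<star> p i)"
      using \<open>?P a\<close> \<open>?P b\<close> by blast
    then show ?thesis using F_closed(2)
      by (intro exI[of _ "\<lambda>i. c i + d i"]) (simp add: conv_linear sum.distrib)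
  qed
  have P_mult: "?P (l \<star> a)" if "l \<in> F" "?P a" for l a
  proof -
    obtain c where c: "\<forall>i<n. c i \<in> F" "a = (\<Sum>i<n. c i \<star> p i)" using \<open>?P a\<close> by blast
    have "l \<star> a = (\<Sum>i<n. (l \<star> c i) \<star> p i)" unfolding c(2) conv_sum_right conv_assoc ..
    moreover have "\<forall>i<n. l \<star> c i \<in> F" using c(1) \<open>l \<in> F\<close> F_closed(5) by simp
    ultimately show ?thesis by (intro exI[of _ "\<lambda>i. l \<star> c i"] conjI)
  qed
  have P_p: "?P (p j)" if j: "j < n" for j
  proof -
    have "(\<Sum>i<n. (if i = j then \<epsilon> else 0) \<star> p i) = (\<Sum>i<n. if i = j then p j else 0)"
      using E_eps(2)[OF p_E[OF j]] by (intro sum.cong[OF refl]) auto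
    also have "\<dots> = p j" using j by simp
    finally show ?thesis using F_closed(1,6) by (intro exI[of _ "\<lambda>i. if i = j then \<epsilon> else 0"]) auto
  qed
  have scale: "q *\<^sub>Q a = (q *\<^sub>Q \<epsilon>) \<star> a" if "a \<in> E" for q a using E_eps(2)[OF that] by (simp add: conv_linear)
  have P_sum: "?P (\<Sum>i\<in>I. a i)" if "finite I" "\<And>i. i \<in> I \<Longrightarrow> ?P (a i)" for I :: "nat set" and a
    using that
  proof (induction I)
    case empty
    have "(\<Sum>i<n. 0 \<star> p i) = 0" by (rule sum.neutral) simp
    then show ?case unfolding sum.empty by (intro exI[of _ "\<lambda>_. 0"] conjI allI impI F_closed(1)) (rule sym)
  next
    case (insert i I)
    then show ?case unfolding sum.insert[OF insert(1,2)] by (intro P_add) blast+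
  qed
  have b0: "?P (\<beta> 0)"
  proof -
    have "\<beta> 0 = ((1 / of_nat n) *\<^sub>Q \<epsilon>) \<star> (\<Sum>j<n. p j)"
      using \<beta>_p(1) scale[OF E_closed(7)[of "{..<n}" p]] p_E by simp
    moreover have "?P (((1 / of_nat n) *\<^sub>Q \<epsilon>) \<star> (\<Sum>j<n. p j))"
      using F_closed(4,6) by (intro P_mult P_sum P_p) auto
    ultimately show ?thesis by simp
  qed
  have P_\<beta>: "?P (\<beta> j)" if j: "j < n" for j
  proof (cases "j = 0")
    case False
    have "\<beta> j = \<beta> 0 + ((-1) *\<^sub>Q \<epsilon>) \<star> p j"
      using \<beta>_p(2)[of j] False scale[OF p_E[OF j], of "-1"] by (simp add: fun_eq_iff)
    then show ?thesis by (simp only: P_add[OF b0 P_mult[OF F_closed(4)[OF F_closed(6)] P_p[OF j]]])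
  qed (use b0 in simp)
  obtain c where c: "\<forall>i<n. c i \<in> F" "v = (\<Sum>i<n. c i \<star> \<beta> i)" using \<beta>_span[OF v] by blast
  show ?thesis unfolding c(2) using c(1) P_\<beta> by (intro P_sum P_mult) auto
qed

lemma rho_f_\<beta>: assumes j: "j < n" shows "rho f (\<beta> j) = (1 / of_nat n) *\<^sub>Q p 0"
proof -
  have "(\<Sum>t\<in>T. conjugate t (\<beta> j)) = p 0"
    unfolding p0_eq by (rule sum.reindex_bij_betw[OF T_basis_bij[OF \<beta>_basis_set[OF j]]])
  then show ?thesis using rho_f[OF \<beta>_E[OF j]] by simp
qed

text \<open>\<open>f\<close> sends every basis element to the same multiple of the trace \<open>p 0\<close>, so it kills differences of basis
elements.\<close>

lemma rho_f_p: assumes j: "j < n" shows "rho f (p j) = (if j = 0 then p 0 else 0)"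
proof (cases "j = 0")
  case True
  have "rho f (p 0) = (\<Sum>i<n. rho f (\<beta> i))" by (simp add: p_def rho_sum)
  also have "\<dots> = (\<Sum>i<n. (1 / of_nat n) *\<^sub>Q p 0)" by (intro sum.cong[OF refl] rho_f_\<beta>) simp
  also have "\<dots> = p 0" using n_pos by (simp add: fun_eq_iff sum_fun_apply)
  finally show ?thesis using True by simp
next
  case False
  have "rho f (\<beta> 0 - \<beta> j) = rho f (\<beta> 0) - rho f (\<beta> j)"
    using rho_linear(4)[of f "\<beta> 0 - \<beta> j" "\<beta> j"] by simp
  then show ?thesis using False rho_f_\<beta>[OF j] rho_f_\<beta>[OF n_pos] by (simp add: p_def)
qed

lemma rho_p_eqI:
  assumes a: "a \<in> A" and b: "b \<in> A" and eq: "\<And>j. j < n \<Longrightarrow> rho a (p j) = rho b (p j)"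
  shows "a = b"
proof -
  have ab: "a - b \<in> A" using A_closed(3)[OF a b] .
  have "rho (a - b) v = 0" if v: "v \<in> E" for v
  proof -
    obtain c where c: "\<forall>i<n. c i \<in> F" "v = (\<Sum>i<n. c i \<star> p i)" using p_span[OF v] by blast
    have "rho (a - b) v = (\<Sum>i<n. c i \<star> rho (a - b) (p i))"
      unfolding c(2) rho_sum using c(1) rho_F[OF ab _ p_E] by (intro sum.cong[OF refl]) auto
    also have "\<dots> = 0" using eq by (intro sum.neutral) (simp add: rho_linear(2))
    finally show ?thesis .
  qed
  then have "a - b = 0" by (rule rho_injective[OF ab])
  then show ?thesis by simp
qed

text \<open>Prescribing the images of the \<open>n\<close> elements \<open>p j\<close> means prescribing \<open>n\<close> elements of \<open>\<rat>H\<epsilon>\<close>, that is, the \<open>n\<close>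
coefficients of an element of the crossed product. So \<open>L\<close>, which sends \<open>a\<close> to the element with these
images as coefficients, is an injective linear endomorphism of \<open>\<rat>N\<epsilon>\<close>.\<close>

lemma rho_p_surjective:
  assumes d: "\<And>j. j < n \<Longrightarrow> d j \<in> E" shows "\<exists>a\<in>A. \<forall>j<n. rho a (p j) = d j"
proof -
  obtain e where e: "bij_betw e {..<n} T" using ex_bij_betw_nat_finite[OF fin_T] by (auto simp: n_def atLeast0LessThan)
  define ix where "ix = the_inv_into {..<n} e"
  have ix: "ix (e j) = j" "e j \<in> T" if "j < n" for j
    using e that the_inv_into_f_f[of e "{..<n}" j] by (auto simp: ix_def bij_betw_def)
  have ixT: "ix t < n" if tT: "t \<in> T" for t
  proof -
    have "t \<in> e ` {..<n}" using tT bij_betw_imp_surj_on[OF e] by simp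
    then obtain j where "t = e j" "j \<in> {..<n}" by (rule imageE)
    then show ?thesis using ix by simp
  qed
  define L where "L a = (\<Sum>t\<in>T. rho a (p (ix t)) \<star> \<delta> t)" for a
  have coord_L: "coord t (L a) = rho a (p (ix t))" if "a \<in> A" "t \<in> T" for a t
    unfolding L_def using rho_in_E[OF that(1) p_E[OF ixT]] that(2) by (intro coord_sum)
  have "\<exists>a\<in>A. L a = (\<Sum>t\<in>T. d (ix t) \<star> \<delta> t)"
  proof (rule injective_linear_surjective[where S = N])
    show "L (a + b) = L a + L b" "L (c *\<^sub>Q a) = c *\<^sub>Q L a" for a b c
      by (simp_all add: L_def rho_linear conv_linear sum.distrib QV.scale_sum_right)
    show "A \<subseteq> functions_on N" by (auto simp: A_def)
    show "L a \<in> A" if "a \<in> A" for a unfolding L_def using rho_in_E[OF that p_E[OF ixT]] by (rule sum_in_A)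
    show "(\<Sum>t\<in>T. d (ix t) \<star> \<delta> t) \<in> A" using d ixT by (intro sum_in_A) blast
    show "a = 0" if a: "a \<in> A" and z: "L a = 0" for a
    proof (rule rho_p_eqI[OF a A_closed(1)])
      fix j assume j: "j < n"
      have "rho a (p j) = coord (e j) (L a)" using coord_L[OF a ix(2)[OF j]] ix(1)[OF j] by simp
      also have "\<dots> = 0" unfolding z by (rule coord_linear)
      also have "\<dots> = rho 0 (p j)" by (simp add: rho_def coord_linear(4))
      finally show "rho a (p j) = rho 0 (p j)" .
    qed
  qed (use fin_N A_subspace in auto)
  then obtain a where a: "a \<in> A" "L a = (\<Sum>t\<in>T. d (ix t) \<star> \<delta> t)" by blast
  have "rho a (p j) = d j" if j: "j < n" for j
  proof -
    have "rho a (p j) = coord (e j) (L a)" using coord_L[OF a(1) ix(2)[OF j]] ix(1)[OF j] by simp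
    also have "\<dots> = d (ix (e j))" unfolding a(2) using d ixT ix(2)[OF j] by (intro coord_sum) blast
    finally show ?thesis using ix(1)[OF j] by simp
  qed
  then show ?thesis using a(1) by blast
qed

end

section \<open>Matrices and the element that shifts the columns of P\<close>

context finite_group
begin

lemma abelian_monoid_group_algebra: "abelian_monoid (group_algebra G)"
  by (rule abelian_monoidI)
     (simp_all only: carrier_group_algebra add_group_algebra zero_group_algebra functions_on_closed add.assoc add_0_left, simp only: add.commute)

lemma finsum_group_algebra:
  assumes "\<And>i. i \<in> I \<Longrightarrow> a i \<in> functions_on (carrier G)"
  shows "finsum (group_algebra G) a I = (\<Sum>i\<in>I. a i)"
  by (rule finsum_eq_sum[OF abelian_monoid_group_algebra])
     (use assms in \<open>simp_all add: carrier_group_algebra\<close>, simp_all add: group_algebra_def)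

end

context split_strong_shoda
begin

lemma coset_eps_phi:
  assumes t: "t \<in> T" shows "coset_eps G H K (\<phi> (H #> t)) = \<delta> t \<star> \<epsilon>"
proof -
  have "t \<in> K #> t" using rcos_self[OF T_in_G[OF t] sub_K] .
  then have "(SOME s. s \<in> K #> t) \<in> K #> t" by (rule someI)
  then obtain x where x: "x \<in> K" "(SOME s. s \<in> K #> t) = x \<otimes> t" by (auto simp: r_coset_def)
  have "\<delta> (x \<otimes> t) \<star> \<epsilon> = \<delta> x \<star> (\<delta> t \<star> \<epsilon>)"
    using delta_mult_assoc[OF memG(3)[OF x(1)] T_in_G[OF t]] by simp
  then show ?thesis
    using delta_K_A[OF x(1) delta_eps_A[OF T_in_N[OF t]]] by (simp add: coset_eps_def T_phi[OF t] x(2))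
qed

lemma coset_act_eq:
  assumes t: "t \<in> T" and v: "v \<in> E" shows "coset_act G (H #> t) v = conjugate t v"
proof -
  have "t \<in> H #> t" using rcos_self[OF T_in_G[OF t] sub_H] .
  then have "(SOME s. s \<in> H #> t) \<in> H #> t" by (rule someI)
  then obtain h where h: "h \<in> H" "(SOME s. s \<in> H #> t) = h \<otimes> t" by (auto simp: r_coset_def)
  have "conjugate (h \<otimes> t) v = conjugate h (conjugate t v)"
    using conjugate_conjugate[OF memG(2)[OF h(1)] T_in_G[OF t]] by simp
  then show ?thesis using conj_H_E[OF h(1) E_conj_N[OF v T_in_N[OF t]]] by (simp add: coset_act_def h(2))
qed

lemma sum_cosets: "(\<Sum>c\<in>carrier (quot G N H). g c) = (\<Sum>t\<in>T. g (H #> t))"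
  by (rule sum.reindex_bij_betw[OF T_bij, symmetric])

lemma coset_in: "t \<in> T \<Longrightarrow> H #> t \<in> carrier (quot G N H)"
  using bij_betwE[OF T_bij] by blast

text \<open>The expansion over \<open>N/H\<close> with values \<open>\<phi>\<close> is the expansion over the transversal, because \<open>\<phi>(tH)\<epsilon> = t\<epsilon>\<close>, and
its coefficients are unique because the cosets \<open>H t\<close> are disjoint.\<close>

lemma crossed_coeffs_eq:
  assumes a: "a \<in> A" and t: "t \<in> T" shows "crossed_coeffs G H K \<phi> a (H #> t) = coord t a"
proof -
  let ?C = "carrier (quot G N H)"
  let ?ok = "\<lambda>x. x \<in> ?C \<rightarrow>\<^sub>E carrier (QHe G H K) \<and>
    a = (\<Oplus>\<^bsub>group_algebra G\<^esub>c\<in>?C. x c \<otimes>\<^bsub>group_algebra G\<^esub> coset_eps G H K (\<phi> c))"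
  define rep where "rep = the_inv_into T (\<lambda>t. H #> t)"
  have rep: "rep (H #> s) = s" if "s \<in> T" for s
    unfolding rep_def using T_bij that by (intro the_inv_into_f_f) (auto simp: bij_betw_def)
  have sum_eq: "(\<Oplus>\<^bsub>group_algebra G\<^esub>c\<in>?C. x c \<otimes>\<^bsub>group_algebra G\<^esub> coset_eps G H K (\<phi> c)) = (\<Sum>s\<in>T. x (H #> s) \<star> \<delta> s)"
    if x: "x \<in> ?C \<rightarrow>\<^sub>E carrier (QHe G H K)" for x
  proof -
    have "(\<Oplus>\<^bsub>group_algebra G\<^esub>c\<in>?C. x c \<otimes>\<^bsub>group_algebra G\<^esub> coset_eps G H K (\<phi> c)) = (\<Sum>c\<in>?C. x c \<star> coset_eps G H K (\<phi> c))"
      by (rule finsum_group_algebra) (rule conv_closed)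
    also have "\<dots> = (\<Sum>s\<in>T. x (H #> s) \<star> \<delta> s)" unfolding sum_cosets
    proof (rule sum.cong[OF refl])
      fix s assume s: "s \<in> T"
      have "x (H #> s) \<in> E" using x coset_in[OF s] by (auto simp: QHe_carrier)
      then show "x (H #> s) \<star> coset_eps G H K (\<phi> (H #> s)) = x (H #> s) \<star> \<delta> s"
        using E_delta_eps T_in_N s by (simp add: coset_eps_phi[OF s])
    qed
    finally show ?thesis .
  qed
  have uniq: "x (H #> s) = coord s a" if x: "?ok x" and s: "s \<in> T" for x s
  proof -
    have "x (H #> r) \<in> E" if "r \<in> T" for r using x coset_in[OF that] by (auto simp: QHe_carrier)
    moreover have "a = (\<Sum>s\<in>T. x (H #> s) \<star> \<delta> s)" using x sum_eq by simp
    ultimately show ?thesis using coord_sum[of "\<lambda>s. x (H #> s)" s] s by simp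
  qed
  define x0 where "x0 = (\<lambda>c\<in>?C. coord (rep c) a)"
  have x0: "x0 (H #> s) = coord s a" if "s \<in> T" for s using coset_in[OF that] rep[OF that] by (simp add: x0_def)
  have "x0 \<in> ?C \<rightarrow>\<^sub>E carrier (QHe G H K)"
  proof (rule PiE_I)
    fix c assume "c \<in> ?C"
    then obtain s where "s \<in> T" "c = H #> s" using bij_betw_imp_surj_on[OF T_bij] by (metis imageE)
    then show "x0 c \<in> carrier (QHe G H K)" using x0 coord_in_E[OF a T_in_N] by (simp add: QHe_carrier)
  qed (simp add: x0_def)
  moreover have "a = (\<Sum>s\<in>T. x0 (H #> s) \<star> \<delta> s)"
    by (subst coord_expansion[OF a]) (rule sum.cong[OF refl], simp add: x0)
  ultimately have ok0: "?ok x0" using sum_eq by simp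
  have "(THE x. ?ok x) = x0"
  proof (rule the_equality[of ?ok, OF ok0])
    fix x assume x: "?ok x"
    show "x = x0"
    proof
      fix c
      show "x c = x0 c"
      proof (cases "c \<in> ?C")
        case True
        then obtain s where "s \<in> T" "c = H #> s" using bij_betw_imp_surj_on[OF T_bij] by (metis imageE)
        then show ?thesis using uniq[OF x] x0 by simp
      next
        case False
        then show ?thesis using x by (auto simp: x0_def PiE_def extensional_def)
      qed
    qed
  qed
  then show ?thesis using x0[OF t] by (simp only: crossed_coeffs_def)
qed

lemma crossed_endo_eq:
  assumes a: "a \<in> A" and v: "v \<in> E" shows "crossed_endo G H K \<phi> a v = rho a v"
proof -
  have "crossed_endo G H K \<phi> a v = (\<Sum>c\<in>carrier (quot G N H). crossed_coeffs G H K \<phi> a c \<star> coset_act G c v)"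
    unfolding crossed_endo_def by (rule finsum_group_algebra) (rule conv_closed)
  also have "\<dots> = rho a v"
    unfolding sum_cosets rho_def by (rule sum.cong[OF refl]) (simp add: crossed_coeffs_eq[OF a] coset_act_eq[OF _ v])
  finally show ?thesis .
qed

end

context normal_basis
begin

abbreviation FF :: "('a \<Rightarrow> rat) ring" where "FF \<equiv> (QHe G H K)\<lparr>carrier := F\<rparr>"
abbreviation MR :: "(nat \<times> nat \<Rightarrow> 'a \<Rightarrow> rat) ring" where "MR \<equiv> mat_ring n FF"

lemma FF_simps: "carrier FF = F" "a \<otimes>\<^bsub>FF\<^esub> b = a \<star> b" "a \<oplus>\<^bsub>FF\<^esub> b = a + b" "\<zero>\<^bsub>FF\<^esub> = 0" "\<one>\<^bsub>FF\<^esub> = \<epsilon>"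
  by simp_all

lemma FF_ring: "ring FF"
proof -
  interpret R: field "QHe G H K" by (rule QHe_field)
  show ?thesis using R.subring_is_ring[OF subfieldE(1)[OF F_subfield]] .
qed

lemma FF_minus_one: "\<ominus>\<^bsub>FF\<^esub> \<one>\<^bsub>FF\<^esub> = - \<epsilon>"
proof -
  interpret R: ring FF by (rule FF_ring)
  show ?thesis
    by (rule R.minus_equality) (simp_all only: FF_simps F_closed left_minus)
qed

lemma FF_finsum: "(\<And>i. i \<in> I \<Longrightarrow> g i \<in> F) \<Longrightarrow> finsum FF g I = (\<Sum>i\<in>I. g i)"
proof -
  assume g: "\<And>i. i \<in> I \<Longrightarrow> g i \<in> F"
  interpret R: ring FF by (rule FF_ring)
  show ?thesis
    by (rule finsum_eq_sum) (use R.abelian_monoid_axioms g in \<open>simp_all add: alg_component_def group_algebra_def\<close>)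
qed

lemma QHe_finsum: "(\<And>i. i \<in> I \<Longrightarrow> g i \<in> E) \<Longrightarrow> finsum (QHe G H K) g I = (\<Sum>i\<in>I. g i)"
proof -
  assume g: "\<And>i. i \<in> I \<Longrightarrow> g i \<in> E"
  interpret R: field "QHe G H K" by (rule QHe_field)
  show ?thesis
    by (rule finsum_eq_sum[OF R.abelian_monoid_axioms alg_component_add alg_component_zero]) (use g in \<open>simp add: QHe_carrier\<close>)
qed

lemma mat_carrier: "M \<in> carrier MR \<longleftrightarrow> M \<in> {..<n} \<times> {..<n} \<rightarrow>\<^sub>E F"
  by (simp add: mat_ring_def Let_def)

lemma mat_entry: "M \<in> carrier MR \<Longrightarrow> i < n \<Longrightarrow> j < n \<Longrightarrow> M (i, j) \<in> F"
  by (auto simp: mat_carrier)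

lemma mat_eqI:
  assumes "M \<in> carrier MR" "M' \<in> carrier MR" "\<And>i j. i < n \<Longrightarrow> j < n \<Longrightarrow> M (i, j) = M' (i, j)"
  shows "M = M'"
  by (rule PiE_ext[OF assms(1,2)[unfolded mat_carrier]]) (use assms(3) in auto)

lemma mat_mult_apply:
  assumes "M \<in> carrier MR" "M' \<in> carrier MR" "i < n" "j < n"
  shows "(M \<otimes>\<^bsub>MR\<^esub> M') (i, j) = (\<Sum>k<n. M (i, k) \<star> M' (k, j))"
proof -
  have "(M \<otimes>\<^bsub>MR\<^esub> M') (i, j) = finsum FF (\<lambda>k. M (i, k) \<star> M' (k, j)) {..<n}"
    using assms(3,4) by (simp add: mat_ring_def Let_def)
  also have "\<dots> = (\<Sum>k<n. M (i, k) \<star> M' (k, j))"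
    by (rule FF_finsum) (use assms mat_entry F_closed(5) in auto)
  finally show ?thesis .
qed

lemma mat_mult_closed:
  assumes "M \<in> carrier MR" "M' \<in> carrier MR" shows "M \<otimes>\<^bsub>MR\<^esub> M' \<in> carrier MR"
  unfolding mat_carrier
proof (rule PiE_I)
  fix ij assume "ij \<in> {..<n} \<times> {..<n}"
  then obtain i j where ij: "ij = (i, j)" "i < n" "j < n" by auto
  show "(M \<otimes>\<^bsub>MR\<^esub> M') ij \<in> F" unfolding ij(1) mat_mult_apply[OF assms ij(2,3)]
    by (rule F_closed(7)) (use assms ij mat_entry F_closed(5) in auto)
next
  fix ij assume "ij \<notin> {..<n} \<times> {..<n}"
  then show "(M \<otimes>\<^bsub>MR\<^esub> M') ij = undefined" by (auto simp: mat_ring_def Let_def)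
qed

lemma mat_one: "\<one>\<^bsub>MR\<^esub> \<in> carrier MR" "i < n \<Longrightarrow> j < n \<Longrightarrow> \<one>\<^bsub>MR\<^esub> (i, j) = (if i = j then \<epsilon> else 0)"
  using F_closed(1,6) by (auto simp: mat_ring_def Let_def)

lemma mat_monoid: "monoid MR"
proof (rule monoidI)
  fix M M' M'' assume c: "M \<in> carrier MR" "M' \<in> carrier MR" "M'' \<in> carrier MR"
  note cc = mat_mult_closed[OF c(1,2)] mat_mult_closed[OF c(2,3)]
  show "M \<otimes>\<^bsub>MR\<^esub> M' \<otimes>\<^bsub>MR\<^esub> M'' = M \<otimes>\<^bsub>MR\<^esub> (M' \<otimes>\<^bsub>MR\<^esub> M'')"
  proof (rule mat_eqI[OF mat_mult_closed[OF cc(1) c(3)] mat_mult_closed[OF c(1) cc(2)]])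
    fix i j assume ij: "i < n" "j < n"
    have "(M \<otimes>\<^bsub>MR\<^esub> M' \<otimes>\<^bsub>MR\<^esub> M'') (i, j) = (\<Sum>k<n. \<Sum>l<n. M (i, l) \<star> M' (l, k) \<star> M'' (k, j))"
      unfolding mat_mult_apply[OF cc(1) c(3) ij]
      by (rule sum.cong[OF refl]) (simp only: mat_mult_apply[OF c(1,2) ij(1)] lessThan_iff conv_sum_left)
    also have "\<dots> = (\<Sum>l<n. \<Sum>k<n. M (i, l) \<star> M' (l, k) \<star> M'' (k, j))" by (rule sum.swap)
    also have "\<dots> = (M \<otimes>\<^bsub>MR\<^esub> (M' \<otimes>\<^bsub>MR\<^esub> M'')) (i, j)"
      unfolding mat_mult_apply[OF c(1) cc(2) ij]
      by (rule sum.cong[OF refl]) (simp only: mat_mult_apply[OF c(2,3) _ ij(2)] lessThan_iff conv_sum_right conv_assoc)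
    finally show "(M \<otimes>\<^bsub>MR\<^esub> M' \<otimes>\<^bsub>MR\<^esub> M'') (i, j) = (M \<otimes>\<^bsub>MR\<^esub> (M' \<otimes>\<^bsub>MR\<^esub> M'')) (i, j)" .
  qed
next
  fix M assume c: "M \<in> carrier MR"
  show "\<one>\<^bsub>MR\<^esub> \<otimes>\<^bsub>MR\<^esub> M = M"
  proof (rule mat_eqI[OF mat_mult_closed[OF mat_one(1) c] c])
    fix i j assume ij: "i < n" "j < n"
    have "(\<one>\<^bsub>MR\<^esub> \<otimes>\<^bsub>MR\<^esub> M) (i, j) = (\<Sum>k<n. if k = i then M (i, j) else 0)"
      unfolding mat_mult_apply[OF mat_one(1) c ij] using ij mat_entry[OF c ij]
      by (intro sum.cong[OF refl]) (auto simp: mat_one(2) E_eps(2) F_E)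
    then show "(\<one>\<^bsub>MR\<^esub> \<otimes>\<^bsub>MR\<^esub> M) (i, j) = M (i, j)" using ij by simp
  qed
  show "M \<otimes>\<^bsub>MR\<^esub> \<one>\<^bsub>MR\<^esub> = M"
  proof (rule mat_eqI[OF mat_mult_closed[OF c mat_one(1)] c])
    fix i j assume ij: "i < n" "j < n"
    have "(M \<otimes>\<^bsub>MR\<^esub> \<one>\<^bsub>MR\<^esub>) (i, j) = (\<Sum>k<n. if k = j then M (i, j) else 0)"
      unfolding mat_mult_apply[OF c mat_one(1) ij] using ij mat_entry[OF c ij]
      by (intro sum.cong[OF refl]) (auto simp: mat_one(2) E_eps(1) F_E)
    then show "(M \<otimes>\<^bsub>MR\<^esub> \<one>\<^bsub>MR\<^esub>) (i, j) = M (i, j)" using ij by simp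
  qed
qed (use mat_mult_closed mat_one in auto)

text \<open>The element of \<open>\<rat>H\<epsilon>\<close> with the \<open>j\<close>-th column of the matrix as coordinates. A matrix is determined by these
elements, which replaces coordinate computations by computations in the field.\<close>

definition column :: "(nat \<times> nat \<Rightarrow> 'a \<Rightarrow> rat) \<Rightarrow> nat \<Rightarrow> 'a \<Rightarrow> rat" where
  "column M j = (\<Sum>i<n. M (i, j) \<star> \<beta> i)"

lemma column_mult:
  assumes c: "M \<in> carrier MR" "M' \<in> carrier MR" and j: "j < n"
  shows "column (M \<otimes>\<^bsub>MR\<^esub> M') j = (\<Sum>l<n. M' (l, j) \<star> column M l)"
proof -
  have "column (M \<otimes>\<^bsub>MR\<^esub> M') j = (\<Sum>i<n. \<Sum>l<n. M (i, l) \<star> M' (l, j) \<star> \<beta> i)"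
    unfolding column_def by (rule sum.cong[OF refl]) (simp only: mat_mult_apply[OF c _ j] lessThan_iff conv_sum_left)
  also have "\<dots> = (\<Sum>l<n. \<Sum>i<n. M (i, l) \<star> M' (l, j) \<star> \<beta> i)" by (rule sum.swap)
  also have "\<dots> = (\<Sum>l<n. M' (l, j) \<star> column M l)"
  proof (rule sum.cong[OF refl])
    fix l assume "l \<in> {..<n}"
    then have l: "l < n" by simp
    show "(\<Sum>i<n. M (i, l) \<star> M' (l, j) \<star> \<beta> i) = M' (l, j) \<star> column M l"
      unfolding column_def conv_sum_right
    proof (rule sum.cong[OF refl])
      fix i assume "i \<in> {..<n}"
      then have "M (i, l) \<star> M' (l, j) = M' (l, j) \<star> M (i, l)"
        using E_commute F_E mat_entry[OF c(1) _ l] mat_entry[OF c(2) l j] by simp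
      then show "M (i, l) \<star> M' (l, j) \<star> \<beta> i = M' (l, j) \<star> (M (i, l) \<star> \<beta> i)" by (simp add: conv_assoc)
    qed
  qed
  finally show ?thesis .
qed

lemma column_one: "j < n \<Longrightarrow> column \<one>\<^bsub>MR\<^esub> j = \<beta> j"
proof -
  assume j: "j < n"
  have "column \<one>\<^bsub>MR\<^esub> j = (\<Sum>i<n. (if i = j then \<epsilon> else 0) \<star> \<beta> i)"
    unfolding column_def by (rule sum.cong[OF refl]) (simp add: mat_one(2) j)
  also have "\<dots> = \<beta> j" unfolding sum_single[OF j] using E_eps(2)[OF \<beta>_E[OF j]] .
  finally show ?thesis .
qed

lemma column_inj:
  assumes c: "M \<in> carrier MR" "M' \<in> carrier MR" and eq: "\<And>j. j < n \<Longrightarrow> column M j = column M' j"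
  shows "M = M'"
proof (rule mat_eqI[OF c])
  fix i j assume ij: "i < n" "j < n"
  have z: "(\<Sum>i<n. (M (i, j) - M' (i, j)) \<star> \<beta> i) = 0"
    using eq[OF ij(2)] by (simp add: column_def conv_diff_left sum_subtractf)
  have "(\<lambda>i. M (i, j) - M' (i, j)) i = 0"
    by (rule \<beta>_independent[OF _ z ij(1)]) (use c ij mat_entry F_closed(3) in auto)
  then show "M (i, j) = M' (i, j)" by simp
qed

text \<open>Uniqueness of coordinates turns the description of the matrix into a characterization.\<close>

lemma matrix_of_char:
  assumes M: "M \<in> carrier MR" and eq: "\<And>j. j < n \<Longrightarrow> g (\<beta> j) = column M j"
  shows "matrix_of (QHe G H K) F bs g = M"
proof -
  have fs: "(\<Oplus>\<^bsub>QHe G H K\<^esub>i\<in>{..<n}. M (i, j) \<otimes>\<^bsub>QHe G H K\<^esub> \<beta> i) = column M j"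
    if "M \<in> carrier MR" "j < n" for M j
  proof -
    have "(\<Oplus>\<^bsub>QHe G H K\<^esub>i\<in>{..<n}. M (i, j) \<otimes>\<^bsub>QHe G H K\<^esub> \<beta> i) = (\<Oplus>\<^bsub>QHe G H K\<^esub>i\<in>{..<n}. M (i, j) \<star> \<beta> i)"
      by (simp only: alg_component_simps)
    also have "\<dots> = column M j" unfolding column_def
      by (rule QHe_finsum) (use that mat_entry F_E \<beta>_E E_closed(5) in auto)
    finally show ?thesis .
  qed
  show ?thesis
    unfolding matrix_of_def length_bs
  proof (rule the_equality)
    show "M \<in> carrier MR \<and> (\<forall>j<n. g (\<beta> j) = (\<Oplus>\<^bsub>QHe G H K\<^esub>i\<in>{..<n}. M (i, j) \<otimes>\<^bsub>QHe G H K\<^esub> \<beta> i))"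
      using M eq fs[OF M] by simp
  next
    fix M' assume M': "M' \<in> carrier MR \<and> (\<forall>j<n. g (\<beta> j) = (\<Oplus>\<^bsub>QHe G H K\<^esub>i\<in>{..<n}. M' (i, j) \<otimes>\<^bsub>QHe G H K\<^esub> \<beta> i))"
    then have "column M' j = column M j" if "j < n" for j using fs[of M' j] eq[OF that] that by simp
    then show "M' = M" using column_inj M M' by blast
  qed
qed

abbreviation \<psi> :: "('a \<Rightarrow> rat) \<Rightarrow> nat \<times> nat \<Rightarrow> 'a \<Rightarrow> rat" where "\<psi> \<equiv> psi G H K \<phi> bs"

lemma psi_char:
  assumes a: "a \<in> A" and M: "M \<in> carrier MR" "\<And>j. j < n \<Longrightarrow> rho a (\<beta> j) = column M j"
  shows "\<psi> a = M"
  unfolding psi_def fixed_field_eq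
  by (rule matrix_of_char[OF M(1)]) (simp add: crossed_endo_eq[OF a \<beta>_E] M(2))

lemma psi_column:
  assumes a: "a \<in> A" and j: "j < n" shows "rho a (\<beta> j) = column (\<psi> a) j"
proof -
  have "\<exists>c. (\<forall>i<n. c i \<in> F) \<and> rho a (\<beta> j) = (\<Sum>i<n. c i \<star> \<beta> i)" if "j < n" for j
    using \<beta>_span[OF rho_in_E[OF a \<beta>_E[OF that]]] .
  then obtain c where c: "\<And>i j. i < n \<Longrightarrow> j < n \<Longrightarrow> c j i \<in> F" "\<And>j. j < n \<Longrightarrow> rho a (\<beta> j) = (\<Sum>i<n. c j i \<star> \<beta> i)"
    by metis
  define M where "M = (\<lambda>(i, j)\<in>{..<n} \<times> {..<n}. c j i)"
  have M: "M \<in> carrier MR" unfolding mat_carrier M_def using c(1) by auto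
  have "rho a (\<beta> j) = column M j" if j: "j < n" for j
    unfolding c(2)[OF j] column_def by (rule sum.cong[OF refl]) (simp add: M_def j)
  then have "\<psi> a = M" "rho a (\<beta> j) = column M j" using psi_char[OF a M] j by auto
  then show ?thesis by simp
qed

text \<open>Matrices with rational entries; inverting \<open>P\<close> is a computation with rational numbers.\<close>

definition scalar_mat :: "(nat \<Rightarrow> nat \<Rightarrow> rat) \<Rightarrow> nat \<times> nat \<Rightarrow> 'a \<Rightarrow> rat" where
  "scalar_mat c = (\<lambda>(i, j)\<in>{..<n} \<times> {..<n}. c i j *\<^sub>Q \<epsilon>)"

lemma scalar_mat_carrier: "scalar_mat c \<in> carrier MR"
  unfolding mat_carrier scalar_mat_def using F_closed(4,6) by auto

lemma scalar_mat_mult: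
  assumes "\<And>i j. i < n \<Longrightarrow> j < n \<Longrightarrow> (\<Sum>k<n. c i k * d k j) = (if i = j then 1 else 0)"
  shows "scalar_mat c \<otimes>\<^bsub>MR\<^esub> scalar_mat d = \<one>\<^bsub>MR\<^esub>"
proof (rule mat_eqI[OF mat_mult_closed[OF scalar_mat_carrier scalar_mat_carrier] mat_one(1)])
  fix i j assume ij: "i < n" "j < n"
  have "(scalar_mat c \<otimes>\<^bsub>MR\<^esub> scalar_mat d) (i, j) = (\<Sum>k<n. (c i k * d k j) *\<^sub>Q \<epsilon>)"
    unfolding mat_mult_apply[OF scalar_mat_carrier scalar_mat_carrier ij]
    by (rule sum.cong[OF refl]) (simp add: scalar_mat_def ij conv_linear eps_idem)
  also have "\<dots> = (\<Sum>k<n. c i k * d k j) *\<^sub>Q \<epsilon>" by (simp only: QV.scale_sum_left)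
  finally show "(scalar_mat c \<otimes>\<^bsub>MR\<^esub> scalar_mat d) (i, j) = \<one>\<^bsub>MR\<^esub> (i, j)"
    unfolding assms[OF ij] mat_one(2)[OF ij] by simp
qed

definition P_coeff :: "nat \<Rightarrow> nat \<Rightarrow> rat" where "P_coeff i j = (if i = 0 \<or> j = 0 then 1 else if i = j then - 1 else 0)"
text \<open>The entries of \<open>P\<^sup>-\<^sup>1\<close>: all equal to \<open>1/n\<close>, minus the identity matrix outside the first row and column.\<close>

definition P_inv_coeff :: "nat \<Rightarrow> nat \<Rightarrow> rat" where "P_inv_coeff i j = 1 / of_nat n - (if i = j \<and> i \<noteq> 0 then 1 else 0)"

lemma P_mat_eq: "P_mat n FF = scalar_mat P_coeff"
  unfolding P_mat_def scalar_mat_def FF_minus_one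
  by (intro restrict_ext) (auto simp: P_coeff_def)

lemma P_coeff_inverse: assumes ij: "i < n" "j < n" shows "(\<Sum>k<n. P_coeff i k * P_inv_coeff k j) = (if i = j then 1 else 0)"
proof (cases "i = 0")
  case True
  have "(\<Sum>k<n. P_coeff i k * P_inv_coeff k j) = (\<Sum>k<n. 1 / of_nat n - (if k = j then if j = 0 then 0 else 1 else 0))"
    by (rule sum.cong[OF refl]) (auto simp: True P_coeff_def P_inv_coeff_def)
  also have "\<dots> = 1 - (if j = 0 then 0 else 1)" unfolding sum_subtractf using n_pos ij by simp
  finally show ?thesis using True by simp
next
  case False
  have "(\<Sum>k<n. P_coeff i k * P_inv_coeff k j) = (\<Sum>k<n. (if k = 0 then P_inv_coeff 0 j else 0) - (if k = i then P_inv_coeff i j else 0))"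
    by (rule sum.cong[OF refl]) (use False in \<open>auto simp: P_coeff_def\<close>)
  also have "\<dots> = P_inv_coeff 0 j - P_inv_coeff i j" unfolding sum_subtractf using n_pos ij by simp
  finally show ?thesis using False by (simp add: P_inv_coeff_def)
qed

lemma P_inverse: "scalar_mat P_coeff \<otimes>\<^bsub>MR\<^esub> scalar_mat P_inv_coeff = \<one>\<^bsub>MR\<^esub>" "scalar_mat P_inv_coeff \<otimes>\<^bsub>MR\<^esub> scalar_mat P_coeff = \<one>\<^bsub>MR\<^esub>"
proof -
  show "scalar_mat P_coeff \<otimes>\<^bsub>MR\<^esub> scalar_mat P_inv_coeff = \<one>\<^bsub>MR\<^esub>" by (rule scalar_mat_mult[OF P_coeff_inverse])
  have sym: "P_inv_coeff i k * P_coeff k j = P_coeff j k * P_inv_coeff k i" for i j k by (auto simp: P_coeff_def P_inv_coeff_def)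
  show "scalar_mat P_inv_coeff \<otimes>\<^bsub>MR\<^esub> scalar_mat P_coeff = \<one>\<^bsub>MR\<^esub>"
    by (rule scalar_mat_mult) (simp only: sym P_coeff_inverse, auto)
qed

lemma inv_P: "inv\<^bsub>MR\<^esub> (scalar_mat P_coeff) = scalar_mat P_inv_coeff"
  by (rule monoid.inv_char[OF mat_monoid scalar_mat_carrier scalar_mat_carrier P_inverse])

lemma column_P: assumes j: "j < n" shows "column (scalar_mat P_coeff) j = p j"
proof -
  have e: "(c *\<^sub>Q \<epsilon>) \<star> \<beta> i = c *\<^sub>Q \<beta> i" if "i < n" for c i using E_eps(2)[OF \<beta>_E[OF that]] by (simp add: conv_linear)
  have "column (scalar_mat P_coeff) j = (\<Sum>i<n. P_coeff i j *\<^sub>Q \<beta> i)"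
    unfolding column_def by (rule sum.cong[OF refl]) (simp add: scalar_mat_def j e)
  also have "\<dots> = p j"
  proof (cases "j = 0")
    case True
    show ?thesis unfolding p_def if_P[OF True] by (rule sum.cong[OF refl]) (simp add: P_coeff_def True)
  next
    case False
    have "(\<Sum>i<n. P_coeff i j *\<^sub>Q \<beta> i) = (\<Sum>i<n. (if i = 0 then \<beta> 0 else 0) - (if i = j then \<beta> j else 0))"
      by (rule sum.cong[OF refl]) (use False in \<open>auto simp: P_coeff_def fun_eq_iff\<close>)
    also have "\<dots> = \<beta> 0 - \<beta> j" unfolding sum_subtractf using n_pos j by simp
    finally show ?thesis using False by (simp add: p_def)
  qed
  finally show ?thesis .
qed

definition cycle_mat :: "nat \<times> nat \<Rightarrow> 'a \<Rightarrow> rat" where "cycle_mat = A_mat n FF"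

lemma cycle_mat_carrier: "cycle_mat \<in> carrier MR"
  unfolding mat_carrier cycle_mat_def A_mat_def FF_simps using F_closed(1,6) by auto

lemma cycle_mat_entry: "i < n \<Longrightarrow> j < n \<Longrightarrow> cycle_mat (i, j) = (if i = Suc j mod n then \<epsilon> else 0)"
proof -
  assume ij: "i < n" "j < n"
  have "(i = Suc j \<or> (i = 0 \<and> j = n - 1)) \<longleftrightarrow> i = Suc j mod n"
    using ij by (cases "Suc j = n") auto
  then show ?thesis using ij by (simp add: cycle_mat_def A_mat_def)
qed

lemma column_PA: assumes j: "j < n" shows "column (scalar_mat P_coeff \<otimes>\<^bsub>MR\<^esub> cycle_mat) j = p (Suc j mod n)"
proof -
  have m: "Suc j mod n < n" using n_pos by simp
  have "column (scalar_mat P_coeff \<otimes>\<^bsub>MR\<^esub> cycle_mat) j = (\<Sum>l<n. cycle_mat (l, j) \<star> column (scalar_mat P_coeff) l)"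
    by (rule column_mult[OF scalar_mat_carrier cycle_mat_carrier j])
  also have "\<dots> = (\<Sum>l<n. if l = Suc j mod n then p (Suc j mod n) else 0)"
    by (rule sum.cong[OF refl]) (use E_eps(2)[OF p_E[OF m]] in \<open>auto simp: cycle_mat_entry j column_P\<close>)
  also have "\<dots> = p (Suc j mod n)" using m by simp
  finally show ?thesis .
qed

definition shift_mat :: "nat \<times> nat \<Rightarrow> 'a \<Rightarrow> rat" where
  "shift_mat = scalar_mat P_coeff \<otimes>\<^bsub>MR\<^esub> cycle_mat \<otimes>\<^bsub>MR\<^esub> scalar_mat P_inv_coeff"

lemma shift_mat_carrier: "shift_mat \<in> carrier MR"
  unfolding shift_mat_def by (intro mat_mult_closed scalar_mat_carrier cycle_mat_carrier)

lemma shift_mat_P: "shift_mat \<otimes>\<^bsub>MR\<^esub> scalar_mat P_coeff = scalar_mat P_coeff \<otimes>\<^bsub>MR\<^esub> cycle_mat"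
proof -
  interpret M: monoid MR by (rule mat_monoid)
  show ?thesis unfolding shift_mat_def
    using M.m_assoc[OF mat_mult_closed[OF scalar_mat_carrier cycle_mat_carrier] scalar_mat_carrier scalar_mat_carrier, of P_coeff P_inv_coeff P_coeff]
      P_inverse(2) M.r_one[OF mat_mult_closed[OF scalar_mat_carrier cycle_mat_carrier]] by simp
qed

abbreviation x :: "'a \<Rightarrow> rat" where "x \<equiv> x_e G H K \<phi> bs"

text \<open>Some element \<open>a\<close> of the crossed product shifts the \<open>p j\<close>, and then \<open>\<psi> a = P A P\<^sup>-\<^sup>1\<close>. So this matrix lies in the
image of \<open>\<psi>\<close>, its chosen preimage \<open>x\<close> has that matrix, and \<open>P A P\<^sup>-\<^sup>1 P = P A\<close> says that \<open>x\<close> shifts the \<open>p j\<close>.\<close>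

lemma x_facts: shows x_in_A: "x \<in> A" and x_shift: "j < n \<Longrightarrow> rho x (p j) = p (Suc j mod n)"
proof -
  have x_eq: "x = inv_into A \<psi> shift_mat"
    unfolding x_e_def Let_def n_eq fixed_field_eq QNe_carrier shift_mat_def P_mat_eq cycle_mat_def inv_P ..
  obtain a where a: "a \<in> A" "\<And>j. j < n \<Longrightarrow> rho a (p j) = p (Suc j mod n)"
    using rho_p_surjective[of "\<lambda>j. p (Suc j mod n)"] p_E n_pos by auto
  have "\<psi> a = shift_mat"
  proof (rule psi_char[OF a(1) shift_mat_carrier])
    fix j assume j: "j < n"
    have "\<beta> j = column (scalar_mat P_coeff \<otimes>\<^bsub>MR\<^esub> scalar_mat P_inv_coeff) j" unfolding P_inverse using column_one[OF j] by simp
    also have "\<dots> = (\<Sum>l<n. scalar_mat P_inv_coeff (l, j) \<star> p l)"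
      unfolding column_mult[OF scalar_mat_carrier scalar_mat_carrier j] by (rule sum.cong[OF refl]) (simp add: column_P)
    finally have "rho a (\<beta> j) = (\<Sum>l<n. rho a (scalar_mat P_inv_coeff (l, j) \<star> p l))" by (simp add: rho_sum)
    also have "\<dots> = (\<Sum>l<n. scalar_mat P_inv_coeff (l, j) \<star> column (scalar_mat P_coeff \<otimes>\<^bsub>MR\<^esub> cycle_mat) l)"
    proof (rule sum.cong[OF refl])
      fix l assume "l \<in> {..<n}"
      then have l: "l < n" by simp
      show "rho a (scalar_mat P_inv_coeff (l, j) \<star> p l) = scalar_mat P_inv_coeff (l, j) \<star> column (scalar_mat P_coeff \<otimes>\<^bsub>MR\<^esub> cycle_mat) l"
        using rho_F[OF a(1) mat_entry[OF scalar_mat_carrier l j] p_E[OF l]] a(2)[OF l] column_PA[OF l] by simp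
    qed
    also have "\<dots> = column shift_mat j" unfolding shift_mat_def
      by (rule column_mult[OF mat_mult_closed[OF scalar_mat_carrier cycle_mat_carrier] scalar_mat_carrier j, symmetric])
    finally show "rho a (\<beta> j) = column shift_mat j" .
  qed
  then have shift_mat_img: "shift_mat \<in> \<psi> ` A" by (intro image_eqI[of _ _ a] a(1)) (rule sym)
  show xA: "x \<in> A" unfolding x_eq using shift_mat_img by (rule inv_into_into)
  have psi_x: "\<psi> x = shift_mat" unfolding x_eq using shift_mat_img by (rule f_inv_into_f)
  show "rho x (p j) = p (Suc j mod n)" if j: "j < n"
  proof -
    have "rho x (p j) = rho x (\<Sum>l<n. scalar_mat P_coeff (l, j) \<star> \<beta> l)" unfolding column_P[OF j, symmetric] column_def ..
    also have "\<dots> = (\<Sum>l<n. scalar_mat P_coeff (l, j) \<star> column shift_mat l)" unfolding rho_sum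
    proof (rule sum.cong[OF refl])
      fix l assume "l \<in> {..<n}"
      then have l: "l < n" by simp
      show "rho x (scalar_mat P_coeff (l, j) \<star> \<beta> l) = scalar_mat P_coeff (l, j) \<star> column shift_mat l"
        using rho_F[OF xA mat_entry[OF scalar_mat_carrier l j] \<beta>_E[OF l]] psi_column[OF xA l] psi_x by simp
    qed
    also have "\<dots> = column (shift_mat \<otimes>\<^bsub>MR\<^esub> scalar_mat P_coeff) j"
      by (rule column_mult[OF shift_mat_carrier scalar_mat_carrier j, symmetric])
    also have "\<dots> = p (Suc j mod n)" unfolding shift_mat_P by (rule column_PA[OF j])
    finally show ?thesis .
  qed
qed

end

section \<open>The orthogonal primitive idempotents\<close>

lemma int_pow_via_nat:
  assumes "monoid M" and x: "x \<in> carrier M" and n: "n > 0" "x [^]\<^bsub>M\<^esub> (n::nat) = \<one>\<^bsub>M\<^esub>"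
  shows "x [^]\<^bsub>M\<^esub> (i::int) = x [^]\<^bsub>M\<^esub> nat (i mod int n)"
proof -
  interpret monoid M by fact
  have mult: "x [^]\<^bsub>M\<^esub> (n * q) = \<one>\<^bsub>M\<^esub>" for q using nat_pow_pow[OF x, of n q] n(2) by simp
  show ?thesis
  proof (cases "i < 0")
    case False
    define m where "m = nat i"
    have "x [^]\<^bsub>M\<^esub> m = x [^]\<^bsub>M\<^esub> (n * (m div n) + m mod n)" by (simp only: mult_div_mod_eq)
    also have "\<dots> = x [^]\<^bsub>M\<^esub> (m mod n)" unfolding nat_pow_mult[OF x, symmetric] mult using x by simp
    finally have "x [^]\<^bsub>M\<^esub> m = x [^]\<^bsub>M\<^esub> (m mod n)" .
    moreover have "nat (i mod int n) = m mod n" using False by (simp add: m_def nat_mod_distrib)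
    moreover have "x [^]\<^bsub>M\<^esub> i = x [^]\<^bsub>M\<^esub> m" unfolding int_pow_def2 m_def if_not_P[OF False] ..
    ultimately show ?thesis by (simp only:)
  next
    case True
    define m where "m = nat (- i)"
    define r where "r = nat (i mod int n)"
    have "int m + int r = - i + i mod int n" using True n(1) by (simp add: m_def r_def)
    also have "\<dots> = int n * (- (i div int n))" using div_mult_mod_eq[of i "int n"] by (simp add: algebra_simps)
    finally have eq: "int (m + r) = int n * (- (i div int n))" by simp
    then have "int n dvd int (m + r)" by simp
    then have "n dvd m + r" by (simp only: of_nat_dvd_iff)
    then obtain q where q: "m + r = n * q" by blast
    have "x [^]\<^bsub>M\<^esub> m \<otimes>\<^bsub>M\<^esub> x [^]\<^bsub>M\<^esub> r = \<one>\<^bsub>M\<^esub>" "x [^]\<^bsub>M\<^esub> r \<otimes>\<^bsub>M\<^esub> x [^]\<^bsub>M\<^esub> m = \<one>\<^bsub>M\<^esub>"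
      using q mult nat_pow_mult[OF x] by (simp_all add: add.commute[of r m])
    then have "inv\<^bsub>M\<^esub> (x [^]\<^bsub>M\<^esub> m) = x [^]\<^bsub>M\<^esub> r" using x by (intro inv_char) auto
    then show ?thesis unfolding int_pow_def2 m_def r_def if_P[OF True] .
  qed
qed

context strong_shoda
begin

text \<open>Elements outside \<open>N\<close> conjugate \<open>\<epsilon>\<close> to a different, hence orthogonal, idempotent.\<close>

lemma eps_delta_eps:
  assumes g: "g \<in> carrier G" shows "g \<in> N \<Longrightarrow> \<epsilon> \<star> (\<delta> g \<star> \<epsilon>) = \<delta> g \<star> \<epsilon>"
    and "g \<notin> N \<Longrightarrow> \<epsilon> \<star> (\<delta> g \<star> \<epsilon>) = 0"
proof -
  show "g \<in> N \<Longrightarrow> \<epsilon> \<star> (\<delta> g \<star> \<epsilon>) = \<delta> g \<star> \<epsilon>" using A_eps(2)[OF delta_eps_A] .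
  assume gN: "g \<notin> N"
  have c: "\<epsilon> \<in> conjugates G \<epsilon>" "conjugate g \<epsilon> \<in> conjugates G \<epsilon>"
    using g conjugate_one[OF N_central_on_G[OF eps_N_central]] by (auto simp: conjugates_def intro: rev_image_eqI[OF one_closed])
  have "\<epsilon> \<noteq> conjugate g \<epsilon>" using centralizer_eps[OF g] gN by metis
  then have "\<epsilon> \<star> conjugate g \<epsilon> = 0"
    using ssp c unfolding strong_shoda_pair_def zero_group_algebra by blast
  then have "\<epsilon> \<star> conjugate g \<epsilon> \<star> \<delta> g = 0" by simp
  then show "\<epsilon> \<star> (\<delta> g \<star> \<epsilon>) = 0" by (simp only: delta_conv_swap[OF g, of \<epsilon>] conv_assoc)
qed

lemma eps_corner: assumes a: "a \<in> functions_on (carrier G)" shows "\<epsilon> \<star> (a \<star> \<epsilon>) \<in> A"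
proof -
  have "\<epsilon> \<star> (a \<star> \<epsilon>) = (\<Sum>g\<in>carrier G. a g *\<^sub>Q (\<epsilon> \<star> (\<delta> g \<star> \<epsilon>)))"
    by (subst basis_expansion[OF fin a]) (simp only: conv_linear)
  also have "\<dots> \<in> A"
  proof (intro A_closed(7) A_closed(4))
    fix g assume "g \<in> carrier G"
    then show "\<epsilon> \<star> (\<delta> g \<star> \<epsilon>) \<in> A" using eps_delta_eps delta_eps_A A_closed(1) by (cases "g \<in> N") auto
  qed
  finally show ?thesis .
qed

end

locale shoda_idempotents = normal_basis +
  fixes T2 :: "'a set"
  assumes T2: "right_transversal G N T2"
begin

abbreviation xp :: "nat \<Rightarrow> 'a \<Rightarrow> rat" where "xp m \<equiv> x [^]\<^bsub>QNe G H K\<^esub> m"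

lemma QNe_monoid: "monoid (QNe G H K)"
  by (rule monoidI) (simp_all add: QNe_carrier A_closed conv_assoc A_eps)

lemma xp_A: "xp m \<in> A"
  using monoid.nat_pow_closed[OF QNe_monoid, of x m] x_in_A by (simp add: QNe_carrier)

lemma xp_Suc: "xp (Suc m) = xp m \<star> x" and xp_0: "xp 0 = \<epsilon>"
  by (simp_all add: nat_pow_def)

lemma rho_xp: "j < n \<Longrightarrow> rho (xp m) (p j) = p ((j + m) mod n)"
proof (induction m arbitrary: j)
  case 0
  then show ?case using rho_eps[OF p_E] by (simp add: xp_0)
next
  case (Suc m)
  have j': "Suc j mod n < n" using n_pos by simp
  have "rho (xp (Suc m)) (p j) = rho (xp m) (p (Suc j mod n))"
    unfolding xp_Suc rho_mult[OF xp_A x_in_A p_E[OF Suc.prems]] x_shift[OF Suc.prems] ..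
  also have "\<dots> = p ((j + Suc m) mod n)" unfolding Suc.IH[OF j'] by (simp add: mod_simps)
  finally show ?case .
qed

lemma xp_n: "xp n = \<epsilon>"
  by (rule rho_p_eqI[OF xp_A A_closed(6)]) (simp add: rho_xp rho_eps p_E)

text \<open>The conjugate of \<open>f\<close> by the \<open>m\<close>-th power of \<open>x\<close>. Since \<open>x\<close> has order dividing \<open>n\<close>, the inverse power is written
with the exponent \<open>n - m\<close>.\<close>

definition prim :: "nat \<Rightarrow> 'a \<Rightarrow> rat" where "prim m = xp m \<star> f \<star> xp (n - m)"

lemma prim_in_A: "prim m \<in> A" unfolding prim_def by (intro A_closed(5) xp_A f_in_A)

text \<open>The inverse power moves \<open>p m\<close> to \<open>p 0\<close>, \<open>f\<close> keeps only \<open>p 0\<close>, and the power moves it back.\<close>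

lemma rho_prim:
  assumes j: "j < n" and m: "m < n" shows "rho (prim m) (p j) = (if j = m then p m else 0)"
proof -
  define i where "i = (j + (n - m)) mod n"
  have i: "i < n" using n_pos by (simp add: i_def)
  have i0: "i = 0 \<longleftrightarrow> j = m"
  proof
    assume "i = 0"
    then have "n dvd j + (n - m)" by (simp add: i_def dvd_eq_mod_eq_0)
    then obtain q where q: "j + (n - m) = n * q" by blast
    have "0 < n * q" "n * q < n * 2" using q j m by linarith+
    then have "q = 1" by simp
    then show "j = m" using q m by simp
  qed (use m in \<open>simp add: i_def\<close>)
  have "rho (prim m) (p j) = rho (xp m) (rho f (p i))"
    unfolding prim_def rho_mult[OF A_closed(5)[OF xp_A f_in_A] xp_A p_E[OF j]] rho_xp[OF j] i_def[symmetric]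
    by (rule rho_mult[OF xp_A f_in_A p_E[OF i]])
  also have "\<dots> = (if i = 0 then rho (xp m) (p 0) else rho (xp m) 0)" unfolding rho_f_p[OF i] by simp
  also have "rho (xp m) (p 0) = p m" using rho_xp[OF n_pos, of m] m by simp
  also have "rho (xp m) 0 = 0" by (rule rho_zero)
  finally show ?thesis using i0 by simp
qed

lemma prim_mult: assumes "m < n" "l < n" shows "prim m \<star> prim l = (if m = l then prim m else 0)"
proof (rule rho_p_eqI)
  show "prim m \<star> prim l \<in> A" "(if m = l then prim m else 0) \<in> A" using prim_in_A A_closed(1,5) by auto
  fix j assume j: "j < n"
  show "rho (prim m \<star> prim l) (p j) = rho (if m = l then prim m else 0) (p j)"
    unfolding rho_mult[OF prim_in_A prim_in_A p_E[OF j]] using rho_prim[OF j assms(2)] rho_prim[OF j assms(1)] rho_prim[OF assms(2) assms(1)] rho_prim[OF assms(2) assms(2)] by (simp add: rho_zero)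
qed

lemma prim_sum: "(\<Sum>m<n. prim m) = \<epsilon>"
proof (rule rho_p_eqI[OF A_closed(7)[OF prim_in_A] A_closed(6)])
  fix j assume j: "j < n"
  have sum_rho: "rho (\<Sum>m\<in>I. prim m) v = (\<Sum>m\<in>I. rho (prim m) v)" if "finite I" for I v
    using that
  proof (induction I)
    case empty
    show ?case unfolding sum.empty by (rule rho_zero)
  next
    case (insert i I)
    show ?case unfolding sum.insert[OF insert(1,2)] rho_linear(1) insert(3) ..
  qed
  have "rho (\<Sum>m<n. prim m) (p j) = (\<Sum>m<n. if m = j then p j else 0)"
    unfolding sum_rho[OF finite_lessThan] by (rule sum.cong[OF refl]) (auto simp: rho_prim j)
  also have "\<dots> = p j" using j by simp
  finally show "rho (\<Sum>m<n. prim m) (p j) = rho \<epsilon> (p j)" using rho_eps[OF p_E[OF j]] by simp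
qed

lemma prim_nonzero: assumes m: "m < n" shows "prim m \<noteq> 0"
proof
  assume "prim m = 0"
  then have "rho (prim m) (p m) = 0" by (simp only: rho_zero)
  then show False using rho_prim[OF m m] p_nonzero[OF m] by simp
qed

text \<open>In the corner, \<open>g\<close> acts on the line \<open>F (p m)\<close> by a scalar \<open>c\<close> and kills the other \<open>p j\<close>. From \<open>g\<^sup>2 = g\<close>
follows \<open>c (c - \<epsilon>) = 0\<close>, so \<open>c\<close> is \<open>0\<close> or \<open>\<epsilon>\<close>.\<close>

lemma prim_corner_idempotent:
  assumes m: "m < n" and g: "g \<in> A" "g \<star> g = g" "prim m \<star> g \<star> prim m = g"
  shows "g = 0 \<or> g = prim m"
proof -
  have dec: "rho g (p j) = rho (prim m) (rho g (rho (prim m) (p j)))" if j: "j < n" for j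
    using rho_mult[OF A_closed(5)[OF prim_in_A g(1)] prim_in_A p_E[OF j], of m m]
      rho_mult[OF prim_in_A g(1) rho_in_E[OF prim_in_A p_E[OF j]], of m m] g(3) by simp
  have off: "rho g (p j) = 0" if j: "j < n" "j \<noteq> m" for j
    using dec[OF j(1)] rho_prim[OF j(1) m] j(2) by (simp add: rho_zero)
  obtain c where c: "\<And>i. i < n \<Longrightarrow> c i \<in> F" "rho g (p m) = (\<Sum>i<n. c i \<star> p i)"
    using p_span[OF rho_in_E[OF g(1) p_E[OF m]]] by blast
  have diag: "rho g (p m) = c m \<star> p m"
  proof -
    have "rho g (p m) = rho (prim m) (rho g (p m))" using dec[OF m] rho_prim[OF m m] by simp
    also have "\<dots> = (\<Sum>i<n. rho (prim m) (c i \<star> p i))" unfolding c(2) by (rule rho_sum)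
    also have "\<dots> = (\<Sum>i<n. if i = m then c m \<star> p m else 0)"
    proof (rule sum.cong[OF refl])
      fix i assume "i \<in> {..<n}"
      then have i: "i < n" by simp
      show "rho (prim m) (c i \<star> p i) = (if i = m then c m \<star> p m else 0)"
        using rho_F[OF prim_in_A c(1)[OF i] p_E[OF i]] rho_prim[OF i m] by simp
    qed
    also have "\<dots> = c m \<star> p m" using m by simp
    finally show ?thesis .
  qed
  have cE: "c m \<in> E" using F_E c(1) m by blast
  have "c m \<star> p m = rho g (rho g (p m))" using rho_mult[OF g(1) g(1) p_E[OF m]] g(2) diag by simp
  also have "\<dots> = c m \<star> (c m \<star> p m)" unfolding diag rho_F[OF g(1) c(1)[OF m] p_E[OF m]] ..
  \<comment> \<open>This is \<open>g (p m) = g (g (p m))\<close>.\<close>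
  finally have "(c m \<star> (c m - \<epsilon>)) \<star> p m = 0"
    using E_eps(1)[OF cE] by (simp add: conv_linear conv_assoc)
  then have "c m \<star> (c m - \<epsilon>) = 0"
    using E_domain[OF E_closed(5)[OF cE E_closed(3)[OF cE E_closed(6)]] p_E[OF m]] p_nonzero[OF m] by blast
  then have "c m = 0 \<or> c m - \<epsilon> = 0" using E_domain[OF cE E_closed(3)[OF cE E_closed(6)]] by blast
  then show ?thesis
  proof
    assume "c m = 0"
    have "g = 0"
    proof (rule rho_p_eqI[OF g(1) A_closed(1)])
      fix j assume "j < n"
      then show "rho g (p j) = rho 0 (p j)"
        using off diag \<open>c m = 0\<close> by (cases "j = m") (simp_all add: rho_zero)
    qed
    then show ?thesis by simp
  next
    assume "c m - \<epsilon> = 0"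
    then have cm: "c m = \<epsilon>" by simp
    have "g = prim m"
    proof (rule rho_p_eqI[OF g(1) prim_in_A])
      fix j assume "j < n"
      then show "rho g (p j) = rho (prim m) (p j)"
        using off diag E_eps(2)[OF p_E[OF m]] rho_prim[OF _ m] by (cases "j = m") (simp_all add: cm)
    qed
    then show ?thesis by simp
  qed
qed

lemma T2_G: "t \<in> T2 \<Longrightarrow> t \<in> carrier G"
  using T2 by (auto simp: right_transversal_def)

lemma fin_T2: "finite T2" using finite_subset_G T2_G by blast

lemma T2_exists: assumes g: "g \<in> carrier G" obtains t m where "t \<in> T2" "m \<in> N" "t = g \<otimes> m"
proof -
  obtain t where "t \<in> T2" "t \<in> g <# N" using T2 g by (auto simp: right_transversal_def)
  then show thesis using that by (auto simp: l_coset_def)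
qed

lemma T2_unique: assumes s: "s \<in> T2" and t: "t \<in> T2" and st: "inv s \<otimes> t \<in> N" shows "s = t"
proof -
  have G: "s \<in> carrier G" "t \<in> carrier G" using T2_G s t by auto
  have "t = s \<otimes> (inv s \<otimes> t)" "s = s \<otimes> \<one>" using G by (simp_all add: m_assoc[symmetric])
  then have "t \<in> s <# N" "s \<in> s <# N" using st subgroup.one_closed[OF sub_N] unfolding l_coset_def by blast+
  then show ?thesis using T2 s t G unfolding right_transversal_def by blast
qed

abbreviation e :: "'a \<Rightarrow> rat" where "e \<equiv> pci G H K"

text \<open>For \<open>s \<noteq> t\<close> in \<open>T2\<close> the element \<open>s\<^sup>-\<^sup>1 t\<close> is not in \<open>N\<close>, so \<open>\<epsilon> s\<^sup>-\<^sup>1 t \<epsilon> = 0\<close> in the middle of the product.\<close>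

lemma conj_orth:
  assumes s: "s \<in> T2" and t: "t \<in> T2" and ne: "s \<noteq> t" and a: "a \<in> A" and b: "b \<in> A"
  shows "conjugate s a \<star> conjugate t b = 0"
proof -
  have G: "s \<in> carrier G" "t \<in> carrier G" using T2_G s t by auto
  have "inv s \<otimes> t \<notin> N" using T2_unique[OF s t] ne by blast
  then have z: "\<epsilon> \<star> (\<delta> (inv s \<otimes> t) \<star> \<epsilon>) = 0" using eps_delta_eps(2)[of "inv s \<otimes> t"] G by simp
  have "conjugate s a \<star> conjugate t b = \<delta> s \<star> a \<star> (\<delta> (inv s) \<star> (\<delta> t \<star> (b \<star> \<delta> (inv t))))"
    by (simp add: conj_by_def conv_assoc)
  also have "\<dots> = \<delta> s \<star> (a \<star> \<epsilon>) \<star> (\<delta> (inv s \<otimes> t) \<star> ((\<epsilon> \<star> b) \<star> \<delta> (inv t)))"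
    using G A_eps(1)[OF a] A_eps(2)[OF b] by (simp add: delta_mult_assoc)
  also have "\<dots> = \<delta> s \<star> a \<star> (\<epsilon> \<star> (\<delta> (inv s \<otimes> t) \<star> \<epsilon>)) \<star> (b \<star> \<delta> (inv t))" by (simp add: conv_assoc)
  finally show ?thesis unfolding z by simp
qed

lemma e_eq: "e = (\<Sum>t\<in>T2. conjugate t \<epsilon>)"
proof -
  have inj: "inj_on (\<lambda>t. conjugate t \<epsilon>) T2"
  proof (rule inj_onI, rule ccontr)
    fix s t assume st: "s \<in> T2" "t \<in> T2" "conjugate s \<epsilon> = conjugate t \<epsilon>" "s \<noteq> t"
    then have "conjugate s \<epsilon> \<star> conjugate s \<epsilon> = 0" using conj_orth[OF st(1,2,4) A_closed(6) A_closed(6)] by simp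
    then have "conjugate s \<epsilon> = 0" using conjugate_mult[OF T2_G[OF st(1)], of \<epsilon> \<epsilon>] eps_idem by simp
    then have "conjugate (inv s) (conjugate s \<epsilon>) = 0" by (simp only: conjugate_linear)
    then show False using conjugate_conjugate[of "inv s" s \<epsilon>] T2_G[OF st(1)] conjugate_one[OF N_central_on_G[OF eps_N_central]] eps_nonzero by simp
  qed
  have img: "conjugates G \<epsilon> = (\<lambda>t. conjugate t \<epsilon>) ` T2"
  proof (intro equalityI subsetI)
    fix c assume "c \<in> conjugates G \<epsilon>"
    then obtain g where g: "g \<in> carrier G" "c = conjugate g \<epsilon>" by (auto simp: conjugates_def)
    obtain t m where t: "t \<in> T2" "m \<in> N" "t = g \<otimes> m" using T2_exists[OF g(1)] .
    have "conjugate t \<epsilon> = conjugate g (conjugate m \<epsilon>)" using conjugate_conjugate[OF g(1) memG(1)[OF t(2)]] t(3) by simp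
    then have "c = conjugate t \<epsilon>" using conj_eps[OF t(2)] g(2) by simp
    then show "c \<in> (\<lambda>t. conjugate t \<epsilon>) ` T2" using t(1) by (rule image_eqI)
  qed (use T2_G in \<open>auto simp: conjugates_def\<close>)
  have "e = (\<Sum>a\<in>conjugates G \<epsilon>. a)"
    unfolding pci_def by (rule finsum_group_algebra) (auto simp: conjugates_def conjugate_closed)
  also have "\<dots> = (\<Sum>t\<in>T2. conjugate t \<epsilon>)" unfolding img by (simp only: sum.reindex[OF inj] o_def)
  finally show ?thesis .
qed

lemma conj_A_e: assumes t: "t \<in> T2" and a: "a \<in> A" shows "conjugate t a \<star> e = conjugate t a"
proof -
  have "conjugate t a \<star> e = (\<Sum>s\<in>T2. if s = t then conjugate t a else 0)"
    unfolding e_eq conv_sum_right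
  proof (rule sum.cong[OF refl])
    fix s assume s: "s \<in> T2"
    show "conjugate t a \<star> conjugate s \<epsilon> = (if s = t then conjugate t a else 0)"
      using conj_orth[OF t s _ a A_closed(6)] conjugate_mult[OF T2_G[OF t], of a \<epsilon>] A_eps(1)[OF a] by auto
  qed
  then show ?thesis using t fin_T2 by simp
qed

lemma QGe_carrier: "carrier (alg_component G (carrier G) e) = {a \<in> functions_on (carrier G). a \<star> e = a}"
proof (rule alg_component_carrier[OF subgroup_self])
  have "e \<star> e = (\<Sum>t\<in>T2. conjugate t \<epsilon> \<star> e)" by (subst (1) e_eq) (rule conv_sum_left)
  also have "\<dots> = e" unfolding e_eq[symmetric] by (subst (2) e_eq) (rule sum.cong[OF refl], rule conj_A_e[OF _ A_closed(6)])
  finally show "e \<star> e = e" .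
qed (rule conv_closed)

definition family :: "('a \<Rightarrow> rat) set" where
  "family = (\<lambda>(t, m). conjugate t (prim m)) ` (T2 \<times> {..<n})"

lemma family_mult:
  assumes "t \<in> T2" "s \<in> T2" "m < n" "l < n"
  shows "conjugate t (prim m) \<star> conjugate s (prim l) = (if t = s \<and> m = l then conjugate t (prim m) else 0)"
proof (cases "t = s")
  case True
  then show ?thesis
    using conjugate_mult[OF T2_G[OF assms(1)], of "prim m" "prim l", symmetric] prim_mult[OF assms(3,4)] conjugate_linear(6) by simp
next
  case False
  then show ?thesis using conj_orth[OF assms(1,2) False prim_in_A prim_in_A] by simp
qed

lemma conj_nonzero: assumes t: "t \<in> carrier G" and a: "a \<in> functions_on (carrier G)" "a \<noteq> 0" shows "conjugate t a \<noteq> 0"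
proof
  assume "conjugate t a = 0"
  then have "conjugate (inv t) (conjugate t a) = 0" by (simp only: conjugate_linear)
  then show False using conjugate_conjugate[of "inv t" t a] t conjugate_one[OF a(1)] a(2) by simp
qed

lemma family_inj: "inj_on (\<lambda>(t, m). conjugate t (prim m)) (T2 \<times> {..<n})"
proof (rule inj_onI)
  fix a b assume ab: "a \<in> T2 \<times> {..<n}" "b \<in> T2 \<times> {..<n}"
    "(\<lambda>(t, m). conjugate t (prim m)) a = (\<lambda>(t, m). conjugate t (prim m)) b"
  obtain t m where a: "a = (t, m)" by (cases a)
  obtain s l where b: "b = (s, l)" by (cases b)
  have *: "t \<in> T2" "m \<in> {..<n}" "s \<in> T2" "l \<in> {..<n}" "conjugate t (prim m) = conjugate s (prim l)"
    using ab by (auto simp: a b)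
  have m: "m < n" "l < n" using * by simp_all
  have "conjugate t (prim m) = conjugate t (prim m) \<star> conjugate s (prim l)"
    unfolding *(5)[symmetric] using family_mult[OF *(1) *(1) m(1) m(1)] by simp
  moreover have "conjugate t (prim m) \<noteq> 0"
    using conj_nonzero[OF T2_G[OF *(1)] A_on_G[OF prim_in_A] prim_nonzero[OF m(1)]] .
  ultimately show "a = b"
    unfolding family_mult[OF *(1,3) m] a b by (cases "t = s \<and> m = l") simp_all
qed

text \<open>If \<open>t q t\<^sup>-\<^sup>1 = a + b\<close> with orthogonal idempotents \<open>a\<close> and \<open>b\<close>, where \<open>q\<close> is one of the projections, then \<open>g = t\<^sup>-\<^sup>1 a t\<close>
satisfies \<open>g = q g q\<close>. In particular \<open>g = \<epsilon> g \<epsilon>\<close> lies in \<open>\<rat>N\<epsilon>\<close>, where the corner of \<open>q\<close> has only the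
idempotents \<open>0\<close> and \<open>q\<close>.\<close>

lemma family_primitive:
  assumes t: "t \<in> T2" and m: "m < n"
  shows "primitive_idempotent (alg_component G (carrier G) e) (conjugate t (prim m))"
proof -
  let ?R = "alg_component G (carrier G) e" and ?f = "conjugate t (prim m)"
  have tG: "t \<in> carrier G" using T2_G[OF t] .
  have idem: "?f \<star> ?f = ?f" using family_mult[OF t t m m] by simp
  have "?f \<in> idempotents ?R"
    using idem conj_A_e[OF t prim_in_A] conjugate_closed by (simp add: idempotents_def QGe_carrier)
  moreover have "?f \<noteq> \<zero>\<^bsub>?R\<^esub>" using conj_nonzero[OF tG A_on_G[OF prim_in_A] prim_nonzero[OF m]] by simp
  moreover have False if ab: "a \<in> idempotents ?R" "b \<in> idempotents ?R" "a \<noteq> \<zero>\<^bsub>?R\<^esub>" "b \<noteq> \<zero>\<^bsub>?R\<^esub>"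
    "orthogonal ?R a b" "?f = a \<oplus>\<^bsub>?R\<^esub> b" for a b
  proof -
    have f: "?f = a + b" and orth: "a \<star> b = 0" "b \<star> a = 0" and aa: "a \<star> a = a" and nz: "a \<noteq> 0" "b \<noteq> 0"
      and a: "a \<in> functions_on (carrier G)"
      using ab by (auto simp: orthogonal_def idempotents_def QGe_carrier)
    have af: "a \<star> ?f = a" "?f \<star> a = a" unfolding f by (simp_all add: conv_linear orth aa)
    define g where "g = conjugate (inv t) a"
    have conj_back: "conjugate (inv t) (conjugate t c) = c" if "c \<in> functions_on (carrier G)" for c
      using conjugate_conjugate[of "inv t" t c] tG conjugate_one[OF that] by simp
    have conj_forth: "conjugate t g = a"
      unfolding g_def using conjugate_conjugate[of t "inv t" a] tG conjugate_one[OF a] by simp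
    have inv_t: "inv t \<in> carrier G" using tG by simp
    have f_prim: "conjugate (inv t) ?f = prim m" using conj_back[OF A_on_G[OF prim_in_A]] .
    have g_prim: "g \<star> prim m = g" "prim m \<star> g = g"
      using conjugate_mult[OF inv_t, of a ?f] conjugate_mult[OF inv_t, of ?f a] af f_prim by (simp_all add: g_def)
    have gg_eq: "g \<star> g = g" using conjugate_mult[OF inv_t, of a a] aa by (simp add: g_def)
    have "\<epsilon> \<star> (g \<star> \<epsilon>) = \<epsilon> \<star> prim m \<star> (g \<star> (prim m \<star> \<epsilon>))"
      using g_prim by (metis conv_assoc)
    also have "\<dots> = g" using g_prim A_eps[OF prim_in_A] by simp
    finally have "g \<in> A" using eps_corner[of g] conjugate_closed by (simp add: g_def)
    then have "g = 0 \<or> g = prim m" using prim_corner_idempotent[OF m _ gg_eq] g_prim by (simp add: conv_assoc)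
    then show False
    proof
      assume "g = 0"
      then have "a = 0" using conj_forth conjugate_linear(6) by simp
      then show False using nz by simp
    next
      assume "g = prim m"
      then have "a = ?f" using conj_forth by simp
      then show False using f nz by simp
    qed
  qed
  ultimately show ?thesis unfolding primitive_idempotent_def by blast
qed

lemma family_complete: "complete_orthogonal_primitive (alg_component G (carrier G) e) family"
proof -
  let ?R = "alg_component G (carrier G) e"
  have fin_family: "finite family" using fin_T2 by (simp add: family_def)
  have R: "abelian_group ?R"
    by (rule abelian_group_alg_component) (auto simp: QGe_carrier functions_on_closed conv_linear)
  have family_in_carrier: "a \<in> carrier ?R" if "a \<in> family" for a
    using that conj_A_e prim_in_A conjugate_closed by (auto simp: family_def QGe_carrier)
  have "finsum ?R (\<lambda>a. a) family = (\<Sum>a\<in>family. a)"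
    by (rule finsum_eq_sum[OF abelian_group.axioms(1)[OF R] alg_component_add alg_component_zero family_in_carrier])
  also have "\<dots> = (\<Sum>(t, m)\<in>T2 \<times> {..<n}. conjugate t (prim m))"
    unfolding family_def sum.reindex[OF family_inj] by (simp only: o_def id_def case_prod_unfold)
  also have "\<dots> = (\<Sum>t\<in>T2. \<Sum>m<n. conjugate t (prim m))" by (rule sum.cartesian_product[symmetric])
  also have "\<dots> = (\<Sum>t\<in>T2. conjugate t \<epsilon>)"
    by (rule sum.cong[OF refl]) (simp only: conjugate_linear(5)[symmetric] prim_sum)
  finally have sum: "finsum ?R (\<lambda>a. a) family = \<one>\<^bsub>?R\<^esub>" unfolding e_eq[symmetric] by simp
  have prim: "primitive_idempotent ?R a" if "a \<in> family" for a
    using that family_primitive by (auto simp: family_def)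
  have orth: "orthogonal ?R a b" if ab: "a \<in> family" "b \<in> family" "a \<noteq> b" for a b
  proof -
    obtain t m where t: "t \<in> T2" "m < n" "a = conjugate t (prim m)" using ab(1) by (auto simp: family_def)
    obtain s l where s: "s \<in> T2" "l < n" "b = conjugate s (prim l)" using ab(2) by (auto simp: family_def)
    have "\<not> (t = s \<and> m = l)" using ab(3) t(3) s(3) by auto
    then have "a \<star> b = 0" "b \<star> a = 0" unfolding t(3) s(3) using family_mult[OF t(1) s(1) t(2) s(2)] family_mult[OF s(1) t(1) s(2) t(2)] by auto
    then show ?thesis by (simp add: orthogonal_def)
  qed
  show ?thesis unfolding complete_orthogonal_primitive_def using fin_family prim orth sum by blast
qed

text \<open>Since \<open>x\<^sup>n = \<epsilon>\<close>, integer exponents may be reduced modulo \<open>n\<close>, which leaves finitely many conjugates.\<close>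

lemma family_eq:
  "{\<delta> t \<star> x [^]\<^bsub>QNe G H K\<^esub> i \<star> (hat T \<star> \<epsilon>) \<star> (x [^]\<^bsub>QNe G H K\<^esub> (- i) \<star> \<delta> (inv t)) | t (i :: int). t \<in> T2} = family"
proof -
  have pow: "x [^]\<^bsub>QNe G H K\<^esub> i = xp (nat (i mod int n))" for i :: int
    by (rule int_pow_via_nat[OF QNe_monoid _ n_pos]) (simp_all add: QNe_carrier x_in_A xp_n)
  have neg: "xp (nat (- i mod int n)) = xp (n - nat (i mod int n))" for i
  proof (cases "i mod int n = 0")
    case True
    then have "- i mod int n = 0" by (simp add: zmod_zminus1_eq_if)
    then show ?thesis using True xp_n xp_0 by simp
  next
    case False
    then have "- i mod int n = int n - i mod int n" by (simp add: zmod_zminus1_eq_if)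
    moreover have "i mod int n \<ge> 0" using n_pos by simp
    ultimately have "nat (- i mod int n) = n - nat (i mod int n)" by linarith
    then show ?thesis by simp
  qed
  have elt: "\<delta> t \<star> x [^]\<^bsub>QNe G H K\<^esub> i \<star> (hat T \<star> \<epsilon>) \<star> (x [^]\<^bsub>QNe G H K\<^esub> (- i) \<star> \<delta> (inv t)) =
     conjugate t (prim (nat (i mod int n)))" for t and i :: int
    unfolding pow neg by (simp add: conj_by_def prim_def f_def conv_assoc)
  have lt: "nat (i mod int n) < n" for i :: int using n_pos by (simp add: nat_less_iff)
  show ?thesis unfolding elt
  proof (intro equalityI subsetI)
    fix a assume "a \<in> {conjugate t (prim (nat (i mod int n))) | t (i :: int). t \<in> T2}"
    then obtain t and i :: int where "t \<in> T2" "a = conjugate t (prim (nat (i mod int n)))" by blast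
    then show "a \<in> family" unfolding family_def using lt[of i] by (intro image_eqI[of _ _ "(t, nat (i mod int n))"]) auto
  next
    fix a assume "a \<in> family"
    then obtain t m where "t \<in> T2" "m < n" "a = conjugate t (prim m)" by (auto simp: family_def)
    then have "t \<in> T2" "a = conjugate t (prim (nat (int m mod int n)))" by (simp_all add: zmod_int[symmetric])
    then show "a \<in> {conjugate t (prim (nat (i mod int n))) | t (i :: int). t \<in> T2}" by blast
  qed
qed

end

theorem theorem4p1:
  fixes G :: "('a, 'b) monoid_scheme"
    and H K N T\<^sub>1 T\<^sub>2 :: "'a set"
    and \<phi> :: "'a set \<Rightarrow> 'a set"
    and y :: 'a
    and \<zeta> :: complex
    and \<epsilon> e w x :: "'a \<Rightarrow> rat"
    and bs :: "('a \<Rightarrow> rat) list"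
  assumes "group G" and "finite (carrier G)"
    and "strong_shoda_pair G H K"
    and N: "N = normalizer G K" and \<epsilon>: "\<epsilon> = eps G H K" and e: "e = pci G H K"
    and "y \<in> H" and "subgroup_generated (quot G H K) {K #>\<^bsub>G\<^esub> y} = quot G H K"
    and "primitive_root_of_unity (card (carrier (quot G H K))) \<zeta>"
    and "is_section G H K \<phi>"
    and "\<And>g g'. g \<in> N \<Longrightarrow> g' \<in> N \<Longrightarrow>
           twisting G H K \<phi> y \<zeta> (H #>\<^bsub>G\<^esub> g) (H #>\<^bsub>G\<^esub> g') = 1"
    and "normal_element (QHe G H K) (fixed_field G H K) w"
    and "distinct bs"
    and "set bs = (\<lambda>\<sigma>. \<sigma> w) ` Gal (QHe G H K) (fixed_field G H K)"
    and "transversal_lifting G H K \<phi> T\<^sub>1"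
    and "right_transversal G N T\<^sub>2"
    and x: "x = x_e G H K \<phi> bs"
  shows "complete_orthogonal_primitive (alg_component G (carrier G) e)
    {basis_elt t \<otimes>\<^bsub>group_algebra G\<^esub> x [^]\<^bsub>QNe G H K\<^esub> i
       \<otimes>\<^bsub>group_algebra G\<^esub> (hat T\<^sub>1 \<otimes>\<^bsub>group_algebra G\<^esub> \<epsilon>)
       \<otimes>\<^bsub>group_algebra G\<^esub> (x [^]\<^bsub>QNe G H K\<^esub> (- i) \<otimes>\<^bsub>group_algebra G\<^esub> basis_elt (inv\<^bsub>G\<^esub> t))
     | t (i :: int). t \<in> T\<^sub>2}"
proof -
  have "shoda_idempotents G H K y \<zeta> \<phi> T\<^sub>1 w bs T\<^sub>2"
    using assms
    by (simp add: shoda_idempotents_def shoda_idempotents_axioms_def normal_basis_def normal_basis_axioms_def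
        split_strong_shoda_def split_strong_shoda_axioms_def strong_shoda_def strong_shoda_axioms_def
        finite_group_def finite_group_axioms_def)
  then interpret shoda_idempotents G H K y \<zeta> \<phi> T\<^sub>1 w bs T\<^sub>2 .
  show ?thesis unfolding e \<epsilon> x family_eq by (rule family_complete)
qed

end
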